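(* Let $\Gamma$ be an admissible boundary of class $\mathcal{C}^2$ and let $z$ and $\boldsymbol{w}$ be boundary functions with $z(\Gamma)\in\mathcal{C}^2(\Gamma)$ and $\boldsymbol{w}(\Gamma)\in\mathcal{C}^2(\Gamma,\mathbb{R}^N)$ that are shape differentiable at $\Gamma$ in the direction $\boldsymbol{V}\in\mathcal{C}([0,\epsilon],V^2(\mathbf{D}))$. Then $D_\Gamma\boldsymbol{w}$ and $\operatorname{div}_\Gamma\boldsymbol{w}$ are also shape differentiable at $\Gamma$ in the direction $\boldsymbol{V}$, and, with $v_n=\boldsymbol{V}(0)\cdot\boldsymbol{n}$, $$(D_\Gamma\boldsymbol{w})'(\Gamma,\boldsymbol{V})=D_\Gamma\boldsymbol{w}'(\Gamma,\boldsymbol{V})+D_\Gamma\boldsymbol{w}\,[\nabla_\Gamma v_n\otimes\boldsymbol{n}-v_nD_\Gamma\boldsymbol{n}],$$ $$(\operatorname{div}_\Gamma\boldsymbol{w})'(\Gamma,\boldsymbol{V})=\operatorname{div}_\Gamma\boldsymbol{w}'(\Gamma,\boldsymbol{V})+[\boldsymbol{n}\otimes\nabla_\Gamma v_n-v_nD_\Gamma\boldsymbol{n}]:D_\Gamma\boldsymbol{w},$$ where $S:T=\operatorname{tr}(S^TT)$ denotes the scalar product of tensors.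
   Context: Velocity method: $\mathbf{D}\subset\mathbb{R}^N$ is a fixed hold-all domain and $V^k(\mathbf{D})=\mathcal{C}^k_0(\mathbf{D},\mathbb{R}^N)$ is the set of $\mathcal{C}^k$ vector fields $f$ such that $D^\alpha f$ has compact support in $\mathbf{D}$ for $0\le|\alpha|\le k$. A velocity field $\boldsymbol{V}\in\mathcal{C}([0,\epsilon],V^k(\mathbf{D}))$ defines trajectories $x(t)$ by $\dot x(t)=\boldsymbol{V}(t)\circ x(t)$, $x(0)=\mathrm{id}$; put $\boldsymbol{v}=\boldsymbol{V}(0)$. A domain is an open bounded set $\Omega$, a boundary is $\Gamma=\partial\Omega$, $\boldsymbol{n}$ is its unit normal pointing outward of $\Omega$, and $\Gamma_t=x(t)(\Gamma)$. Tangential calculus: for $f$ scalar and $\boldsymbol{w}$ vector valued on $\Gamma$, with any $\mathcal{C}^1$ extensions $F$, $\boldsymbol{W}$ to a neighborhood of $\Gamma$, $\nabla_\Gamma f=(I-\boldsymbol{n}\otimes\boldsymbol{n})\nabla F|_\Gamma$, $D_\Gamma\boldsymbol{w}=(D\boldsymbol{W}-D\boldsymbol{W}\boldsymbol{n}\otimes\boldsymbol{n})|_\Gamma$ and $\operatorname{div}_\Gamma\boldsymbol{w}=(\operatorname{div}\boldsymbol{W}-D\boldsymbol{W}\boldsymbol{n}\cdot\boldsymbol{n})|_\Gamma$ (independent of the extension). Here $(\boldsymbol{a}\otimes\boldsymbol{b})\boldsymbol{c}=(\boldsymbol{b}\cdot\boldsymbol{c})\boldsymbol{a}$. Shape derivatives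 of boundary functions: a boundary function assigns to each admissible boundary $\Gamma$ (in particular to each $\Gamma_t$) a function $z(\Gamma)$ on $\Gamma$. If $z(\Gamma)\in\mathcal{C}^r(\Gamma)$, $1\le r\le k$, its material derivative is $\dot z(\Gamma,\boldsymbol{V})=\lim_{t\searrow0}\frac{z(\Gamma_t)\circ x(t)-z(\Gamma)}{t}$, the limit being taken in $\mathcal{C}^{r-1}(\Gamma)$; $z$ is shape differentiable at $\Gamma$ in the direction $\boldsymbol{V}$ if it exists, and the shape derivative is $z'(\Gamma,\boldsymbol{V})=\dot z(\Gamma,\boldsymbol{V})-\nabla_\Gamma z(\Gamma)\cdot\boldsymbol{v}$. For vector valued boundary functions, $\boldsymbol{w}'(\Gamma,\boldsymbol{V})=\dot{\boldsymbol{w}}(\Gamma,\boldsymbol{V})-D_\Gamma\boldsymbol{w}\,\boldsymbol{v}$, with the analogous material derivative. A tensor (matrix) valued boundary function $A$ is shape differentiable if $A\boldsymbol{e}$ is for every fixed vector $\boldsymbol{e}$, and $A'(\Gamma,\boldsymbol{V})$ is defined by $A'(\Gamma,\boldsymbol{V})\boldsymbol{e}=(A\boldsymbol{e})'(\Gamma,\boldsymbol{V})$. *)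

theory Defs
  imports "HOL-Analysis.Analysis"
begin

subsection \<open>Functions of class C^k on open sets\<close>

text \<open>\<open>U\<close> is always an open set. By linearity it would be enough to let \<open>e\<close> range over
  the canonical basis, that is, to use partial derivatives.\<close>

primrec Ck_on :: "nat \<Rightarrow> ('a::euclidean_space \<Rightarrow> 'b::real_normed_vector) \<Rightarrow> 'a set \<Rightarrow> bool" where
  "Ck_on 0 f U \<longleftrightarrow> continuous_on U f"
| "Ck_on (Suc k) f U \<longleftrightarrow>
     (\<forall>y\<in>U. f differentiable (at y)) \<and> (\<forall>e. Ck_on k (\<lambda>y. frechet_derivative f (at y) e) U)"

text \<open>Convergence in the C^k norm on \<open>U\<close>: all derivatives of order at most \<open>k\<close> converge
  uniformly.\<close>

primrec Ck_limit ::
  "nat \<Rightarrow> 'a::euclidean_space set \<Rightarrow> ('t \<Rightarrow> 'a \<Rightarrow> 'b::real_normed_vector) \<Rightarrow> ('a \<Rightarrow> 'b) \<Rightarrow> 't filter \<Rightarrow> bool"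
where
  "Ck_limit 0 U F f A \<longleftrightarrow> uniform_limit U F f A"
| "Ck_limit (Suc k) U F f A \<longleftrightarrow> uniform_limit U F f A \<and>
     (\<forall>e. Ck_limit k U (\<lambda>t y. frechet_derivative (F t) (at y) e)
                       (\<lambda>y. frechet_derivative f (at y) e) A)"


subsection \<open>Velocity fields and trajectories\<close>

text \<open>A field with compact support in the open set \<open>D\<close> is identified with its extension by
  zero to the whole space. The supports of its derivatives lie in its own support.\<close>

definition Ck_compact_support :: "nat \<Rightarrow> (real^'n) set \<Rightarrow> (real^'n \<Rightarrow> real^'n) set" where
  "Ck_compact_support k D =
     {f. Ck_on k f UNIV \<and> compact (closure {y. f y \<noteq> 0}) \<and> closure {y. f y \<noteq> 0} \<subseteq> D}"

definition velocity_field ::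
  "nat \<Rightarrow> (real^'n) set \<Rightarrow> real \<Rightarrow> (real \<Rightarrow> real^'n \<Rightarrow> real^'n) \<Rightarrow> bool" where
  "velocity_field k D \<epsilon> V \<longleftrightarrow>
     (\<forall>t\<in>{0..\<epsilon>}. V t \<in> Ck_compact_support k D) \<and>
     (\<forall>t\<in>{0..\<epsilon>}. Ck_limit k UNIV V (V t) (at t within {0..\<epsilon>}))"

definition trajectories ::
  "real \<Rightarrow> (real \<Rightarrow> real^'n \<Rightarrow> real^'n) \<Rightarrow> (real \<Rightarrow> real^'n \<Rightarrow> real^'n) \<Rightarrow> bool" where
  "trajectories \<epsilon> V x \<longleftrightarrow>
     (\<forall>X. x 0 X = X) \<and>
     (\<forall>X. \<forall>t\<in>{0..\<epsilon>}. ((\<lambda>s. x s X) has_vector_derivative V t (x t X)) (at t within {0..\<epsilon>}))"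


subsection \<open>Domains, boundaries and the outward normal\<close>

text \<open>Bounded open sets whose boundary is of class C^k: near each boundary point a C^k
  diffeomorphism \<open>g\<close>, with inverse \<open>h\<close>, maps the set to one side of a coordinate hyperplane and
  its boundary to that hyperplane.\<close>

definition Ck_domain :: "nat \<Rightarrow> (real^'n) set \<Rightarrow> bool" where
  "Ck_domain k \<Omega> \<longleftrightarrow> open \<Omega> \<and> bounded \<Omega> \<and>
     (\<forall>p\<in>frontier \<Omega>. \<exists>(U :: (real^'n) set) (W :: (real^'n) set) g h i.
        open U \<and> p \<in> U \<and> open W \<and> homeomorphism U W g h \<and> Ck_on k g U \<and> Ck_on k h W \<and>
        g ` (U \<inter> \<Omega>) = {y\<in>W. y $ i < 0} \<and> g ` (U \<inter> frontier \<Omega>) = {y\<in>W. y $ i = 0})"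

definition admissible_boundary :: "nat \<Rightarrow> (real^'n) set \<Rightarrow> (real^'n) set \<Rightarrow> bool" where
  "admissible_boundary k D \<Gamma> \<longleftrightarrow> (\<exists>\<Omega>. Ck_domain k \<Omega> \<and> \<Omega> \<subseteq> D \<and> frontier \<Omega> = \<Gamma>)"

text \<open>A bounded domain lying locally on one side of its C^1 boundary is determined by this
  boundary, so the following choice is in fact unique.\<close>

definition enclosed_domain :: "(real^'n) set \<Rightarrow> (real^'n) set" where
  "enclosed_domain \<Gamma> = (SOME \<Omega>. Ck_domain 1 \<Omega> \<and> frontier \<Omega> = \<Gamma>)"

definition tangent_space :: "(real^'n) set \<Rightarrow> real^'n \<Rightarrow> (real^'n) set" where
  "tangent_space \<Gamma> y = {\<tau>. \<exists>\<gamma> \<delta>. \<delta> > 0 \<and> \<gamma> 0 = y \<and> \<gamma> ` {-\<delta><..<\<delta>} \<subseteq> \<Gamma> \<and>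
                              (\<gamma> has_vector_derivative \<tau>) (at (0::real))}"

definition outward_normal :: "(real^'n) set \<Rightarrow> real^'n \<Rightarrow> real^'n" where
  "outward_normal \<Gamma> y = (THE n. norm n = 1 \<and> (\<forall>\<tau>\<in>tangent_space \<Gamma> y. n \<bullet> \<tau> = 0) \<and>
     (\<forall>\<^sub>F s in at_right 0. y - s *\<^sub>R n \<in> enclosed_domain \<Gamma> \<and>
                          y + s *\<^sub>R n \<notin> closure (enclosed_domain \<Gamma>)))"


subsection \<open>Tensors\<close>

definition outer :: "real^'n \<Rightarrow> real^'n \<Rightarrow> real^'n^'n" where
  "outer a b = (\<chi> i j. a $ i * b $ j)"

lemma outer_mult_vec: "outer a b *v c = (b \<bullet> c) *\<^sub>R a"
  by (simp add: outer_def vec_eq_iff matrix_vector_mult_def inner_vec_def sum_distrib_left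
      mult.assoc mult.commute mult.left_commute)

definition tensor_inner :: "real^'n^'n \<Rightarrow> real^'n^'n \<Rightarrow> real" where
  "tensor_inner S T = trace (transpose S ** T)"


subsection \<open>Tangential calculus\<close>

definition extends_Ck :: "nat \<Rightarrow> (real^'n) set \<Rightarrow> (real^'n \<Rightarrow> 'b::real_normed_vector) \<Rightarrow>
    (real^'n \<Rightarrow> 'b) \<Rightarrow> bool" where
  "extends_Ck k \<Gamma> f F \<longleftrightarrow> (\<exists>U. open U \<and> \<Gamma> \<subseteq> U \<and> Ck_on k F U) \<and> (\<forall>y\<in>\<Gamma>. F y = f y)"

definition Ck_boundary :: "nat \<Rightarrow> (real^'n) set \<Rightarrow> (real^'n \<Rightarrow> 'b::real_normed_vector) set" where
  "Ck_boundary k \<Gamma> = {f. \<exists>F. extends_Ck k \<Gamma> f F}"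

text \<open>The tangential operators below do not depend on the chosen extension. They are meaningful
  only for functions in \<^term>\<open>Ck_boundary 1 \<Gamma>\<close>.\<close>

definition C1_extension :: "(real^'n) set \<Rightarrow> (real^'n \<Rightarrow> 'b::real_normed_vector) \<Rightarrow>
    (real^'n \<Rightarrow> 'b)" where
  "C1_extension \<Gamma> f = (SOME F. extends_Ck 1 \<Gamma> f F)"

definition tan_grad :: "(real^'n) set \<Rightarrow> (real^'n \<Rightarrow> real) \<Rightarrow> real^'n \<Rightarrow> real^'n" where
  "tan_grad \<Gamma> f y = (let n = outward_normal \<Gamma> y in
     (mat 1 - outer n n) *v (\<chi> i. frechet_derivative (C1_extension \<Gamma> f) (at y) (axis i 1)))"

definition tan_jacobian :: "(real^'n) set \<Rightarrow> (real^'n \<Rightarrow> real^'n) \<Rightarrow> real^'n \<Rightarrow> real^'n^'n" where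
  "tan_jacobian \<Gamma> w y = (let n = outward_normal \<Gamma> y; DW = jacobian (C1_extension \<Gamma> w) (at y) in
     DW - outer (DW *v n) n)"

definition tan_div :: "(real^'n) set \<Rightarrow> (real^'n \<Rightarrow> real^'n) \<Rightarrow> real^'n \<Rightarrow> real" where
  "tan_div \<Gamma> w y = (let n = outward_normal \<Gamma> y; DW = jacobian (C1_extension \<Gamma> w) (at y) in
     trace DW - (DW *v n) \<bullet> n)"

text \<open>Tangential derivative in the direction of the tangential part of \<open>e\<close>, for values in any
  normed space: for scalar \<open>f\<close> it is the component of the tangential gradient along \<open>e\<close>.\<close>

definition tan_deriv :: "(real^'n) set \<Rightarrow> (real^'n \<Rightarrow> 'b::real_normed_vector) \<Rightarrow> real^'n \<Rightarrow>
    real^'n \<Rightarrow> 'b" where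
  "tan_deriv \<Gamma> f e y = (let n = outward_normal \<Gamma> y in
     frechet_derivative (C1_extension \<Gamma> f) (at y) (e - (n \<bullet> e) *\<^sub>R n))"

text \<open>Uniform convergence on \<open>\<Gamma>\<close> of all tangential derivatives of order at most \<open>k\<close>.\<close>

primrec tan_limit :: "nat \<Rightarrow> (real^'n) set \<Rightarrow> ('t \<Rightarrow> real^'n \<Rightarrow> 'b::real_normed_vector) \<Rightarrow>
    (real^'n \<Rightarrow> 'b) \<Rightarrow> 't filter \<Rightarrow> bool" where
  "tan_limit 0 \<Gamma> F f A \<longleftrightarrow> uniform_limit \<Gamma> F f A"
| "tan_limit (Suc k) \<Gamma> F f A \<longleftrightarrow> uniform_limit \<Gamma> F f A \<and>
     (\<forall>e. tan_limit k \<Gamma> (\<lambda>t. tan_deriv \<Gamma> (F t) e) (tan_deriv \<Gamma> f e) A)"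

definition Ck_boundary_limit :: "nat \<Rightarrow> (real^'n) set \<Rightarrow>
    ('t \<Rightarrow> real^'n \<Rightarrow> 'b::real_normed_vector) \<Rightarrow> (real^'n \<Rightarrow> 'b) \<Rightarrow> 't filter \<Rightarrow> bool" where
  "Ck_boundary_limit k \<Gamma> F f A \<longleftrightarrow>
     (\<forall>\<^sub>F t in A. F t \<in> Ck_boundary k \<Gamma>) \<and> f \<in> Ck_boundary k \<Gamma> \<and> tan_limit k \<Gamma> F f A"


subsection \<open>Material and shape derivatives of boundary functions\<close>

text \<open>A boundary function is a map \<open>z\<close> such that \<open>z \<Gamma>\<close> is a function on \<open>\<Gamma>\<close>; its values for other
  sets and outside \<open>\<Gamma>\<close> are irrelevant. In the following relations \<open>r \<ge> 1\<close> is the order of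
  regularity of \<open>z \<Gamma>\<close>, \<open>x\<close> is the family of trajectories of the velocity field \<open>V\<close>, and
  the derivative is determined on \<open>\<Gamma>\<close> only.\<close>

definition has_material_derivative ::
  "nat \<Rightarrow> (real \<Rightarrow> real^'n \<Rightarrow> real^'n) \<Rightarrow> (real^'n) set \<Rightarrow>
   ((real^'n) set \<Rightarrow> real^'n \<Rightarrow> 'b::real_normed_vector) \<Rightarrow> (real^'n \<Rightarrow> 'b) \<Rightarrow> bool" where
  "has_material_derivative r x \<Gamma> z zdot \<longleftrightarrow>
     z \<Gamma> \<in> Ck_boundary r \<Gamma> \<and>
     Ck_boundary_limit (r - 1) \<Gamma> (\<lambda>t y. (z (x t ` \<Gamma>) (x t y) - z \<Gamma> y) /\<^sub>R t) zdot (at_right 0)"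

definition has_shape_derivative ::
  "nat \<Rightarrow> (real \<Rightarrow> real^'n \<Rightarrow> real^'n) \<Rightarrow> (real \<Rightarrow> real^'n \<Rightarrow> real^'n) \<Rightarrow> (real^'n) set \<Rightarrow>
   ((real^'n) set \<Rightarrow> real^'n \<Rightarrow> real) \<Rightarrow> (real^'n \<Rightarrow> real) \<Rightarrow> bool" where
  "has_shape_derivative r V x \<Gamma> z z' \<longleftrightarrow>
     (\<exists>zdot. has_material_derivative r x \<Gamma> z zdot \<and>
        (\<forall>y\<in>\<Gamma>. z' y = zdot y - tan_grad \<Gamma> (z \<Gamma>) y \<bullet> V 0 y))"

definition has_shape_derivative_vec ::
  "nat \<Rightarrow> (real \<Rightarrow> real^'n \<Rightarrow> real^'n) \<Rightarrow> (real \<Rightarrow> real^'n \<Rightarrow> real^'n) \<Rightarrow> (real^'n) set \<Rightarrow>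
   ((real^'n) set \<Rightarrow> real^'n \<Rightarrow> real^'n) \<Rightarrow> (real^'n \<Rightarrow> real^'n) \<Rightarrow> bool" where
  "has_shape_derivative_vec r V x \<Gamma> w w' \<longleftrightarrow>
     (\<exists>wdot. has_material_derivative r x \<Gamma> w wdot \<and>
        (\<forall>y\<in>\<Gamma>. w' y = wdot y - tan_jacobian \<Gamma> (w \<Gamma>) y *v V 0 y))"

definition has_shape_derivative_tensor ::
  "nat \<Rightarrow> (real \<Rightarrow> real^'n \<Rightarrow> real^'n) \<Rightarrow> (real \<Rightarrow> real^'n \<Rightarrow> real^'n) \<Rightarrow> (real^'n) set \<Rightarrow>
   ((real^'n) set \<Rightarrow> real^'n \<Rightarrow> real^'n^'n) \<Rightarrow> (real^'n \<Rightarrow> real^'n^'n) \<Rightarrow> bool" where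
  "has_shape_derivative_tensor r V x \<Gamma> A A' \<longleftrightarrow>
     (\<forall>e. has_shape_derivative_vec r V x \<Gamma> (\<lambda>\<Gamma> y. A \<Gamma> y *v e) (\<lambda>y. A' y *v e))"

definition normal_velocity :: "(real \<Rightarrow> real^'n \<Rightarrow> real^'n) \<Rightarrow> (real^'n) set \<Rightarrow> real^'n \<Rightarrow> real" where
  "normal_velocity V \<Gamma> y = V 0 y \<bullet> outward_normal \<Gamma> y"

end

theory Submission
  imports Defs
begin

text \<open>The proof pulls everything back to the fixed boundary \<open>\<Gamma>\<close>. Put \<open>u\<^sub>t = w(\<Gamma>\<^sub>t) \<circ> x(t)\<close>; by
hypothesis \<open>u\<^sub>t = w(\<Gamma>) + t Q\<^sub>t\<close>, where \<open>Q\<^sub>t\<close> converges to the material derivative of \<open>w\<close> together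
with its tangential derivatives. Let \<open>K\<^sub>t\<close> be the inverse of the Jacobian of \<open>x(t)\<close> and
\<open>m\<^sub>t = K\<^sub>t\<^sup>T n\<close>, a normal of the moved boundary. The chain rule (\<open>tan_jacobian_transport\<close>) gives
\<open>D\<^sub>\<Gamma>\<^sub>t w(\<Gamma>\<^sub>t) \<circ> x(t) = (D\<^sub>\<Gamma> u\<^sub>t) K\<^sub>t (I - m\<^sub>t \<otimes> m\<^sub>t / |m\<^sub>t|\<^sup>2)\<close>,
because \<open>K\<^sub>t\<close> maps tangent vectors of the moved boundary to tangent vectors of \<open>\<Gamma>\<close>.
Only the projection onto the tangent space enters, so the orientation of the moved normal is
irrelevant. Every factor on the right has a derivative at \<open>t = 0\<close> that is uniform on \<open>\<Gamma>\<close>, and the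
product rule yields the material derivative of the tangential Jacobian
(\<open>material_derivative_tan_jacobian\<close>).

The shape derivative subtracts the tangential derivative of \<open>(D\<^sub>\<Gamma> w) e\<close> in the direction of the
velocity \<open>v\<close>, while \<open>D\<^sub>\<Gamma> w'\<close> contains the tangential derivative of \<open>(D\<^sub>\<Gamma> w) v\<close>. With a
\<open>C\<^sup>2\<close> extension \<open>W\<close> of \<open>w(\<Gamma>)\<close> both contain a second derivative of \<open>W\<close> in two tangential directions;
these cancel by Schwarz's theorem. What remains is the image under \<open>DW\<close> of terms of first order in
\<open>v\<close> and \<open>n\<close>, and the symmetry of \<open>D\<^sub>\<Gamma> n\<close> turns them into the asserted formula
(\<open>moving_normal_algebra\<close>, \<open>material_minus_transport_tan_jacobian\<close>). The statement on the
divergence is the trace of the one on the Jacobian.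

Two bodies of facts support this. First, \<open>n\<close> has a \<open>C\<^sup>1\<close> extension with symmetric tangential
derivative (\<open>C2_boundary_normal_extension\<close>): cut-off chart coordinates add up to a global \<open>C\<^sup>2\<close>
defining function \<open>\<phi>\<close>, whose normalized gradient is the normal up to a locally constant sign.
Second, for small \<open>t\<close> the map \<open>x(t)\<close> is a \<open>C\<^sup>1\<close> diffeomorphism with Jacobian \<open>I + t Dv + o(t)\<close>
uniformly in space (\<open>flow_small_time\<close>, \<open>flow_eventually_diffeomorphism\<close>). Its differentiability
is read off from a bound for second differences, which follows, like all other estimates for the
flow, from an elementary short-time form of Gronwall's inequality.\<close>

section \<open>Calculus of C^k functions on open sets\<close>

abbreviation fderiv :: "('a::real_normed_vector \<Rightarrow> 'b::real_normed_vector) \<Rightarrow> 'a \<Rightarrow> 'a \<Rightarrow> 'b" where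
  "fderiv f y \<equiv> frechet_derivative f (at y)"

lemma frechet_derivative_cong_open:
  assumes "open U" "y \<in> U" "\<And>z. z \<in> U \<Longrightarrow> f z = g z"
  shows "fderiv f y = fderiv g y"
proof -
  have "(f has_derivative d) (at y) \<longleftrightarrow> (g has_derivative d) (at y)" for d
    using has_derivative_transform_within_open[OF _ assms(1,2), of f d UNIV g]
      has_derivative_transform_within_open[OF _ assms(1,2), of g d UNIV f] assms(3) by auto
  then show ?thesis unfolding frechet_derivative_def by simp
qed

lemma Ck_on_cong:
  assumes "open U" "\<And>y. y \<in> U \<Longrightarrow> f y = g y" "Ck_on k f U"
  shows "Ck_on k g U"
  using assms(2,3)
proof (induction k arbitrary: f g)
  case 0
  then show ?case by (auto cong: continuous_on_cong)
next
  case (Suc k)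
  have "g differentiable (at y)" if "y \<in> U" for y
  proof -
    have "f differentiable (at y)" using Suc.prems that by simp
    then show ?thesis
      using has_derivative_transform_within_open[OF _ assms(1) that, of f _ UNIV g] Suc.prems(1)
      unfolding differentiable_def by metis
  qed
  moreover have "Ck_on k (\<lambda>y. fderiv g y e) U" for e
    using Suc.IH[of "\<lambda>y. fderiv f y e" "\<lambda>y. fderiv g y e"]
      frechet_derivative_cong_open[OF assms(1) _ Suc.prems(1)] Suc.prems(2) by simp
  ultimately show ?case by simp
qed

lemma Ck_on_SucI:
  assumes "open U" "\<And>y. y \<in> U \<Longrightarrow> (f has_derivative f' y) (at y)"
    and "\<And>e. Ck_on k (\<lambda>y. f' y e) U"
  shows "Ck_on (Suc k) f U"
proof -
  have "fderiv f y = f' y" if "y \<in> U" for y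
    using frechet_derivative_at[OF assms(2)[OF that]] by simp
  then have "Ck_on k (\<lambda>y. fderiv f y e) U" for e
    using Ck_on_cong[OF assms(1) _ assms(3)[of e]] by simp
  then show ?thesis using assms(2) by (auto simp: differentiable_def)
qed

lemma Ck_on_Suc_has_derivative:
  "Ck_on (Suc k) f U \<Longrightarrow> y \<in> U \<Longrightarrow> (f has_derivative fderiv f y) (at y)"
  by (simp add: frechet_derivative_works)

lemma Ck_on_imp_continuous: "Ck_on k f U \<Longrightarrow> continuous_on U f"
  by (cases k) (auto intro!: continuous_at_imp_continuous_on differentiable_imp_continuous_within)

lemma Ck_on_Suc_mono: "Ck_on (Suc k) f U \<Longrightarrow> Ck_on k f U"
proof (induction k arbitrary: f)
  case 0
  then show ?case using Ck_on_imp_continuous[OF 0] by simp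
next
  case (Suc k)
  have "Ck_on k (\<lambda>y. fderiv f y e) U" for e
    using Suc.IH[of "\<lambda>y. fderiv f y e"] Suc.prems by simp
  then show ?case using Suc.prems by simp
qed

lemma Ck_on_mono: "Ck_on k f U \<Longrightarrow> j \<le> k \<Longrightarrow> Ck_on j f U"
  by (induction k) (auto dest: Ck_on_Suc_mono simp: le_Suc_eq simp del: Ck_on.simps)

lemma Ck_on_subset: "Ck_on k f U \<Longrightarrow> V \<subseteq> U \<Longrightarrow> Ck_on k f V"
  by (induction k arbitrary: f) (auto intro: continuous_on_subset)

lemma Ck_on_Un: "open U \<Longrightarrow> open V \<Longrightarrow> Ck_on k f U \<Longrightarrow> Ck_on k f V \<Longrightarrow> Ck_on k f (U \<union> V)"
  by (induction k arbitrary: f) (auto intro: continuous_on_open_Un)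

lemma Ck_on_const: "open U \<Longrightarrow> Ck_on k (\<lambda>y. c) U"
proof (induction k arbitrary: c)
  case (Suc k)
  show ?case using Suc by (intro Ck_on_SucI[where f'="\<lambda>y e. 0"]) (auto simp del: Ck_on.simps)
qed simp

lemma Ck_on_bounded_linear:
  assumes "bounded_linear L" "open U" "Ck_on k f U"
  shows "Ck_on k (\<lambda>y. L (f y)) U"
  using assms(3)
proof (induction k arbitrary: f)
  case 0
  then show ?case by (auto intro: bounded_linear.continuous_on[OF assms(1)])
next
  case (Suc k)
  show ?case
    using Suc Ck_on_Suc_has_derivative[OF Suc.prems]
    by (intro Ck_on_SucI[where f'="\<lambda>y e. L (fderiv f y e)"] assms(2)
       bounded_linear.has_derivative[OF assms(1)]) auto
qed

lemma Ck_on_ident: "open U \<Longrightarrow> Ck_on k (\<lambda>y. y) U"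
proof (cases k)
  case (Suc j)
  assume "open U"
  then show ?thesis unfolding Suc
    by (intro Ck_on_SucI[where f'="\<lambda>y e. e"] Ck_on_const) auto
qed simp

lemma Ck_on_add:
  assumes "open U" "Ck_on k f U" "Ck_on k g U"
  shows "Ck_on k (\<lambda>y. f y + g y) U"
  using assms(2,3)
proof (induction k arbitrary: f g)
  case 0
  then show ?case by (auto intro: continuous_intros)
next
  case (Suc k)
  show ?case
    using Suc Ck_on_Suc_has_derivative[OF Suc.prems(1)] Ck_on_Suc_has_derivative[OF Suc.prems(2)]
    by (intro Ck_on_SucI[where f'="\<lambda>y e. fderiv f y e + fderiv g y e"]
         assms(1) has_derivative_add) auto
qed

lemma Ck_on_diff:
  assumes "open U" "Ck_on k f U" "Ck_on k g U"
  shows "Ck_on k (\<lambda>y. f y - g y) U"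
  using Ck_on_add[OF assms(1,2) Ck_on_bounded_linear[OF bounded_linear_minus[OF bounded_linear_ident] assms(1,3)]]
  by simp

lemma Ck_on_sum:
  assumes "open U" "\<And>i. i \<in> I \<Longrightarrow> Ck_on k (f i) U"
  shows "Ck_on k (\<lambda>y. \<Sum>i\<in>I. f i y) U"
  using assms(2)
  by (induction I rule: infinite_finite_induct) (auto intro: Ck_on_add Ck_on_const assms(1))

lemma Ck_on_bilinear:
  assumes "bounded_bilinear B" "open U" "Ck_on k f U" "Ck_on k g U"
  shows "Ck_on k (\<lambda>y. B (f y) (g y)) U"
  using assms(3,4)
proof (induction k arbitrary: f g)
  case 0
  then show ?case by (auto intro: bounded_bilinear.continuous_on[OF assms(1)])
next
  case (Suc k)
  have *: "Ck_on k f U" "Ck_on k g U" using Suc.prems Ck_on_Suc_mono by blast+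
  have "Ck_on k (\<lambda>y. B (f y) (fderiv g y e) + B (fderiv f y e) (g y)) U" for e
    using Suc.prems by (intro Ck_on_add Suc.IH assms(2) *) auto
  then show ?case
    using Suc Ck_on_Suc_has_derivative[OF Suc.prems(1)] Ck_on_Suc_has_derivative[OF Suc.prems(2)]
    by (intro Ck_on_SucI[where f'="\<lambda>y e. B (f y) (fderiv g y e) + B (fderiv f y e) (g y)"]
         assms(2) bounded_bilinear.FDERIV[OF assms(1)]) auto
qed

lemmas Ck_on_scaleR = Ck_on_bilinear[OF bounded_bilinear_scaleR]
lemmas Ck_on_mult = Ck_on_bilinear[OF bounded_bilinear_mult]
lemmas Ck_on_inner = Ck_on_bilinear[OF bounded_bilinear_inner]

lemma linear_Basis_expansion:
  fixes f :: "'a::euclidean_space \<Rightarrow> 'b::real_vector"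
  assumes "linear f" shows "f e = (\<Sum>b\<in>Basis. (e \<bullet> b) *\<^sub>R f b)"
  by (metis (no_types, lifting) assms euclidean_representation linear_scale linear_sum sum.cong)

text \<open>Membership in \<open>Ck_on\<close> controls derivatives in constant directions only. A direction that
varies with the point is expanded in the basis.\<close>

lemma Ck_on_frechet_apply:
  fixes f :: "'a::euclidean_space \<Rightarrow> 'b::real_normed_vector"
  assumes "open U" "Ck_on (Suc k) f U" "Ck_on k u U"
  shows "Ck_on k (\<lambda>y. fderiv f y (u y)) U"
proof -
  have "Ck_on k (\<lambda>y. \<Sum>b\<in>Basis. (u y \<bullet> b) *\<^sub>R fderiv f y b) U"
    using assms by (intro Ck_on_sum Ck_on_scaleR Ck_on_inner Ck_on_const) auto
  moreover have "(\<Sum>b\<in>Basis. (u y \<bullet> b) *\<^sub>R fderiv f y b) =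
      fderiv f y (u y)" if "y \<in> U" for y
    using linear_Basis_expansion[OF has_derivative_linear[OF Ck_on_Suc_has_derivative[OF assms(2) that]], of "u y"]
    by simp
  ultimately show ?thesis using Ck_on_cong[OF assms(1)] by (smt (verit, best))
qed

lemma Ck_on_1_compose:
  fixes f :: "'a::euclidean_space \<Rightarrow> 'b::euclidean_space" and g :: "'b \<Rightarrow> 'c::real_normed_vector"
  assumes "open U" "Ck_on 1 f U" "open W" "f ` U \<subseteq> W" "Ck_on 1 g W"
  shows "Ck_on 1 (\<lambda>y. g (f y)) U"
proof -
  have f: "Ck_on (Suc 0) f U" and g: "Ck_on (Suc 0) g W" using assms by simp_all
  have cf: "continuous_on U f" using Ck_on_imp_continuous[OF f] .
  have "Ck_on 0 (\<lambda>y. fderiv g (f y) (fderiv f y e)) U" for e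
  proof -
    have "continuous_on U (\<lambda>y. \<Sum>b\<in>Basis. (fderiv f y e \<bullet> b) *\<^sub>R fderiv g (f y) b)"
      using f g assms(4) by (intro continuous_intros continuous_on_compose2[OF _ cf, of W]) auto
    moreover have "fderiv g (f y) v = (\<Sum>b\<in>Basis. (v \<bullet> b) *\<^sub>R fderiv g (f y) b)" if "y \<in> U" for y v
      using linear_Basis_expansion[OF has_derivative_linear[OF Ck_on_Suc_has_derivative[OF g]]] assms(4) that
      by blast
    ultimately show ?thesis by (auto cong: continuous_on_cong)
  qed
  moreover have "((\<lambda>y. g (f y)) has_derivative (\<lambda>e. fderiv g (f y) (fderiv f y e))) (at y)" if "y \<in> U" for y
    using has_derivative_compose[OF Ck_on_Suc_has_derivative[OF f that] Ck_on_Suc_has_derivative[OF g]]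
      assms(4) that by auto
  ultimately show ?thesis
    unfolding One_nat_def
    by (intro Ck_on_SucI[OF assms(1), where f'="\<lambda>y e. fderiv g (f y) (fderiv f y e)"]) auto
qed

lemma Ck_on_1_normalize: "Ck_on 1 (\<lambda>v::'a::euclidean_space. v /\<^sub>R norm v) (- {0})"
proof -
  have o: "open (- {0::'a})" by auto
  have "Ck_on 1 (\<lambda>v::'a. inverse (norm v)) (-{0})"
    unfolding One_nat_def
    by (rule Ck_on_SucI[OF o, where f'="\<lambda>v e. - (inverse (norm v) * (e \<bullet> sgn v) * inverse (norm v))"])
      (auto intro!: derivative_eq_intros continuous_intros has_derivative_norm simp: sgn_div_norm inner_commute)
  from Ck_on_scaleR[OF o this Ck_on_ident[OF o]] show ?thesis by simp
qed

text \<open>Schwarz's theorem. By two applications of the mean value theorem, the mixed second difference of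
\<open>f\<close> over a parallelogram with sides \<open>hp\<close> and \<open>hq\<close> is \<open>h\<^sup>2\<close> times a mixed second derivative at a
nearby point. It is symmetric in \<open>p\<close> and \<open>q\<close>, and the second derivatives are continuous.\<close>

lemma second_derivative_symmetric_real:
  fixes f :: "'a::euclidean_space \<Rightarrow> real"
  assumes "open U" "Ck_on 2 f U" "y \<in> U"
  shows "fderiv (\<lambda>z. fderiv f z a) y b =
         fderiv (\<lambda>z. fderiv f z b) y a"
proof -
  define D where "D z e = fderiv f z e" for z e
  define H where "H z p q = fderiv (\<lambda>z. D z p) z q" for z p q
  have C: "Ck_on (Suc (Suc 0)) f U" using assms(2) by (simp add: numeral_2_eq_2)
  have D: "(f has_derivative D z) (at z)" if "z \<in> U" for z
    using Ck_on_Suc_has_derivative[OF C that] by (simp add: D_def[abs_def])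
  have H: "((\<lambda>z. D z p) has_derivative H z p) (at z)" if "z \<in> U" for z p
    using C that Ck_on_Suc_has_derivative[of 0 "\<lambda>z. D z p" U z] by (simp add: D_def[abs_def] H_def[abs_def])
  have Hc: "continuous_on U (\<lambda>z. H z p q)" for p q
    using C by (simp add: D_def[abs_def] H_def[abs_def])
  (* the mean value theorem, first in the direction p and then in the direction q *)
  have key: "\<exists>c\<in>ball y e. (f (y + h *\<^sub>R p + h *\<^sub>R q) - f (y + h *\<^sub>R p) - f (y + h *\<^sub>R q) + f y) = h * h * H c p q"
    if e: "ball y e \<subseteq> U" and h: "h > 0" "h * norm p + h * norm q < e" for e h p q
  proof -
    have inb: "y + s *\<^sub>R p + r *\<^sub>R q \<in> ball y e" if "0 \<le> s" "s \<le> h" "0 \<le> r" "r \<le> h" for s r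
    proof -
      have "norm (s *\<^sub>R p + r *\<^sub>R q) \<le> s * norm p + r * norm q"
        using norm_triangle_ineq[of "s *\<^sub>R p" "r *\<^sub>R q"] that by simp
      also have "\<dots> \<le> h * norm p + h * norm q"
        using that by (intro add_mono mult_right_mono) auto
      finally show ?thesis using h by (simp add: dist_norm add.assoc norm_minus_commute add.commute)
    qed
    define g where "g s = f (y + s *\<^sub>R p + h *\<^sub>R q) - f (y + s *\<^sub>R p + 0 *\<^sub>R q)" for s
    have f1: "((\<lambda>s. f (y + s *\<^sub>R p + r *\<^sub>R q)) has_derivative (\<lambda>k. D (y + s *\<^sub>R p + r *\<^sub>R q) (k *\<^sub>R p))) (at s within {0..h})"
      if "0 \<le> s" "s \<le> h" "0 \<le> r" "r \<le> h" for s r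
    proof -
      have "((\<lambda>s. y + s *\<^sub>R p + r *\<^sub>R q) has_derivative (\<lambda>k. k *\<^sub>R p)) (at s within {0..h})"
        by (auto intro!: derivative_eq_intros)
      from has_derivative_compose[OF this D] inb[OF that] e show ?thesis by auto
    qed
    have "(g has_derivative (\<lambda>k. D (y + s *\<^sub>R p + h *\<^sub>R q) (k *\<^sub>R p) - D (y + s *\<^sub>R p + 0 *\<^sub>R q) (k *\<^sub>R p))) (at s within {0..h})"
      if "0 \<le> s" "s \<le> h" for s
      unfolding g_def[abs_def] using f1[of s h] f1[of s 0] that h by (intro has_derivative_diff) auto
    from mvt_very_simple[OF _ this] h obtain s where s: "s \<in> {0..h}"
      "g h - g 0 = D (y + s *\<^sub>R p + h *\<^sub>R q) (h *\<^sub>R p) - D (y + s *\<^sub>R p + 0 *\<^sub>R q) (h *\<^sub>R p)"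
      by auto
    have lin: "linear (D z)" if "z \<in> U" for z using has_derivative_linear[OF D[OF that]] .
    have "y + s *\<^sub>R p + h *\<^sub>R q \<in> U" "y + s *\<^sub>R p + 0 *\<^sub>R q \<in> U"
      using inb[of s h] inb[of s 0] s h e by (auto simp del: scale_zero_left)
    then have g: "g h - g 0 = h * (D (y + s *\<^sub>R p + h *\<^sub>R q) p - D (y + s *\<^sub>R p + 0 *\<^sub>R q) p)"
      using s(2) by (simp add: linear_scale[OF lin] algebra_simps)
    have "((\<lambda>r. D (y + s *\<^sub>R p + r *\<^sub>R q) p) has_derivative (\<lambda>k. H (y + s *\<^sub>R p + r *\<^sub>R q) p (k *\<^sub>R q))) (at r within {0..h})"
      if "0 \<le> r" "r \<le> h" for r
    proof -
      have "((\<lambda>r. y + s *\<^sub>R p + r *\<^sub>R q) has_derivative (\<lambda>k. k *\<^sub>R q)) (at r within {0..h})"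
        by (auto intro!: derivative_eq_intros)
      from has_derivative_compose[OF this H] inb[of s r] s that e show ?thesis by auto
    qed
    from mvt_very_simple[OF _ this] h obtain r where r: "r \<in> {0..h}"
      "D (y + s *\<^sub>R p + h *\<^sub>R q) p - D (y + s *\<^sub>R p + 0 *\<^sub>R q) p = H (y + s *\<^sub>R p + r *\<^sub>R q) p (h *\<^sub>R q)"
      by auto
    have c: "y + s *\<^sub>R p + r *\<^sub>R q \<in> ball y e" using inb s r by auto
    then have "linear (H (y + s *\<^sub>R p + r *\<^sub>R q) p)" using has_derivative_linear[OF H] e by auto
    then have "g h - g 0 = h * h * H (y + s *\<^sub>R p + r *\<^sub>R q) p q"
      using g r by (simp add: linear_scale)
    then show ?thesis using c by (intro bexI[of _ "y + s *\<^sub>R p + r *\<^sub>R q"]) (auto simp: g_def)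
  qed
  have "H y p q \<le> H y q p + 2*\<eta>" if \<eta>: "\<eta> > 0" for p q \<eta>
  proof -
    have "isCont (\<lambda>z. H z p q) y" "isCont (\<lambda>z. H z q p) y"
      using Hc assms by (auto simp: continuous_on_eq_continuous_at)
    then have "\<forall>\<^sub>F z in nhds y. dist (H z p q) (H y p q) < \<eta>" "\<forall>\<^sub>F z in nhds y. dist (H z q p) (H y q p) < \<eta>"
      using tendsto_at_iff_tendsto_nhds[of "\<lambda>z. H z p q" y] tendsto_at_iff_tendsto_nhds[of "\<lambda>z. H z q p" y]
      by (auto simp: isCont_def dest: tendstoD[OF _ \<eta>])
    moreover have "\<forall>\<^sub>F z in nhds y. z \<in> U" using assms eventually_nhds by blast
    ultimately have "\<forall>\<^sub>F z in nhds y. z \<in> U \<and> dist (H z p q) (H y p q) < \<eta> \<and> dist (H z q p) (H y q p) < \<eta>"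
      by eventually_elim auto
    then obtain e where e: "e > 0" "\<And>z. z \<in> ball y e \<Longrightarrow> z \<in> U \<and> dist (H z p q) (H y p q) < \<eta> \<and> dist (H z q p) (H y q p) < \<eta>"
      unfolding eventually_nhds_metric by (auto simp: dist_commute)
    define h where "h = e / (2 * (norm p + norm q + 1))"
    have pos: "norm p + norm q + 1 > 0" using norm_ge_zero[of p] norm_ge_zero[of q] by linarith
    have h: "h > 0" using e pos by (simp add: h_def)
    have "h * norm p + h * norm q < e"
    proof -
      have "h * (norm p + norm q) \<le> h * (norm p + norm q + 1)" using h by (intro mult_left_mono) auto
      also have "\<dots> = e / 2" using pos unfolding h_def by (simp add: field_simps)
      finally show ?thesis using e by (simp add: algebra_simps)
    qed
    note small = this
    have sub: "ball y e \<subseteq> U" using e(2) by blast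
    have "h * norm q + h * norm p < e" using small by simp
    from key[OF sub h this] obtain c' where c': "c' \<in> ball y e"
      "f (y + h *\<^sub>R q + h *\<^sub>R p) - f (y + h *\<^sub>R q) - f (y + h *\<^sub>R p) + f y = h * h * H c' q p" by blast
    from key[OF sub h small] obtain c where c: "c \<in> ball y e"
      "f (y + h *\<^sub>R p + h *\<^sub>R q) - f (y + h *\<^sub>R p) - f (y + h *\<^sub>R q) + f y = h * h * H c p q" by blast
    have "h * h * H c p q = h * h * H c' q p" using c(2) c'(2) by (simp add: algebra_simps)
    then have "H c p q = H c' q p" using h by simp
    then show ?thesis using e(2)[OF c(1)] e(2)[OF c'(1)] unfolding dist_real_def by linarith
  qed
  note eps = this
  have "H y p q \<le> H y q p" for p q
  proof (rule field_le_epsilon)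
    fix \<eta> :: real assume "0 < \<eta>"
    then show "H y p q \<le> H y q p + \<eta>" using eps[of "\<eta>/2" p q] by simp
  qed
  then show ?thesis using antisym[of "H y a b" "H y b a"] by (simp add: H_def D_def)
qed

lemma second_derivative_symmetric:
  fixes f :: "'a::euclidean_space \<Rightarrow> 'b::euclidean_space"
  assumes "open U" "Ck_on 2 f U" "y \<in> U"
  shows "fderiv (\<lambda>z. fderiv f z a) y b =
         fderiv (\<lambda>z. fderiv f z b) y a"
proof (rule euclidean_eqI)
  fix c :: 'b assume "c \<in> Basis"
  have C: "Ck_on (Suc (Suc 0)) f U" using assms(2) by (simp add: numeral_2_eq_2)
  have bl: "bounded_linear (\<lambda>v::'b. v \<bullet> c)" by (rule bounded_linear_inner_left)
  have fd: "fderiv (\<lambda>z. g z \<bullet> c) z e = fderiv g z e \<bullet> c"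
    if "Ck_on (Suc k) g U" "z \<in> U" for g z e k
    using frechet_derivative_at[OF bounded_linear.has_derivative[OF bl Ck_on_Suc_has_derivative[OF that]]]
    by metis
  have "fderiv (\<lambda>z. fderiv f z a) y b \<bullet> c =
    fderiv (\<lambda>z. fderiv (\<lambda>z. f z \<bullet> c) z a) y b" for a b
    using fd[OF C] fd[of 0 "\<lambda>z. fderiv f z a" y] C assms(3)
    using frechet_derivative_cong_open[OF assms(1,3), of "\<lambda>z. fderiv f z a \<bullet> c"
      "\<lambda>z. fderiv (\<lambda>z. f z \<bullet> c) z a"]
    by simp
  then show "fderiv (\<lambda>z. fderiv f z a) y b \<bullet> c =
         fderiv (\<lambda>z. fderiv f z b) y a \<bullet> c"
    using second_derivative_symmetric_real[OF assms(1) Ck_on_bounded_linear[OF bl assms(1,2)] assms(3)]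
    by metis
qed

text \<open>The product rule for the pairing of the derivative of \<open>f\<close> with a moving direction \<open>u\<close>.\<close>

lemma has_derivative_frechet_apply:
  fixes f :: "'a::euclidean_space \<Rightarrow> 'b::real_normed_vector"
  assumes "open U" "Ck_on 2 f U" "y \<in> U" "(u has_derivative u') (at y)"
  shows "((\<lambda>z. fderiv f z (u z)) has_derivative
     (\<lambda>\<tau>. fderiv (\<lambda>z. fderiv f z (u y)) y \<tau> +
          fderiv f y (u' \<tau>))) (at y)"
proof -
  define D where "D z e = fderiv f z e" for z e
  have C: "Ck_on (Suc (Suc 0)) f U" using assms(2) by (simp add: numeral_2_eq_2)
  have H: "((\<lambda>z. D z p) has_derivative fderiv (\<lambda>z. D z p) y) (at y)" for p
    using C assms(3) Ck_on_Suc_has_derivative[of 0 "\<lambda>z. D z p" U y] by (simp add: D_def[abs_def])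
  have ex: "D z e = (\<Sum>b\<in>Basis. (e \<bullet> b) *\<^sub>R D z b)" if "z \<in> U" for z e
    unfolding D_def
    by (rule linear_Basis_expansion[OF has_derivative_linear[OF Ck_on_Suc_has_derivative[OF C that]]])
  have der: "((\<lambda>z. \<Sum>b\<in>Basis. (u z \<bullet> b) *\<^sub>R D z b) has_derivative
     (\<lambda>\<tau>. \<Sum>b\<in>Basis. (u y \<bullet> b) *\<^sub>R fderiv (\<lambda>z. D z b) y \<tau> + (u' \<tau> \<bullet> b) *\<^sub>R D y b)) (at y)"
    if "(u has_derivative u') (at y)" for u u'
    by (intro has_derivative_sum has_derivative_scaleR H has_derivative_inner_left that)
  have gen: "((\<lambda>z. D z (u z)) has_derivative
     (\<lambda>\<tau>. (\<Sum>b\<in>Basis. (u y \<bullet> b) *\<^sub>R fderiv (\<lambda>z. D z b) y \<tau>) + D y (u' \<tau>))) (at y)"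
    if u: "(u has_derivative u') (at y)" for u u'
    using has_derivative_transform_within_open[OF der[OF u] assms(1,3) ex[symmetric]]
    by (simp add: sum.distrib flip: ex[OF assms(3)])
  have "D y 0 = 0" by (subst ex[OF assms(3)]) simp
  then have "((\<lambda>z. D z (u y)) has_derivative
     (\<lambda>\<tau>. (\<Sum>b\<in>Basis. (u y \<bullet> b) *\<^sub>R fderiv (\<lambda>z. D z b) y \<tau>))) (at y)"
    using gen[of "\<lambda>z. u y" "\<lambda>\<tau>. 0"] by simp
  from frechet_derivative_at[OF this, symmetric]
  have eq: "fderiv (\<lambda>z. D z (u y)) y =
     (\<lambda>\<tau>. (\<Sum>b\<in>Basis. (u y \<bullet> b) *\<^sub>R fderiv (\<lambda>z. D z b) y \<tau>))" .
  show ?thesis using gen[OF assms(4)] unfolding D_def[symmetric] eq .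
qed

section \<open>Defining functions and outward normals\<close>

lemma DERIV_pos_part_power:
  "((\<lambda>s. max 0 s ^ Suc (Suc k)) has_real_derivative (real (Suc (Suc k)) * max 0 s ^ Suc k)) (at (s::real))"
proof -
  consider "s > 0" | "s < 0" | "s = 0" by linarith
  then show ?thesis
  proof cases
    case 1
    have "((\<lambda>s. s ^ Suc (Suc k)) has_real_derivative (real (Suc (Suc k)) * s ^ Suc k)) (at s)"
      using DERIV_pow[of "Suc (Suc k)" s] by simp
    then show ?thesis using 1 has_field_derivative_transform_within_open[of "\<lambda>s. s ^ Suc (Suc k)" _ s "{0<..}" "\<lambda>s. max 0 s ^ Suc (Suc k)"]
      by (simp add: max_def)
  next
    case 2
    then show ?thesis using has_field_derivative_transform_within_open[of "\<lambda>s. 0" 0 s "{..<0}" "\<lambda>s. max 0 s ^ Suc (Suc k)"]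
      by (simp add: max_def)
  next
    case 3
    have "((\<lambda>h::real. max 0 h ^ Suc k) \<longlongrightarrow> max 0 0 ^ Suc k) (at 0)"
      by (intro tendsto_intros)
    moreover have "\<forall>\<^sub>F h in at 0. max 0 h ^ Suc k = (max 0 (0 + h) ^ Suc (Suc k) - max 0 0 ^ Suc (Suc k)) / (h::real)"
      unfolding eventually_at_filter by (intro always_eventually) (auto simp: max_def)
    ultimately have "((\<lambda>h::real. (max 0 (0 + h) ^ Suc (Suc k) - max 0 0 ^ Suc (Suc k)) / h) \<longlongrightarrow> max 0 0 ^ Suc k) (at 0)"
      by (rule Lim_transform_eventually)
    then show ?thesis using 3 by (simp add: DERIV_def)
  qed
qed

text \<open>A cut-off function of class \<open>C\<^sup>k\<close> around \<open>p\<close>: it is positive exactly in the ball of radius \<open>r\<close>, and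
on the sphere it vanishes to order \<open>k + 1\<close>.\<close>

lemma Ck_on_bump:
  "Ck_on k (\<lambda>y::'a::euclidean_space. max 0 (r\<^sup>2 - (norm (y - p))\<^sup>2) ^ Suc k) UNIV"
proof (induction k)
  case 0
  then show ?case by (auto intro!: continuous_intros)
next
  case (Suc k)
  have d: "((\<lambda>y::'a. r\<^sup>2 - (norm (y - p))\<^sup>2) has_derivative (\<lambda>e. - (2 * (e \<bullet> (y - p))))) (at y)" for y
    unfolding power2_norm_eq_inner by (auto intro!: derivative_eq_intros simp: inner_commute)
  show ?case
  proof (rule Ck_on_SucI)
    show "((\<lambda>y::'a. max 0 (r\<^sup>2 - (norm (y - p))\<^sup>2) ^ Suc (Suc k)) has_derivative
        (\<lambda>e. (max 0 (r\<^sup>2 - (norm (y - p))\<^sup>2) ^ Suc k) * (real (Suc (Suc k)) * - (2 * (e \<bullet> (y - p)))))) (at y)" for y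
      using has_derivative_compose[OF d, OF DERIV_pos_part_power[unfolded has_field_derivative_def]]
      by (simp add: mult_ac)
    show "Ck_on k (\<lambda>y::'a. (max 0 (r\<^sup>2 - (norm (y - p))\<^sup>2) ^ Suc k) * (real (Suc (Suc k)) * - (2 * (e \<bullet> (y - p))))) UNIV" for e
      using Suc by (intro Ck_on_mult Ck_on_const Ck_on_inner Ck_on_diff Ck_on_ident Ck_on_bounded_linear[OF bounded_linear_minus[OF bounded_linear_ident]]) auto
  qed auto
qed

lemma Ck_on_1_has_derivative:
  "Ck_on 1 f U \<Longrightarrow> y \<in> U \<Longrightarrow> (f has_derivative fderiv f y) (at y)"
  using Ck_on_Suc_has_derivative[of 0 f U y] by simp

lemma Ck_domain_mono:
  fixes \<Omega> :: "(real^'n) set"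
  assumes "Ck_domain k \<Omega>" "j \<le> k" shows "Ck_domain j \<Omega>"
  unfolding Ck_domain_def
proof (intro conjI ballI)
  fix p assume "p \<in> frontier \<Omega>"
  then obtain U W :: "(real^'n) set" and g h i where "open U" "p \<in> U" "open W" "homeomorphism U W g h"
      "Ck_on k g U" "Ck_on k h W"
      "g ` (U \<inter> \<Omega>) = {y\<in>W. y $ i < 0}" "g ` (U \<inter> frontier \<Omega>) = {y\<in>W. y $ i = 0}"
    using assms(1) unfolding Ck_domain_def by blast
  then show "\<exists>(U :: (real^'n) set) (W :: (real^'n) set) g h i.
        open U \<and> p \<in> U \<and> open W \<and> homeomorphism U W g h \<and> Ck_on j g U \<and> Ck_on j h W \<and>
        g ` (U \<inter> \<Omega>) = {y\<in>W. y $ i < 0} \<and> g ` (U \<inter> frontier \<Omega>) = {y\<in>W. y $ i = 0}"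
    using Ck_on_mono[OF _ assms(2)] by (intro exI[of _ U] exI[of _ W] exI[of _ g] exI[of _ h] exI[of _ i]) auto
qed (use assms in \<open>auto simp: Ck_domain_def\<close>)

lemma chart_derivative_inverse:
  fixes g h :: "'a::euclidean_space \<Rightarrow> 'a"
  assumes "open U" "open W" "homeomorphism U W g h" "Ck_on 1 g U" "Ck_on 1 h W" "y \<in> U"
  shows "fderiv h (g y) (fderiv g y e) = e"
    and "fderiv g y (fderiv h (g y) e) = e"
proof -
  have gy: "g y \<in> W" "h (g y) = y" using assms(3,6) by (auto simp: homeomorphism_def)
  have g: "(g has_derivative fderiv g y) (at y)"
    using Ck_on_1_has_derivative assms(4,6) by blast
  have h: "(h has_derivative fderiv h (g y)) (at (g y))"
    using Ck_on_1_has_derivative assms(5) gy by blast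
  have "((\<lambda>y. h (g y)) has_derivative (\<lambda>e. fderiv h (g y) (fderiv g y e))) (at y)"
    by (rule has_derivative_compose[OF g h])
  moreover have "((\<lambda>y. h (g y)) has_derivative (\<lambda>e. e)) (at y)"
    by (rule has_derivative_transform_within_open[OF has_derivative_ident assms(1,6)])
      (use assms(3) in \<open>auto simp: homeomorphism_def\<close>)
  ultimately show "fderiv h (g y) (fderiv g y e) = e"
    by (metis has_derivative_unique)
  have "((\<lambda>y. g (h y)) has_derivative (\<lambda>e. fderiv g y (fderiv h (g y) e))) (at (g y))"
    using has_derivative_compose[OF h, of g] g gy by simp
  moreover have "((\<lambda>y. g (h y)) has_derivative (\<lambda>e. e)) (at (g y))"
    by (rule has_derivative_transform_within_open[OF has_derivative_ident assms(2) gy(1)])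
      (use assms(3) in \<open>auto simp: homeomorphism_def\<close>)
  ultimately show "fderiv g y (fderiv h (g y) e) = e"
    by (metis has_derivative_unique)
qed

lemma chart_sides:
  assumes "homeomorphism U W g h" "g ` (U \<inter> \<Omega>) = {y\<in>W. y $ i < (0::real)}"
    "g ` (U \<inter> frontier \<Omega>) = {y\<in>W. y $ i = 0}" "y \<in> U"
  shows "y \<in> \<Omega> \<longleftrightarrow> g y $ i < 0" "y \<in> frontier \<Omega> \<longleftrightarrow> g y $ i = 0"
proof -
  have gW: "g z \<in> W" and hg: "h (g z) = z" if "z \<in> U" for z
    using assms(1) that by (auto simp: homeomorphism_def)
  have *: "y \<in> S \<longleftrightarrow> g y \<in> g ` (U \<inter> S)" for S
    using hg assms(4) by (metis Int_iff imageE image_eqI)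
  show "y \<in> \<Omega> \<longleftrightarrow> g y $ i < 0" "y \<in> frontier \<Omega> \<longleftrightarrow> g y $ i = 0"
    unfolding *[of \<Omega>] *[of "frontier \<Omega>"] assms(2,3) using gW[OF assms(4)] by simp_all
qed

lemma chart_curve:
  fixes g h :: "'a::euclidean_space \<Rightarrow> 'a"
  assumes "open U" "open W" "homeomorphism U W g h" "Ck_on 1 g U" "Ck_on 1 h W" "y \<in> U"
  obtains \<delta> where "\<delta> > 0" "\<And>s. \<bar>s\<bar> < \<delta> \<Longrightarrow> g y + s *\<^sub>R b \<in> W"
    "\<And>s. \<bar>s\<bar> < \<delta> \<Longrightarrow> h (g y + s *\<^sub>R b) \<in> U" "\<And>s. \<bar>s\<bar> < \<delta> \<Longrightarrow> g (h (g y + s *\<^sub>R b)) = g y + s *\<^sub>R b"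
    "h (g y + 0 *\<^sub>R b) = y"
    "((\<lambda>s. h (g y + s *\<^sub>R b)) has_vector_derivative fderiv h (g y) b) (at 0)"
proof -
  have gy: "g y \<in> W" "h (g y) = y" using assms(3,6) by (auto simp: homeomorphism_def)
  have h: "(h has_derivative fderiv h (g y + 0 *\<^sub>R b)) (at (g y + 0 *\<^sub>R b))"
    using Ck_on_1_has_derivative[OF assms(5) gy(1)] by simp
  have "((\<lambda>s. g y + s *\<^sub>R b) has_derivative (\<lambda>s. s *\<^sub>R b)) (at 0)" by (auto intro!: derivative_eq_intros)
  from has_derivative_compose[OF this h]
  have d: "((\<lambda>s. h (g y + s *\<^sub>R b)) has_vector_derivative fderiv h (g y) b) (at 0)"
    using linear_scale[OF has_derivative_linear[OF h]] by (simp add: has_vector_derivative_def)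
  have "continuous_on UNIV (\<lambda>s::real. g y + s *\<^sub>R b)" by (intro continuous_intros)
  then have "open ((\<lambda>s::real. g y + s *\<^sub>R b) -` W)" using assms(2) by (simp add: open_vimage)
  moreover have "0 \<in> (\<lambda>s::real. g y + s *\<^sub>R b) -` W" using gy by simp
  ultimately obtain \<delta> where "\<delta> > 0" "ball 0 \<delta> \<subseteq> (\<lambda>s::real. g y + s *\<^sub>R b) -` W"
    using open_contains_ball by metis
  moreover from this(2) have W: "g y + s *\<^sub>R b \<in> W" if "\<bar>s\<bar> < \<delta>" for s
    using that by (auto simp: subset_iff)
  moreover have hU: "h z \<in> U" "g (h z) = z" if "z \<in> W" for z
    using assms(3) that unfolding homeomorphism_def by auto
  ultimately show ?thesis by (intro that[OF _ W hU(1)[OF W] hU(2)[OF W] _ d]) (simp_all add: gy)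
qed

text \<open>The last property makes sums of such functions nondegenerate: a curve that leaves \<open>\<Omega>\<close> through \<open>y\<close>
makes the derivative of every function with these signs nonnegative.\<close>

definition local_defining_function ::
  "nat \<Rightarrow> (real^'n) set \<Rightarrow> real^'n \<Rightarrow> real \<Rightarrow> (real^'n \<Rightarrow> real) \<Rightarrow> bool" where
  "local_defining_function k \<Omega> p r \<psi> \<longleftrightarrow> r > 0 \<and> Ck_on k \<psi> UNIV \<and> (\<forall>y\<in>frontier \<Omega>. \<psi> y = 0) \<and>
    (\<forall>y\<in>\<Omega>. \<psi> y \<le> 0) \<and> (\<forall>y. y \<notin> \<Omega> \<longrightarrow> \<psi> y \<ge> 0) \<and>
    (\<forall>y\<in>\<Omega>. y \<in> ball p r \<longrightarrow> \<psi> y < 0) \<and> (\<forall>y. y \<notin> closure \<Omega> \<longrightarrow> y \<in> ball p r \<longrightarrow> \<psi> y > 0) \<and>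
    (\<forall>y\<in>frontier \<Omega>. y \<in> ball p r \<longrightarrow> (\<exists>\<gamma> \<nu>. \<gamma> (0::real) = y \<and> (\<gamma> has_vector_derivative \<nu>) (at 0) \<and>
       (\<forall>\<^sub>F s in at_right 0. \<gamma> s \<notin> \<Omega>) \<and> fderiv \<psi> y \<nu> > 0))"

text \<open>The \<open>i\<close>-th chart coordinate has the required signs but exists only on \<open>U\<close>; multiplied by a cut-off
function it extends by zero. The curve through \<open>y\<close> is the preimage of a coordinate line.\<close>

lemma local_defining_function_exists:
  fixes \<Omega> :: "(real^'n) set"
  assumes "Ck_domain k \<Omega>" "1 \<le> k" "p \<in> frontier \<Omega>"
  shows "\<exists>r \<psi>. local_defining_function k \<Omega> p r \<psi>"
proof -
  obtain U W :: "(real^'n) set" and g h i where ch: "open U" "p \<in> U" "open W" "homeomorphism U W g h" "Ck_on k g U" "Ck_on k h W"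
    "g ` (U \<inter> \<Omega>) = {y\<in>W. y $ i < 0}" "g ` (U \<inter> frontier \<Omega>) = {y\<in>W. y $ i = 0}"
    using assms unfolding Ck_domain_def by blast
  note side = chart_sides[OF ch(4,7,8)]
  have g1: "Ck_on 1 g U" and h1: "Ck_on 1 h W" using Ck_on_mono ch(5,6) assms(2) by blast+
  obtain r where r: "r > 0" "cball p r \<subseteq> U" using ch(1,2) open_contains_cball by metis
  define \<beta> where "\<beta> y = max 0 (r\<^sup>2 - (norm (y - p))\<^sup>2) ^ Suc k" for y
  define \<psi> where "\<psi> y = (if y \<in> U then \<beta> y * g y $ i else 0)" for y
  have chi: "\<beta> y \<ge> 0" "\<beta> y > 0 \<longleftrightarrow> y \<in> ball p r" "y \<notin> ball p r \<Longrightarrow> \<beta> y = 0" for y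
  proof -
    have "norm (y - p) < r \<longleftrightarrow> (norm (y - p))\<^sup>2 < r\<^sup>2"
      using r(1) power_strict_mono[of "norm (y - p)" r 2] power2_less_imp_less[of "norm (y - p)" r] by auto
    then have "y \<in> ball p r \<longleftrightarrow> r\<^sup>2 - (norm (y - p))\<^sup>2 > 0" by (simp add: dist_norm norm_minus_commute)
    then show "\<beta> y \<ge> 0" "\<beta> y > 0 \<longleftrightarrow> y \<in> ball p r" "y \<notin> ball p r \<Longrightarrow> \<beta> y = 0"
      by (auto simp: \<beta>_def max_def)
  qed
  have chiC: "Ck_on k \<beta> UNIV" using Ck_on_bump by (simp add: \<beta>_def[abs_def])
  have blc: "bounded_linear (\<lambda>v::real^'n. v $ i)" by (rule bounded_linear_vec_nth)
  have "Ck_on k (\<lambda>y. \<beta> y * g y $ i) U"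
    by (intro Ck_on_mult ch Ck_on_bounded_linear[OF blc] Ck_on_subset[OF chiC]) auto
  from Ck_on_cong[OF ch(1) _ this, of \<psi>] have "Ck_on k \<psi> U" by (simp add: \<psi>_def)
  moreover have "Ck_on k \<psi> (- cball p r)"
  proof (rule Ck_on_cong)
    show "Ck_on k (\<lambda>y. 0::real) (- cball p r)" by (rule Ck_on_const) auto
    show "0 = \<psi> y" if "y \<in> - cball p r" for y using chi(3)[of y] that by (simp add: \<psi>_def)
  qed auto
  moreover have "U \<union> - cball p r = UNIV" using r by auto
  ultimately have C: "Ck_on k \<psi> UNIV" using Ck_on_Un[OF ch(1), of "- cball p r" k \<psi>] by auto
  have pos: "g y $ i > 0" if "y \<in> U" "y \<notin> closure \<Omega>" for y
  proof -
    have "y \<notin> \<Omega>" "y \<notin> frontier \<Omega>" using that closure_subset by (auto simp: frontier_def)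
    then show ?thesis using side[OF that(1)] by linarith
  qed
  have bU: "y \<in> U" if "y \<in> ball p r" for y using r that by auto
  have cur: "\<exists>\<gamma> \<nu>. \<gamma> (0::real) = y \<and> (\<gamma> has_vector_derivative \<nu>) (at 0) \<and>
       (\<forall>\<^sub>F s in at_right 0. \<gamma> s \<notin> \<Omega>) \<and> fderiv \<psi> y \<nu> > 0"
    if y: "y \<in> frontier \<Omega>" "y \<in> ball p r" for y
  proof -
    have yU: "y \<in> U" using bU y by blast
    obtain \<delta> where d: "\<delta> > 0" "\<And>s. \<bar>s\<bar> < \<delta> \<Longrightarrow> g y + s *\<^sub>R axis i 1 \<in> W"
      "\<And>s. \<bar>s\<bar> < \<delta> \<Longrightarrow> h (g y + s *\<^sub>R axis i 1) \<in> U" "\<And>s. \<bar>s\<bar> < \<delta> \<Longrightarrow> g (h (g y + s *\<^sub>R axis i 1)) = g y + s *\<^sub>R axis i 1"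
      "h (g y + 0 *\<^sub>R axis i 1) = y"
      "((\<lambda>s. h (g y + s *\<^sub>R axis i 1)) has_vector_derivative fderiv h (g y) (axis i 1)) (at 0)"
      by (rule chart_curve[OF ch(1,3,4) g1 h1 yU, where b="axis i 1"]) (rule that)
    define \<gamma> where "\<gamma> s = h (g y + s *\<^sub>R axis i 1)" for s
    define \<nu> where "\<nu> = fderiv h (g y) (axis i 1)"
    have g0: "\<gamma> 0 = y" using d(5) by (simp add: \<gamma>_def)
    have gd: "(\<gamma> has_vector_derivative \<nu>) (at 0)" using d(6) by (simp add: \<gamma>_def[abs_def] \<nu>_def)
    have gi: "g (\<gamma> s) $ i = s" "\<gamma> s \<in> U" if "\<bar>s\<bar> < \<delta>" for s
      using d that side[OF yU] y by (auto simp: \<gamma>_def)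
    have "\<forall>\<^sub>F s in at_right 0. \<gamma> s \<notin> \<Omega>"
      using d(1) gi side(1) unfolding eventually_at_right_field by (intro exI[of _ \<delta>]) force
    moreover have "fderiv \<psi> y \<nu> = \<beta> y"
    proof -
      have "Ck_on (Suc 0) \<psi> UNIV" "Ck_on (Suc 0) \<beta> UNIV" using Ck_on_mono[OF C assms(2)] Ck_on_mono[OF chiC assms(2)] by simp_all
      from Ck_on_Suc_has_derivative[OF this(1)] Ck_on_Suc_has_derivative[OF this(2)]
      have D: "(\<psi> has_derivative fderiv \<psi> y) (at (\<gamma> 0))"
          "(\<beta> has_derivative fderiv \<beta> y) (at (\<gamma> 0))" using g0 by auto
      note gd' = gd[unfolded has_vector_derivative_def]
      have "((\<lambda>s. \<beta> (\<gamma> s) * s) has_derivative (\<lambda>s. \<beta> (\<gamma> 0) * s + fderiv \<beta> y (s *\<^sub>R \<nu>) * 0)) (at 0)"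
        by (intro has_derivative_mult has_derivative_compose[OF gd' D(2)] has_derivative_ident)
      then have "((\<lambda>s. \<psi> (\<gamma> s)) has_derivative (\<lambda>s. \<beta> (\<gamma> 0) * s + fderiv \<beta> y (s *\<^sub>R \<nu>) * 0)) (at 0)"
        by (rule has_derivative_transform_within_open[of _ _ _ _ "ball 0 \<delta>"]) (use d gi in \<open>auto simp: \<psi>_def\<close>)
      from fun_cong[OF has_derivative_unique[OF this has_derivative_compose[OF gd' D(1)]], of 1]
      show ?thesis using g0 by simp
    qed
    ultimately show ?thesis
      using g0 gd chi(2) y(2) by (intro exI[of _ \<gamma>] exI[of _ \<nu>]) auto
  qed
  have "\<psi> y = 0" if "y \<in> frontier \<Omega>" for y using side(2)[of y] that by (simp add: \<psi>_def)
  moreover have "\<psi> y \<le> 0" if "y \<in> \<Omega>" for y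
    using side(1)[of y] that mult_nonneg_nonpos[OF chi(1)[of y], of "g y $ i"] by (auto simp: \<psi>_def)
  moreover have "\<psi> y \<ge> 0" if "y \<notin> \<Omega>" for y
    using side(1)[of y] that mult_nonneg_nonneg[OF chi(1)[of y], of "g y $ i"] by (auto simp: \<psi>_def)
  moreover have "\<psi> y < 0" if "y \<in> \<Omega>" "y \<in> ball p r" for y
    using side(1)[OF bU] that chi(2)[of y] bU[OF that(2)] by (simp add: \<psi>_def mult_pos_neg)
  moreover have "\<psi> y > 0" if "y \<notin> closure \<Omega>" "y \<in> ball p r" for y
    using pos[OF bU] that chi(2)[of y] bU[OF that(2)] by (simp add: \<psi>_def)
  ultimately have "local_defining_function k \<Omega> p r \<psi>"
    unfolding local_defining_function_def using r(1) C cur by blast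
  then show ?thesis by blast
qed

text \<open>The boundary is compact, hence covered by finitely many balls on which a local defining function
exists. Their sum works: all summands have weakly the same sign everywhere, and their derivatives
cannot cancel.\<close>

lemma defining_function:
  fixes \<Omega> :: "(real^'n) set"
  assumes "Ck_domain k \<Omega>" "1 \<le> k"
  obtains \<phi> B where "open B" "frontier \<Omega> \<subseteq> B" "Ck_on k \<phi> UNIV"
    "\<And>y. y \<in> frontier \<Omega> \<Longrightarrow> \<phi> y = (0::real)"
    "\<And>y. y \<in> \<Omega> \<Longrightarrow> y \<in> B \<Longrightarrow> \<phi> y < 0" "\<And>y. y \<in> B \<Longrightarrow> y \<notin> closure \<Omega> \<Longrightarrow> \<phi> y > 0"
    "\<And>y. y \<in> frontier \<Omega> \<Longrightarrow> \<exists>\<nu>. fderiv \<phi> y \<nu> > 0"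
proof -
  have "\<exists>r \<psi>. local_defining_function k \<Omega> p r \<psi>" if "p \<in> frontier \<Omega>" for p
    by (rule local_defining_function_exists[OF assms that])
  then have "\<forall>p\<in>frontier \<Omega>. \<exists>q. local_defining_function k \<Omega> p (fst q) (snd q)" by force
  from bchoice[OF this] obtain q where "\<forall>p\<in>frontier \<Omega>. local_defining_function k \<Omega> p (fst (q p)) (snd (q p))" ..
  then obtain r \<psi> where gd: "\<And>p. p \<in> frontier \<Omega> \<Longrightarrow> local_defining_function k \<Omega> p (r p) (\<psi> p)"
    using that[of "\<lambda>p. fst (q p)" "\<lambda>p. snd (q p)"] by auto
  have "compact (frontier \<Omega>)"
    using assms(1) by (auto simp: Ck_domain_def compact_frontier_bounded)
  moreover have "frontier \<Omega> \<subseteq> (\<Union>p\<in>frontier \<Omega>. ball p (r p))"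
  proof
    fix p assume p: "p \<in> frontier \<Omega>"
    then have "r p > 0" using gd unfolding local_defining_function_def by blast
    then show "p \<in> (\<Union>p\<in>frontier \<Omega>. ball p (r p))"
      using UN_I[OF p, of p "\<lambda>p. ball p (r p)"] by simp
  qed
  ultimately obtain T where T: "T \<subseteq> frontier \<Omega>" "finite T" "frontier \<Omega> \<subseteq> (\<Union>p\<in>T. ball p (r p))"
    using compactE_image[of "frontier \<Omega>" "frontier \<Omega>" "\<lambda>p. ball p (r p)"] by auto
  have gT: "local_defining_function k \<Omega> p (r p) (\<psi> p)" if "p \<in> T" for p using gd T that by blast
  define \<phi> where "\<phi> y = (\<Sum>p\<in>T. \<psi> p y)" for y
  have C: "Ck_on k \<phi> UNIV" unfolding \<phi>_def[abs_def] using gT by (intro Ck_on_sum) (auto simp: local_defining_function_def)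
  show ?thesis
  proof (rule that[of "\<Union>p\<in>T. ball p (r p)" \<phi>])
    show "\<phi> y = 0" if "y \<in> frontier \<Omega>" for y
      unfolding \<phi>_def using gT that by (intro sum.neutral) (auto simp: local_defining_function_def)
    show "\<phi> y < 0" if "y \<in> \<Omega>" and yB: "y \<in> (\<Union>p\<in>T. ball p (r p))" for y
    proof -
      obtain q where q: "q \<in> T" "y \<in> ball q (r q)" using yB by blast
      have "(\<Sum>p\<in>T. - \<psi> p y) > 0"
        using T(2) q that gT by (intro sum_pos2[of T q]) (auto simp: local_defining_function_def)
      then show ?thesis by (simp add: \<phi>_def sum_negf)
    qed
    show "\<phi> y > 0" if yB: "y \<in> (\<Union>p\<in>T. ball p (r p))" and yc: "y \<notin> closure \<Omega>" for y
    proof -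
      obtain q where q: "q \<in> T" "y \<in> ball q (r q)" using yB by blast
      have "y \<notin> \<Omega>" using yc closure_subset by blast
      then show ?thesis unfolding \<phi>_def
        using T(2) q yc gT by (intro sum_pos2[of T q]) (auto simp: local_defining_function_def)
    qed
    show "\<exists>\<nu>. fderiv \<phi> y \<nu> > 0" if y: "y \<in> frontier \<Omega>" for y
    proof -
      obtain q where q: "q \<in> T" "y \<in> ball q (r q)" using T y by blast
      then obtain \<gamma> \<nu> where c: "\<gamma> (0::real) = y" "(\<gamma> has_vector_derivative \<nu>) (at 0)"
        "\<forall>\<^sub>F s in at_right 0. \<gamma> s \<notin> \<Omega>" "fderiv (\<psi> q) y \<nu> > 0"
        using gT[OF q(1)] y unfolding local_defining_function_def by blast
      have D: "(\<psi> p has_derivative fderiv (\<psi> p) y) (at y)" if "p \<in> T" for p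
      proof -
        have "Ck_on 1 (\<psi> p) UNIV" using gT[OF that] assms(2) Ck_on_mono unfolding local_defining_function_def by blast
        then show ?thesis using Ck_on_Suc_has_derivative[of 0 "\<psi> p" UNIV y] by simp
      qed
      have nn: "fderiv (\<psi> p) y \<nu> \<ge> 0" if "p \<in> T" for p
      proof -
        have "((\<lambda>s. \<psi> p (\<gamma> s)) has_real_derivative fderiv (\<psi> p) y \<nu>) (at 0)"
        proof -
          have "(\<psi> p has_derivative fderiv (\<psi> p) y) (at (\<gamma> 0))" using D[OF that] c(1) by simp
          from has_derivative_compose[OF c(2)[unfolded has_vector_derivative_def] this] show ?thesis
            using linear_scale[OF has_derivative_linear[OF D[OF that]]]
            by (simp add: has_field_derivative_def mult_commute_abs)
        qed
        then have "((\<lambda>s. (\<psi> p (\<gamma> s) - \<psi> p (\<gamma> 0)) / (s - 0)) \<longlongrightarrow> fderiv (\<psi> p) y \<nu>) (at_right 0)"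
          unfolding has_field_derivative_iff by (rule filterlim_mono) (auto simp: at_le)
        moreover have "\<psi> p (\<gamma> 0) = 0" using gT[OF that] y c(1) by (simp add: local_defining_function_def)
        moreover have "\<forall>\<^sub>F s in at_right 0. s > (0::real)" by (simp add: eventually_at_right_less)
        then have "\<forall>\<^sub>F s in at_right 0. \<psi> p (\<gamma> s) / s \<ge> 0"
          using c(3) by eventually_elim (use gT[OF that] in \<open>auto simp: local_defining_function_def\<close>)
        ultimately show ?thesis by (intro tendsto_lowerbound[of "\<lambda>s. \<psi> p (\<gamma> s) / s"]) auto
      qed
      have "(\<phi> has_derivative (\<lambda>e. \<Sum>p\<in>T. fderiv (\<psi> p) y e)) (at y)"
        unfolding \<phi>_def[abs_def] by (intro has_derivative_sum D)
      then have "fderiv \<phi> y \<nu> = (\<Sum>p\<in>T. fderiv (\<psi> p) y \<nu>)"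
        using frechet_derivative_at by metis
      also have "\<dots> > 0" using T(2) q c(4) nn by (intro sum_pos2[of T q]) auto
      finally show ?thesis by blast
    qed
  qed (use T C in auto)
qed

text \<open>A function that vanishes on the boundary is constant along curves in it, which gives one
inclusion. For the other one, the chart provides curves in the boundary with every velocity whose
\<open>i\<close>-th chart coordinate is zero; modulo these velocities the derivative of \<open>\<phi>\<close> is determined by the
\<open>i\<close>-th coordinate, and it is not zero.\<close>

lemma tangent_space_eq_kernel:
  fixes \<Omega> :: "(real^'n) set" and \<phi> :: "real^'n \<Rightarrow> real"
  assumes "Ck_domain 1 \<Omega>" "y \<in> frontier \<Omega>" "\<phi> differentiable (at y)"
    "\<And>z. z \<in> frontier \<Omega> \<Longrightarrow> \<phi> z = 0" "\<exists>\<nu>. fderiv \<phi> y \<nu> > 0"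
  shows "tangent_space (frontier \<Omega>) y = {\<tau>. fderiv \<phi> y \<tau> = 0}"
proof -
  define D where "D = fderiv \<phi> y"
  have D: "(\<phi> has_derivative D) (at y)" using assms(3) by (simp add: D_def frechet_derivative_works)
  have linD: "linear D" using has_derivative_linear[OF D] .
  have 1: "D \<tau> = 0" if "\<tau> \<in> tangent_space (frontier \<Omega>) y" for \<tau>
  proof -
    from that obtain \<gamma> \<delta> where c: "\<delta> > 0" "\<gamma> 0 = y" "\<gamma> ` {-\<delta><..<\<delta>} \<subseteq> frontier \<Omega>"
      "(\<gamma> has_vector_derivative \<tau>) (at (0::real))" unfolding tangent_space_def by blast
    have "\<phi> (\<gamma> s) = 0" if "s \<in> {-\<delta><..<\<delta>}" for s using assms(4) c(3) that by blast
    note zero = this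
    have "((\<lambda>s. \<phi> (\<gamma> s)) has_derivative (\<lambda>s. D (s *\<^sub>R \<tau>))) (at 0)"
      using has_derivative_compose[OF c(4)[unfolded has_vector_derivative_def], of \<phi>] D c(2) by simp
    moreover have "((\<lambda>s. \<phi> (\<gamma> s)) has_derivative (\<lambda>s. 0)) (at 0)"
      by (rule has_derivative_transform_within_open[of "\<lambda>s. 0" _ _ _ "{-\<delta><..<\<delta>}"]) (use c(1) zero in auto)
    ultimately have "(\<lambda>s. D (s *\<^sub>R \<tau>)) = (\<lambda>s. 0)" by (rule has_derivative_unique)
    from fun_cong[OF this, of 1] show ?thesis by simp
  qed
  obtain U W :: "(real^'n) set" and g h i where ch: "open U" "y \<in> U" "open W" "homeomorphism U W g h" "Ck_on 1 g U" "Ck_on 1 h W"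
    "g ` (U \<inter> \<Omega>) = {y\<in>W. y $ i < 0}" "g ` (U \<inter> frontier \<Omega>) = {y\<in>W. y $ i = 0}"
    using assms(1,2) unfolding Ck_domain_def by blast
  note side = chart_sides[OF ch(4,7,8)]
  define G where "G = fderiv g y"
  define H where "H = fderiv h (g y)"
  have HG: "H (G e) = e" for e using chart_derivative_inverse(1)[OF ch(1,3-6,2)] by (simp add: G_def H_def)
  have "g y \<in> W" using ch(2,4) by (auto simp: homeomorphism_def)
  then have linH: "linear H" unfolding H_def using Ck_on_1_has_derivative[OF ch(6)] has_derivative_linear by blast
  have tan: "H b \<in> tangent_space (frontier \<Omega>) y" if "b $ i = 0" for b
  proof -
    obtain \<delta> where d: "\<delta> > 0" "\<And>s. \<bar>s\<bar> < \<delta> \<Longrightarrow> g y + s *\<^sub>R b \<in> W"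
      "\<And>s. \<bar>s\<bar> < \<delta> \<Longrightarrow> h (g y + s *\<^sub>R b) \<in> U" "\<And>s. \<bar>s\<bar> < \<delta> \<Longrightarrow> g (h (g y + s *\<^sub>R b)) = g y + s *\<^sub>R b"
      "h (g y + 0 *\<^sub>R b) = y"
      "((\<lambda>s. h (g y + s *\<^sub>R b)) has_vector_derivative fderiv h (g y) b) (at 0)"
      by (rule chart_curve[OF ch(1,3-6,2), where b=b]) (rule that)
    have "h (g y + s *\<^sub>R b) \<in> frontier \<Omega>" if "\<bar>s\<bar> < \<delta>" for s
      using side(2)[OF d(3)[OF that]] d(4)[OF that] side(2)[OF ch(2)] assms(2) \<open>b $ i = 0\<close> by simp
    then show ?thesis unfolding tangent_space_def H_def using d(1,5,6)
      by (intro CollectI exI[of _ "\<lambda>s. h (g y + s *\<^sub>R b)"] exI[of _ \<delta>]) auto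
  qed
  have 2: "\<tau> \<in> tangent_space (frontier \<Omega>) y" if "D \<tau> = 0" for \<tau>
  proof -
    have split: "D v = (G v $ i) * D (H (axis i 1))" for v
    proof -
      (* b is the part of v that is tangential in the chart *)
      define b where "b = G v - (G v $ i) *\<^sub>R axis i 1"
      have "D (H b) = 0" using 1 tan[of b] by (simp add: b_def axis_def)
      moreover have "v = H b + (G v $ i) *\<^sub>R H (axis i 1)"
        unfolding b_def using linH HG[of v] by (simp add: linear_diff linear_scale)
      then have "D v = D (H b + (G v $ i) *\<^sub>R H (axis i 1))" by (rule arg_cong)
      ultimately show ?thesis using linD by (simp add: linear_add linear_scale)
    qed
    obtain \<nu> where "D \<nu> > 0" using assms(5) by (auto simp: D_def)
    then have "D (H (axis i 1)) \<noteq> 0" using split[of \<nu>] by auto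
    then have "G \<tau> $ i = 0" using split[of \<tau>] that by simp
    from tan[OF this] show ?thesis by (simp add: HG)
  qed
  show ?thesis using 1 2 by (auto simp flip: D_def)
qed

definition gradient :: "('a::euclidean_space \<Rightarrow> real) \<Rightarrow> 'a \<Rightarrow> 'a" where
  "gradient f y = (\<Sum>b\<in>Basis. fderiv f y b *\<^sub>R b)"

lemma gradient_inner: "f differentiable (at y) \<Longrightarrow> gradient f y \<bullet> e = fderiv f y e"
proof -
  assume "f differentiable (at y)"
  from linear_Basis_expansion[OF linear_frechet_derivative[OF this], of e]
  have "fderiv f y e = (\<Sum>b\<in>Basis. (e \<bullet> b) * fderiv f y b)" by simp
  also have "\<dots> = gradient f y \<bullet> e"
    unfolding gradient_def inner_sum_left by (intro sum.cong) (auto simp: inner_commute)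
  finally show ?thesis by simp
qed

lemma Ck_on_gradient: "open U \<Longrightarrow> Ck_on (Suc k) f U \<Longrightarrow> Ck_on k (gradient f) U"
  unfolding gradient_def[abs_def] by (intro Ck_on_sum Ck_on_scaleR Ck_on_const) auto

lemma same_orthogonal_complement:
  fixes a b :: "'a::euclidean_space"
  assumes "a \<noteq> 0" "\<And>\<tau>. a \<bullet> \<tau> = 0 \<Longrightarrow> b \<bullet> \<tau> = 0"
  shows "b = ((a \<bullet> b) / (a \<bullet> a)) *\<^sub>R a"
proof -
  define c where "c = (a \<bullet> b) / (a \<bullet> a)"
  have a: "a \<bullet> (b - c *\<^sub>R a) = 0" using assms(1) by (simp add: c_def inner_diff_right)
  then have "b \<bullet> (b - c *\<^sub>R a) = 0" by (rule assms(2))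
  then have "(b - c *\<^sub>R a) \<bullet> (b - c *\<^sub>R a) = 0" using a by (simp add: inner_diff_left)
  then show ?thesis by (simp add: c_def)
qed

definition C1_boundary :: "(real^'n) set \<Rightarrow> bool" where
  "C1_boundary \<Gamma> \<longleftrightarrow> (\<exists>\<Omega>. Ck_domain 1 \<Omega> \<and> frontier \<Omega> = \<Gamma>)"

lemma enclosed_domain:
  assumes "C1_boundary \<Gamma>"
  shows "Ck_domain 1 (enclosed_domain \<Gamma>)" "frontier (enclosed_domain \<Gamma>) = \<Gamma>"
  using someI_ex[OF assms[unfolded C1_boundary_def]] unfolding enclosed_domain_def by auto

text \<open>By \<open>tangent_space_eq_kernel\<close> the unit vectors orthogonal to the tangent space are the two
normalizations of the gradient. Since \<open>\<phi>\<close> is negative inside and positive outside, only the one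
along which \<open>\<phi>\<close> increases points outward. This shows that the definite description in
\<open>outward_normal\<close> denotes.\<close>

lemma C1_boundary_defining_function:
  fixes \<Gamma> :: "(real^'n) set"
  assumes "C1_boundary \<Gamma>"
  obtains \<phi> where "Ck_on 1 \<phi> UNIV" "\<And>y. y \<in> \<Gamma> \<Longrightarrow> gradient \<phi> y \<noteq> 0"
    "\<And>y. y \<in> \<Gamma> \<Longrightarrow> tangent_space \<Gamma> y = {\<tau>. gradient \<phi> y \<bullet> \<tau> = 0}"
    "\<And>y. y \<in> \<Gamma> \<Longrightarrow> outward_normal \<Gamma> y = gradient \<phi> y /\<^sub>R norm (gradient \<phi> y)"
proof -
  define \<Omega> where "\<Omega> = enclosed_domain \<Gamma>"
  have dom: "Ck_domain 1 \<Omega>" and fr: "frontier \<Omega> = \<Gamma>" using enclosed_domain[OF assms] by (auto simp: \<Omega>_def)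
  obtain \<phi> B where df: "open B" "frontier \<Omega> \<subseteq> B" "Ck_on 1 \<phi> UNIV"
    "\<And>y. y \<in> frontier \<Omega> \<Longrightarrow> \<phi> y = (0::real)"
    "\<And>y. y \<in> \<Omega> \<Longrightarrow> y \<in> B \<Longrightarrow> \<phi> y < 0" "\<And>y. y \<in> B \<Longrightarrow> y \<notin> closure \<Omega> \<Longrightarrow> \<phi> y > 0"
    "\<And>y. y \<in> frontier \<Omega> \<Longrightarrow> \<exists>\<nu>. fderiv \<phi> y \<nu> > 0"
    by (rule defining_function[OF dom order_refl]) (rule that)
  have diff: "\<phi> differentiable (at y)" for y using df(3) by simp
  note gi = gradient_inner[OF diff]
  have nz: "gradient \<phi> y \<noteq> 0" if "y \<in> \<Gamma>" for y
    using df(7)[of y] that fr gi[of y] by (metis inner_zero_left less_irrefl)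
  have ts: "tangent_space \<Gamma> y = {\<tau>. gradient \<phi> y \<bullet> \<tau> = 0}" if "y \<in> \<Gamma>" for y
    using tangent_space_eq_kernel[OF dom _ diff df(4) df(7), of y] that fr gi by simp
  have on: "outward_normal \<Gamma> y = gradient \<phi> y /\<^sub>R norm (gradient \<phi> y)" if y: "y \<in> \<Gamma>" for y
  proof -
    define n where "n = gradient \<phi> y /\<^sub>R norm (gradient \<phi> y)"
    have n1: "norm n = 1" using nz[OF y] by (simp add: n_def)
    have nt: "n \<bullet> \<tau> = 0" if "\<tau> \<in> tangent_space \<Gamma> y" for \<tau> using that ts[OF y] by (simp add: n_def)
    have gn: "gradient \<phi> y \<bullet> n > 0" using nz[OF y] by (simp add: n_def)
    have "((\<lambda>s. \<phi> (y + s *\<^sub>R n)) has_real_derivative (gradient \<phi> y \<bullet> n)) (at 0)"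
    proof -
      have 1: "((\<lambda>s. y + s *\<^sub>R n) has_derivative (\<lambda>s. s *\<^sub>R n)) (at (0::real))" by (auto intro!: derivative_eq_intros)
      have "(\<phi> has_derivative fderiv \<phi> y) (at (y + 0 *\<^sub>R n))"
        using diff[of y] by (simp add: frechet_derivative_works)
      from has_derivative_compose[OF 1 this] show ?thesis
        unfolding gi[symmetric] by (simp add: has_field_derivative_def mult_commute_abs)
    qed
    from has_real_derivative_pos_inc_right[OF this gn] has_real_derivative_pos_inc_left[OF this gn]
    obtain d1 d2 where d: "d1 > 0" "\<And>s. 0 < s \<Longrightarrow> s < d1 \<Longrightarrow> \<phi> y < \<phi> (y + s *\<^sub>R n)"
      "d2 > 0" "\<And>s. 0 < s \<Longrightarrow> s < d2 \<Longrightarrow> \<phi> (y - s *\<^sub>R n) < \<phi> y"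
      by auto
    obtain d3 where d3: "d3 > 0" "ball y d3 \<subseteq> B" using df(1,2) y fr open_contains_ball by blast
    have phy: "\<phi> y = 0" using df(4) y fr by simp
    have ev: "y - s *\<^sub>R n \<in> \<Omega> \<and> y + s *\<^sub>R n \<notin> closure \<Omega>" if "0 < s" "s < min (min d1 d2) d3" for s
    proof -
      have B: "y - s *\<^sub>R n \<in> B" "y + s *\<^sub>R n \<in> B" using d3 that n1 by (auto simp: subset_iff dist_norm)
      have cl: "closure \<Omega> = \<Omega> \<union> frontier \<Omega>" using dom by (auto simp: Ck_domain_def frontier_def interior_open closure_subset[THEN subsetD])
      have "\<phi> (y - s *\<^sub>R n) < 0" "\<phi> (y + s *\<^sub>R n) > 0" using d that phy by auto
      then show ?thesis using df(4)[of "y - s *\<^sub>R n"] df(4)[of "y + s *\<^sub>R n"] df(5)[of "y + s *\<^sub>R n"] df(6)[of "y - s *\<^sub>R n"] B cl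
        by (metis Un_iff less_asym less_irrefl)
    qed
    have posd: "min (min d1 d2) d3 > 0" using d d3 by simp
    show ?thesis unfolding outward_normal_def n_def[symmetric] \<Omega>_def[symmetric]
    proof (rule the_equality)
      show "norm n = 1 \<and> (\<forall>\<tau>\<in>tangent_space \<Gamma> y. n \<bullet> \<tau> = 0) \<and>
        (\<forall>\<^sub>F s in at_right 0. y - s *\<^sub>R n \<in> \<Omega> \<and> y + s *\<^sub>R n \<notin> closure \<Omega>)"
        using n1 nt ev posd unfolding eventually_at_right_field by blast
      fix m assume m: "norm m = 1 \<and> (\<forall>\<tau>\<in>tangent_space \<Gamma> y. m \<bullet> \<tau> = 0) \<and>
        (\<forall>\<^sub>F s in at_right 0. y - s *\<^sub>R m \<in> \<Omega> \<and> y + s *\<^sub>R m \<notin> closure \<Omega>)"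
      have "m = ((n \<bullet> m) / (n \<bullet> n)) *\<^sub>R n"
        using m n1 ts[OF y] by (intro same_orthogonal_complement) (auto simp: n_def)
      then obtain c where c: "m = c *\<^sub>R n" by blast
      then have "\<bar>c\<bar> = 1" using m n1 by simp
      moreover have "c \<noteq> -1"
      proof
        assume "c = -1"
        then have mn: "m = - n" using c by simp
        have "\<forall>\<^sub>F s in at_right 0. y - s *\<^sub>R n \<in> \<Omega> \<and> y + s *\<^sub>R n \<notin> closure \<Omega>"
          using ev posd unfolding eventually_at_right_field by blast
        then have "\<forall>\<^sub>F s in at_right (0::real). False"
          using m[THEN conjunct2, THEN conjunct2]
          by eventually_elim (use mn closure_subset[of \<Omega>] in auto)
        then show False by simp
      qed
      ultimately show "m = n" using c by (cases "c \<ge> 0") auto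
    qed
  qed
  show ?thesis using that[OF df(3) nz ts on] .
qed

lemma C1_boundary_compact: "C1_boundary \<Gamma> \<Longrightarrow> compact \<Gamma>"
  by (auto simp: C1_boundary_def Ck_domain_def compact_frontier_bounded)

lemma C1_boundary_normal:
  assumes "C1_boundary \<Gamma>"
  shows "continuous_on \<Gamma> (outward_normal \<Gamma>)" "y \<in> \<Gamma> \<Longrightarrow> norm (outward_normal \<Gamma> y) = 1"
    "y \<in> \<Gamma> \<Longrightarrow> tangent_space \<Gamma> y = {\<tau>. outward_normal \<Gamma> y \<bullet> \<tau> = 0}"
proof -
  obtain \<phi> where df: "Ck_on 1 \<phi> UNIV" "\<And>y. y \<in> \<Gamma> \<Longrightarrow> gradient \<phi> y \<noteq> 0"
    "\<And>y. y \<in> \<Gamma> \<Longrightarrow> tangent_space \<Gamma> y = {\<tau>. gradient \<phi> y \<bullet> \<tau> = 0}"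
    "\<And>y. y \<in> \<Gamma> \<Longrightarrow> outward_normal \<Gamma> y = gradient \<phi> y /\<^sub>R norm (gradient \<phi> y)"
    using C1_boundary_defining_function[OF assms] by blast
  have "continuous_on \<Gamma> (gradient \<phi>)"
    using Ck_on_imp_continuous[OF Ck_on_gradient[of UNIV 0 \<phi>]] df(1) continuous_on_subset by auto
  then have "continuous_on \<Gamma> (\<lambda>y. gradient \<phi> y /\<^sub>R norm (gradient \<phi> y))"
    using df(2) by (intro continuous_intros) auto
  then show "continuous_on \<Gamma> (outward_normal \<Gamma>)" using df(4) by (auto cong: continuous_on_cong)
  show "norm (outward_normal \<Gamma> y) = 1" "tangent_space \<Gamma> y = {\<tau>. outward_normal \<Gamma> y \<bullet> \<tau> = 0}" if "y \<in> \<Gamma>"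
    using df(2-4)[OF that] by auto
qed

lemma C2_domain_imp_C1_boundary: "Ck_domain 2 \<Omega> \<Longrightarrow> C1_boundary (frontier \<Omega>)"
  unfolding C1_boundary_def using Ck_domain_mono[of 2 \<Omega> 1] by auto

text \<open>The domain selected by \<open>enclosed_domain\<close> is only known to be of class \<open>C\<^sup>1\<close>, so its defining
function \<open>\<theta>\<close> yields merely a continuous normal. The \<open>C\<^sup>2\<close> domain \<open>\<Omega>\<close> with the same boundary has a
defining function \<open>\<phi>\<close> of class \<open>C\<^sup>2\<close>. On \<open>\<Gamma>\<close> both gradients are orthogonal to the same
hyperplane, so they are parallel, and the sign of their inner product is locally constant
near \<open>\<Gamma>\<close>. Multiplying the normalized gradient of \<open>\<phi>\<close> by this sign gives a \<open>C\<^sup>1\<close> extension of the normal.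
On tangent vectors its derivative is a multiple of the Hessian of \<open>\<phi>\<close>, because the derivative of the
scalar factor only contributes a multiple of the normal; hence the symmetry.\<close>

lemma C2_boundary_normal_extension:
  fixes \<Omega> :: "(real^'n) set"
  assumes "Ck_domain 2 \<Omega>" and \<Gamma>: "frontier \<Omega> = \<Gamma>"
  obtains U N where "open U" "\<Gamma> \<subseteq> U" "Ck_on 1 N U" "\<And>z. z \<in> U \<Longrightarrow> norm (N z) = 1"
    "\<And>y. y \<in> \<Gamma> \<Longrightarrow> N y = outward_normal \<Gamma> y"
    "\<And>y \<sigma> \<tau>. y \<in> \<Gamma> \<Longrightarrow> N y \<bullet> \<sigma> = 0 \<Longrightarrow> N y \<bullet> \<tau> = 0 \<Longrightarrow>
       fderiv N y \<sigma> \<bullet> \<tau> = fderiv N y \<tau> \<bullet> \<sigma>"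
proof -
  have C1: "C1_boundary \<Gamma>" using C2_domain_imp_C1_boundary assms by blast
  obtain \<phi> B where df: "Ck_on 2 \<phi> UNIV"
    "\<And>y. y \<in> frontier \<Omega> \<Longrightarrow> \<phi> y = (0::real)"
    "\<And>y. y \<in> frontier \<Omega> \<Longrightarrow> \<exists>\<nu>. fderiv \<phi> y \<nu> > 0"
    using defining_function[OF assms(1)] by (metis one_le_numeral)
  obtain \<theta> where th: "Ck_on 1 \<theta> UNIV" "\<And>y. y \<in> \<Gamma> \<Longrightarrow> gradient \<theta> y \<noteq> 0"
    "\<And>y. y \<in> \<Gamma> \<Longrightarrow> tangent_space \<Gamma> y = {\<tau>. gradient \<theta> y \<bullet> \<tau> = 0}"
    "\<And>y. y \<in> \<Gamma> \<Longrightarrow> outward_normal \<Gamma> y = gradient \<theta> y /\<^sub>R norm (gradient \<theta> y)"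
    using C1_boundary_defining_function[OF C1] by blast
  have C2: "Ck_on (Suc (Suc 0)) \<phi> UNIV" using df(1) by (simp add: numeral_2_eq_2)
  have diff: "\<phi> differentiable (at y)" for y using C2 by simp
  note gi = gradient_inner[OF diff]
  have g1: "Ck_on 1 (gradient \<phi>) UNIV" unfolding One_nat_def by (rule Ck_on_gradient[OF _ C2]) auto
  define m where "m z = gradient \<phi> z \<bullet> gradient \<theta> z" for z
  have cm: "continuous_on UNIV m" unfolding m_def[abs_def]
    using Ck_on_imp_continuous[OF g1] Ck_on_imp_continuous[OF Ck_on_gradient[of UNIV 0 \<theta>]] th(1)
    by (intro continuous_intros) auto
  (* on Up and Um the two gradients point to the same and to opposite sides *)
  define Up where "Up = {z. m z > 0}"
  define Um where "Um = {z. m z < 0}"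
  have op: "open Up" "open Um" unfolding Up_def Um_def using cm by (auto intro: open_Collect_less continuous_on_const)
  have nz: "gradient \<phi> z \<noteq> 0" if "z \<in> Up \<union> Um" for z using that by (auto simp: Up_def Um_def m_def)
  define N where "N z = sgn (m z) *\<^sub>R (gradient \<phi> z /\<^sub>R norm (gradient \<phi> z))" for z
  have nC: "Ck_on 1 (\<lambda>z. gradient \<phi> z /\<^sub>R norm (gradient \<phi> z)) S" if "open S" "S \<subseteq> Up \<union> Um" for S
    by (rule Ck_on_1_compose[OF that(1) Ck_on_subset[OF g1] _ _ Ck_on_1_normalize]) (use nz that in auto)
  have "Ck_on 1 N Up"
    by (rule Ck_on_cong[OF op(1) _ nC]) (use op in \<open>auto simp: N_def Up_def\<close>)
  moreover have "Ck_on 1 N Um"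
    by (rule Ck_on_cong[OF op(2) _ Ck_on_bounded_linear[OF bounded_linear_minus[OF bounded_linear_ident] op(2) nC]])
      (use op in \<open>auto simp: N_def Um_def\<close>)
  ultimately have NC: "Ck_on 1 N (Up \<union> Um)" using op Ck_on_Un by blast
  have gam: "m y \<noteq> 0" "N y = outward_normal \<Gamma> y" if y: "y \<in> \<Gamma>" for y
  proof -
    have ts: "tangent_space \<Gamma> y = {\<tau>. gradient \<phi> y \<bullet> \<tau> = 0}"
      using tangent_space_eq_kernel[OF Ck_domain_mono[OF assms(1), of 1] _ diff df(2,3)] y \<Gamma> gi by simp
    have a: "gradient \<phi> y \<noteq> 0" using df(3)[of y] y \<Gamma> gi[of y] by (metis inner_zero_left less_irrefl)
    define c where "c = m y / (gradient \<phi> y \<bullet> gradient \<phi> y)"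
    have eq: "gradient \<theta> y = c *\<^sub>R gradient \<phi> y"
      unfolding c_def m_def using ts th(3)[OF y] by (intro same_orthogonal_complement a) auto
    then have c: "c \<noteq> 0" using th(2)[OF y] by auto
    then show "m y \<noteq> 0" by (auto simp: c_def)
    have "gradient \<phi> y \<bullet> gradient \<phi> y > 0" using a by simp
    moreover have "sgn (u / q) = sgn u" if "q > 0" for u q :: real using that by (simp add: sgn_divide)
    ultimately have "sgn (m y) = sgn c" unfolding c_def by metis
    then show "N y = outward_normal \<Gamma> y" using th(4)[OF y] c a unfolding N_def eq
      by (simp add: sgn_if field_simps)
  qed
  have sym: "fderiv N y \<sigma> \<bullet> \<tau> = fderiv N y \<tau> \<bullet> \<sigma>"
    if y: "y \<in> \<Gamma>" and t: "N y \<bullet> \<sigma> = 0" "N y \<bullet> \<tau> = 0" for y \<sigma> \<tau>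
  proof -
    have yU: "y \<in> Up \<union> Um" using gam[OF y] by (auto simp: Up_def Um_def)
    (* near y the sign is a constant s, so N is a differentiable multiple of the gradient *)
    obtain S s where S: "open S" "y \<in> S" "S \<subseteq> Up \<union> Um" "\<And>z. z \<in> S \<Longrightarrow> sgn (m z) = s"
    proof (cases "y \<in> Up")
      case True then show ?thesis using that[of Up 1] op by (auto simp: Up_def)
    next
      case False then show ?thesis using that[of Um "-1"] op yU by (auto simp: Um_def)
    qed
    define c where "c z = s * inverse (norm (gradient \<phi> z))" for z
    have gd: "(gradient \<phi> has_derivative fderiv (gradient \<phi>) y) (at y)"
      using g1 Ck_on_Suc_has_derivative[of 0 "gradient \<phi>" UNIV y] by simp
    have "(\<lambda>z. norm (gradient \<phi> z)) differentiable (at y)"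
      using has_derivative_compose[OF gd has_derivative_norm[OF nz[OF yU]]] differentiable_def by blast
    then have "c differentiable (at y)" unfolding c_def[abs_def] using nz[OF yU]
      by (intro differentiable_mult differentiable_inverse) auto
    then obtain c' where c': "(c has_derivative c') (at y)" by (auto simp: differentiable_def)
    have Nc: "N z = c z *\<^sub>R gradient \<phi> z" if "z \<in> S" for z
      using S(4)[OF that] by (simp add: N_def c_def)
    have "(N has_derivative (\<lambda>e. c y *\<^sub>R fderiv (gradient \<phi>) y e + c' e *\<^sub>R gradient \<phi> y)) (at y)"
      by (rule has_derivative_transform_within_open[OF has_derivative_scaleR[OF c' gd] S(1,2)]) (use Nc in auto)
    then have DN: "fderiv N y = (\<lambda>e. c y *\<^sub>R fderiv (gradient \<phi>) y e + c' e *\<^sub>R gradient \<phi> y)"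
      by (rule frechet_derivative_at[symmetric])
    have "gradient \<phi> y \<bullet> \<sigma> = 0" "gradient \<phi> y \<bullet> \<tau> = 0"
      using t gam(1)[OF y] nz[OF yU] by (auto simp: N_def sgn_if split: if_splits)
    moreover have "fderiv (gradient \<phi>) y a \<bullet> b = fderiv (\<lambda>z. fderiv \<phi> z b) y a" for a b
      using fun_cong[OF frechet_derivative_at[OF has_derivative_inner_left[OF gd, of b]], of a] by (simp add: gi)
    ultimately show ?thesis
      using second_derivative_symmetric[OF open_UNIV df(1), where y=y and a=\<tau> and b=\<sigma>]
      by (simp add: DN inner_add_left)
  qed
  show ?thesis
  proof (rule that[OF open_Un[OF op] _ NC _ gam(2) sym])
    show "\<Gamma> \<subseteq> Up \<union> Um"
    proof
      fix y assume "y \<in> \<Gamma>"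
      then have "m y > 0 \<or> m y < 0" using gam(1)[of y] by linarith
      then show "y \<in> Up \<union> Um" by (auto simp: Up_def Um_def)
    qed
    show "norm (N z) = 1" if "z \<in> Up \<union> Um" for z
      using nz[OF that] that by (auto simp: N_def Up_def Um_def)
  qed
qed

section \<open>Differentiability from second differences\<close>

text \<open>For short times the exponential in Gronwall's inequality can be replaced by the constant 2: if \<open>M\<close>
is the maximum of the norm of \<open>u\<close>, the mean value inequality gives \<open>M \<le> (L M + K) t\<close>, and the
first summand is at most \<open>M / 2\<close>.\<close>

lemma small_time_gronwall:
  fixes u :: "real \<Rightarrow> 'a::real_normed_vector"
  assumes "0 \<le> t" "u 0 = 0"
    and der: "\<And>s. s \<in> {0..t} \<Longrightarrow> (u has_vector_derivative u' s) (at s within {0..t})"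
    and bd: "\<And>s. s \<in> {0..t} \<Longrightarrow> norm (u' s) \<le> L * norm (u s) + K"
    and "0 \<le> L" "L * t \<le> 1/2"
  shows "norm (u t) \<le> 2 * K * t"
proof -
  have "continuous_on {0..t} u"
    using has_vector_derivative_continuous[OF der] by (auto simp: continuous_on_eq_continuous_within)
  then have "continuous_on {0..t} (\<lambda>s. norm (u s))" by (rule continuous_on_norm)
  from continuous_attains_sup[OF compact_Icc _ this] assms(1)
  obtain r where r: "r \<in> {0..t}" "\<And>s. s \<in> {0..t} \<Longrightarrow> norm (u s) \<le> norm (u r)" by auto
  have K: "0 \<le> K"
  proof -
    have "norm (u' 0) \<le> K" using bd[of 0] assms(1,2) by simp
    then show ?thesis using norm_ge_zero order_trans by blast
  qed
  have B: "norm (u' s) \<le> L * norm (u r) + K" if "s \<in> {0..t}" for s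
    using bd[OF that] mult_left_mono[OF r(2)[OF that] \<open>0 \<le> L\<close>] by linarith
  have "norm (u r - u 0) \<le> (L * norm (u r) + K) * norm (r - 0)"
  proof (rule differentiable_bound[OF convex_real_interval(5)[of 0 t]])
    show "(u has_derivative (\<lambda>h. h *\<^sub>R u' s)) (at s within {0..t})" if "s \<in> {0..t}" for s
      using der[OF that] by (simp add: has_vector_derivative_def)
    show "onorm (\<lambda>h. h *\<^sub>R u' s) \<le> L * norm (u r) + K" if "s \<in> {0..t}" for s
      by (rule onorm_bound) (use B[OF that] K assms(5) in \<open>auto simp: mult.commute intro: mult_left_mono\<close>)
  qed (use r assms(1) in auto)
  also have "\<dots> \<le> (L * norm (u r) + K) * t" using r(1) K assms(5) by (intro mult_left_mono) auto
  also have "\<dots> = (L * t) * norm (u r) + K * t" by (simp add: algebra_simps)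
  also have "\<dots> \<le> 1/2 * norm (u r) + K * t" using assms(6) by (intro add_right_mono mult_right_mono) auto
  finally have "norm (u r) \<le> 2 * K * t" using assms(2) by simp
  then show ?thesis using r(2)[of t] assms(1) by auto
qed

text \<open>The defect \<open>F s = f (s a) - s f a\<close> is additive in \<open>s\<close> and vanishes at the integers. So it is
periodic and thus bounded, and a bounded additive function is zero.\<close>

lemma additive_bounded_imp_linear:
  fixes f :: "'a::real_normed_vector \<Rightarrow> 'b::real_normed_vector"
  assumes add: "\<And>a b. f (a + b) = f a + f b" and bd: "\<And>a. norm (f a) \<le> K * norm a"
  shows "linear f"
proof (rule linearI[OF add])
  fix r a
  define F where "F s = f (s *\<^sub>R a) - s *\<^sub>R f a" for s
  have Fa: "F (s + s') = F s + F s'" for s s' by (simp add: F_def add scaleR_add_left)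
  have F0: "F 0 = 0" using Fa[of 0 0] by simp
  have Fn: "F (real n * s) = real n *\<^sub>R F s" for n s
    by (induction n) (simp_all add: F0 distrib_right Fa scaleR_add_left)
  have F1: "F 1 = 0" by (simp add: F_def)
  have Fz: "F (of_int m) = 0" for m
  proof -
    have "F (real n) = 0" for n using Fn[of n 1] F1 by simp
    moreover have "F (- real n) = 0" for n using Fa[of "real n" "- real n"] F0 calculation[of n] by simp
    ultimately show ?thesis by (cases m rule: int_cases2) auto
  qed
  have K: "0 \<le> K * norm a" using norm_ge_zero[of "f a"] bd[of a] by linarith
  have bF: "norm (F s) \<le> 2 * (K * norm a)" for s
  proof -
    have "F s = F (frac s)" using Fa[of "frac s" "of_int \<lfloor>s\<rfloor>"] Fz by (simp add: frac_def)
    also have "norm \<dots> \<le> norm (f (frac s *\<^sub>R a)) + \<bar>frac s\<bar> * norm (f a)"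
      unfolding F_def using norm_triangle_ineq4[of "f (frac s *\<^sub>R a)" "frac s *\<^sub>R f a"] by simp
    also have "\<dots> \<le> \<bar>frac s\<bar> * (K * norm a) + \<bar>frac s\<bar> * (K * norm a)"
      using bd[of "frac s *\<^sub>R a"] bd[of a] by (intro add_mono mult_left_mono) (auto simp: mult_ac)
    also have "\<dots> = \<bar>frac s\<bar> * (2 * (K * norm a))" by simp
    also have "\<dots> \<le> 1 * (2 * (K * norm a))"
      using K frac_lt_1[of s] frac_ge_0[of s] by (intro mult_right_mono) auto
    finally show ?thesis by simp
  qed
  have "norm (F r) \<le> e" if e: "e > 0" for e
  proof -
    obtain n where n: "real n * e > 2 * (K * norm a)" using reals_Archimedean3[OF e] by blast
    have "n > 0" using n K by (cases n) auto
    have "real n * norm (F r) \<le> real n * e" using bF[of "real n * r"] n by (simp add: Fn)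
    then show ?thesis using \<open>n > 0\<close> by simp
  qed
  then have "norm (F r) \<le> 0" by (rule field_le_epsilon[of _ 0, simplified])
  then show "f (r *\<^sub>R a) = r *\<^sub>R f a" by (simp add: F_def)
qed

text \<open>The bound on second differences says that the increments of \<open>f\<close> at \<open>X\<close> are additive up to a
quadratic error. Hence the rescaled increments \<open>2\<^sup>k (f (X + A / 2\<^sup>k) - f X)\<close> converge geometrically,
to a limit that is additive in \<open>A\<close> and differs from \<open>f (X + A) - f X\<close> by a quadratic term. The limit
is linear because \<open>f\<close> is Lipschitz, so it is the derivative.\<close>

lemma second_difference_imp_differentiable:
  fixes f :: "'a::real_normed_vector \<Rightarrow> 'b::banach"
  assumes sd: "\<And>X A B. norm (f (X + A + B) - f (X + A) - f (X + B) + f X) \<le> C * norm A * norm B"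
    and lip: "\<And>X Y. norm (f X - f Y) \<le> K * norm (X - Y)" and "0 \<le> C"
  obtains f' where "\<And>X. (f has_derivative f' X) (at X)"
    "\<And>X e. norm (f (X + e) - f X - f' X e) \<le> C * (norm e)\<^sup>2"
    "\<And>X Y e. norm (f' X e - f' Y e) \<le> C * norm (X - Y) * norm e"
proof -
  define q where "q X A k = 2^k *\<^sub>R (f (X + A /\<^sub>R 2^k) - f X)" for X A and k :: nat
  have step: "norm (q X A (Suc k) - q X A k) \<le> (C * (norm A)\<^sup>2 / 4) * (1/2)^k" for X A k
  proof -
    define E where "E = A /\<^sub>R 2^Suc k"
    have E: "A /\<^sub>R 2^k = E + E" by (simp add: E_def scaleR_2[symmetric])
    have "q X A (Suc k) - q X A k = - (2^k *\<^sub>R (f (X + E + E) - f (X + E) - f (X + E) + f X))"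
    proof -
      define v w z where "v = f (X + E) - f X" and "w = f (X + E + E) - f X"
        and "z = f (X + E + E) - f (X + E) - f (X + E) + f X"
      have z: "(v + v) - w = - z" by (simp add: v_def w_def z_def)
      have "q X A (Suc k) - q X A k = 2^Suc k *\<^sub>R v - 2^k *\<^sub>R w"
        unfolding q_def E_def[symmetric] E v_def w_def by (simp only: add.assoc)
      also have "\<dots> = 2^k *\<^sub>R ((v + v) - w)"
        by (simp add: scaleR_diff_right scaleR_2[symmetric] mult.commute)
      finally show ?thesis unfolding z z_def scaleR_minus_right .
    qed
    then have "norm (q X A (Suc k) - q X A k) \<le> 2^k * (C * norm E * norm E)"
      using sd[of X E E] by simp
    also have "\<dots> = (C * (norm A)\<^sup>2 / 4) * (1/2)^k"
      by (simp add: E_def power2_eq_square field_simps power_add[symmetric])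
    finally show ?thesis .
  qed
  have lim: "\<exists>l. q X A \<longlonglongrightarrow> l \<and> norm (l - (f (X + A) - f X)) \<le> C * (norm A)\<^sup>2" for X A
  proof -
    define c where "c = C * (norm A)\<^sup>2 / 4"
    have sg: "(\<lambda>k. c * (1/2)^k) sums (c * 2)" using geometric_sums[of "1/2::real"] sums_mult[of "\<lambda>k. (1/2::real)^k" 2 c] by simp
    have sm: "summable (\<lambda>k. norm (q X A (Suc k) - q X A k))"
      by (rule summable_comparison_test[OF _ sums_summable[OF sg]]) (use step[of X A] in \<open>auto simp: c_def\<close>)
    define S where "S = (\<Sum>k. q X A (Suc k) - q X A k)"
    have "(\<lambda>n. \<Sum>k<n. q X A (Suc k) - q X A k) \<longlonglongrightarrow> S"
      unfolding S_def using summable_LIMSEQ[OF summable_norm_cancel[OF sm]] .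
    then have "(\<lambda>n. q X A n - q X A 0) \<longlonglongrightarrow> S" by (simp add: sum_lessThan_telescope)
    from tendsto_add[OF this tendsto_const[of "q X A 0"]] have "q X A \<longlonglongrightarrow> S + q X A 0" by simp
    moreover have "norm S \<le> C * (norm A)\<^sup>2"
    proof -
      have "norm S \<le> (\<Sum>k. norm (q X A (Suc k) - q X A k))" unfolding S_def by (rule summable_norm[OF sm])
      also have "\<dots> \<le> (\<Sum>k. c * (1/2)^k)"
        by (rule suminf_le[OF _ sm sums_summable[OF sg]]) (use step[of X A] in \<open>auto simp: c_def\<close>)
      also have "\<dots> = c * 2" using sums_unique[OF sg] by simp
      also have "\<dots> \<le> C * (norm A)\<^sup>2" using assms(3) by (simp add: c_def)
      finally show ?thesis .
    qed
    ultimately show ?thesis by (intro exI[of _ "S + q X A 0"]) (simp add: q_def)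
  qed
  define f' where "f' X A = lim (q X A)" for X A
  have f': "q X A \<longlonglongrightarrow> f' X A" "norm (f' X A - (f (X + A) - f X)) \<le> C * (norm A)\<^sup>2" for X A
  proof -
    obtain l where l: "q X A \<longlonglongrightarrow> l" "norm (l - (f (X + A) - f X)) \<le> C * (norm A)\<^sup>2" using lim by blast
    have "f' X A = l" using limI[OF l(1)] by (simp add: f'_def)
    with l show "q X A \<longlonglongrightarrow> f' X A" "norm (f' X A - (f (X + A) - f X)) \<le> C * (norm A)\<^sup>2" by auto
  qed
  have add: "f' X (A + B) = f' X A + f' X B" for X A B
  proof -
    have "(\<lambda>k. q X (A + B) k - q X A k - q X B k) \<longlonglongrightarrow> f' X (A + B) - f' X A - f' X B"
      by (intro tendsto_intros f')
    moreover have "(\<lambda>k. q X (A + B) k - q X A k - q X B k) \<longlonglongrightarrow> 0"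
    proof (rule Lim_null_comparison)
      have "norm (q X (A + B) k - q X A k - q X B k) \<le> (C * norm A * norm B) * (1/2)^k" for k
      proof -
        define E G where "E = A /\<^sub>R 2^k" and "G = B /\<^sub>R 2^k"
        have EG: "(A + B) /\<^sub>R 2^k = E + G" by (simp add: E_def G_def scaleR_add_right)
        have "q X (A + B) k - q X A k - q X B k = 2^k *\<^sub>R (f (X + E + G) - f (X + E) - f (X + G) + f X)"
          unfolding q_def EG E_def[symmetric] G_def[symmetric] by (simp add: algebra_simps)
        then have "norm (q X (A + B) k - q X A k - q X B k) \<le> 2^k * (C * norm E * norm G)"
          using sd[of X E G] by simp
        also have "\<dots> = (C * norm A * norm B) * (1/2)^k"
          by (simp add: E_def G_def field_simps)
        finally show ?thesis .
      qed
      then show "\<forall>\<^sub>F k in sequentially. norm (q X (A + B) k - q X A k - q X B k) \<le> (C * norm A * norm B) * (1/2)^k"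
        by simp
      show "(\<lambda>k. (C * norm A * norm B) * (1/2)^k) \<longlonglongrightarrow> 0"
        by (intro tendsto_mult_right_zero LIMSEQ_power_zero) auto
    qed
    ultimately have "f' X (A + B) - f' X A - f' X B = 0" by (rule LIMSEQ_unique)
    then show ?thesis by (simp add: algebra_simps)
  qed
  have bd: "norm (f' X A) \<le> K * norm A" for X A
  proof (rule LIMSEQ_le_const2[OF tendsto_norm[OF f'(1)]])
    have "norm (q X A k) \<le> K * norm A" for k
    proof -
      have "norm (q X A k) = 2^k * norm (f (X + A /\<^sub>R 2^k) - f X)" by (simp add: q_def)
      also have "\<dots> \<le> 2^k * (K * norm (A /\<^sub>R 2^k))"
        using lip[of "X + A /\<^sub>R 2^k" X] by (intro mult_left_mono) auto
      also have "2^k * (K * norm (A /\<^sub>R 2^k)) = K * norm A" by (simp add: field_simps)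
      finally show ?thesis .
    qed
    then show "\<exists>N. \<forall>n\<ge>N. norm (q X A n) \<le> K * norm A" by blast
  qed
  have lin: "linear (f' X)" for X using additive_bounded_imp_linear[OF add bd] .
  have bl: "bounded_linear (f' X)" for X
    using lin bd[of X] by (auto simp: bounded_linear_def bounded_linear_axioms_def mult.commute)
  have rem: "norm (f (X + e) - f X - f' X e) \<le> C * (norm e)\<^sup>2" for X e
    using f'(2)[of X e] by (simp add: norm_minus_commute)
  have "(f has_derivative f' X) (at X)" for X
    unfolding has_derivative_at
  proof (rule conjI[OF bl], rule Lim_null_comparison[of _ "\<lambda>h. C * norm h"])
    show "\<forall>\<^sub>F h in at 0. norm (norm (f (X + h) - f X - f' X h) / norm h) \<le> C * norm h"
      unfolding eventually_at_filter
      by (intro always_eventually) (use rem[of X] in \<open>auto simp: power2_eq_square divide_le_eq mult.assoc\<close>)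
    show "((\<lambda>h. C * norm h) \<longlongrightarrow> 0) (at 0)" by (intro tendsto_mult_right_zero tendsto_norm_zero) (rule tendsto_ident_at)
  qed
  moreover have "norm (f' X e - f' Y e) \<le> C * norm (X - Y) * norm e" for X Y e
  proof (rule LIMSEQ_le_const2[OF tendsto_norm[OF tendsto_diff[OF f'(1) f'(1)]]])
    have "norm (q X e k - q Y e k) \<le> C * norm (X - Y) * norm e" for k
    proof -
      have "q X e k - q Y e k = 2^k *\<^sub>R (f (Y + (X - Y) + e /\<^sub>R 2^k) - f (Y + (X - Y)) - f (Y + e /\<^sub>R 2^k) + f Y)"
        by (simp add: q_def algebra_simps)
      then have "norm (q X e k - q Y e k) \<le> 2^k * (C * norm (X - Y) * norm (e /\<^sub>R 2^k))"
        using sd[of Y "X - Y" "e /\<^sub>R 2^k"] by simp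
      also have "2^k * (C * norm (X - Y) * norm (e /\<^sub>R 2^k)) = C * norm (X - Y) * norm e" by (simp add: field_simps)
      finally show ?thesis .
    qed
    then show "\<exists>N. \<forall>n\<ge>N. norm (q X e n - q Y e n) \<le> C * norm (X - Y) * norm e" by blast
  qed
  ultimately show ?thesis using that[of f'] rem by blast
qed

section \<open>Flows for short times\<close>

definition regular_velocity :: "real \<Rightarrow> real \<Rightarrow> (real \<Rightarrow> 'a::euclidean_space \<Rightarrow> 'a) \<Rightarrow> bool" where
  "regular_velocity \<delta> L V \<longleftrightarrow> 0 < \<delta> \<and> 0 \<le> L \<and>
     (\<forall>t\<in>{0..\<delta>}. \<forall>y. (V t has_derivative fderiv (V t) y) (at y) \<and> norm (V t y) \<le> L \<and>
        (\<forall>e. norm (fderiv (V t) y e) \<le> L * norm e) \<and>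
        (\<forall>z e. norm (fderiv (V t) y e - fderiv (V t) z e) \<le> L * norm (y - z) * norm e))"

lemma bounded_if_zero_outside_compact:
  fixes f :: "'a::metric_space \<Rightarrow> 'b::real_normed_vector"
  assumes "continuous_on UNIV f" "compact S" "\<And>y. y \<notin> S \<Longrightarrow> f y = 0"
  shows "\<exists>B. \<forall>y. norm (f y) \<le> B"
proof -
  have "bounded (f ` S)" using compact_continuous_image[of S f] assms(1,2) continuous_on_subset compact_imp_bounded by blast
  then obtain B where "B > 0" "\<And>y. y \<in> S \<Longrightarrow> norm (f y) \<le> B" unfolding bounded_pos by auto
  then have "norm (f y) \<le> B" for y using assms(3)[of y] by (cases "y \<in> S") auto
  then show ?thesis by blast
qed

lemma norm_le_Basis_sum:
  fixes f :: "'a::euclidean_space \<Rightarrow> 'b::real_normed_vector"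
  assumes "linear f" "\<And>b. b \<in> Basis \<Longrightarrow> norm (f b) \<le> c"
  shows "norm (f e) \<le> (real DIM('a) * c) * norm e"
proof -
  have "norm (f e) = norm (\<Sum>b\<in>Basis. (e \<bullet> b) *\<^sub>R f b)" using linear_Basis_expansion[OF assms(1)] by metis
  also have "\<dots> \<le> (\<Sum>b\<in>(Basis::'a set). norm e * c)"
    by (intro sum_norm_le) (auto intro!: mult_mono assms(2) Basis_le_norm)
  finally show ?thesis by (simp add: mult_ac)
qed

lemma uniform_bound_near:
  fixes F :: "real \<Rightarrow> 'a::euclidean_space \<Rightarrow> 'b::real_normed_vector"
  assumes "uniform_limit UNIV F (F 0) (at 0 within S)" "continuous_on UNIV (F 0)" "compact K" "\<And>y. y \<notin> K \<Longrightarrow> F 0 y = 0"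
  shows "\<exists>B. (\<forall>y. norm (F 0 y) \<le> B) \<and> (\<forall>\<^sub>F t in at 0 within S. \<forall>y. norm (F t y) \<le> B)"
proof -
  obtain B where B: "\<And>y. norm (F 0 y) \<le> B" using bounded_if_zero_outside_compact[OF assms(2,3,4)] by blast
  have "\<forall>\<^sub>F t in at 0 within S. \<forall>y\<in>UNIV. dist (F t y) (F 0 y) < 1" using uniform_limitD[OF assms(1)] by simp
  then have "\<forall>\<^sub>F t in at 0 within S. \<forall>y. norm (F t y) \<le> B + 1"
  proof eventually_elim
    case (elim t)
    have "norm (F t y) \<le> B + 1" for y
      using norm_triangle_sub[of "F t y" "F 0 y"] B[of y] elim[rule_format, of y] by (auto simp: dist_norm)
    then show ?case by blast
  qed
  moreover have "norm (F 0 y) \<le> B + 1" for y using B[of y] by linarith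
  ultimately show ?thesis by blast
qed

lemma finite_uniform_bound:
  fixes F :: "'i \<Rightarrow> real \<Rightarrow> 'a \<Rightarrow> 'b::real_normed_vector"
  assumes "finite I" "\<And>i. i \<in> I \<Longrightarrow> \<exists>B. (\<forall>y. norm (F i 0 y) \<le> B) \<and> (\<forall>\<^sub>F t in A. \<forall>y. norm (F i t y) \<le> B)"
  shows "\<exists>B\<ge>0. (\<forall>i\<in>I. \<forall>y. norm (F i 0 y) \<le> B) \<and> (\<forall>\<^sub>F t in A. \<forall>i\<in>I. \<forall>y. norm (F i t y) \<le> B)"
  using assms
proof (induction I)
  case empty
  then show ?case by auto
next
  case (insert j I)
  then obtain B where B: "B \<ge> 0" "\<forall>i\<in>I. \<forall>y. norm (F i 0 y) \<le> B" "\<forall>\<^sub>F t in A. \<forall>i\<in>I. \<forall>y. norm (F i t y) \<le> B" by auto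
  obtain C where C: "\<forall>y. norm (F j 0 y) \<le> C" "\<forall>\<^sub>F t in A. \<forall>y. norm (F j t y) \<le> C" using insert.prems by auto
  have "\<forall>\<^sub>F t in A. \<forall>i\<in>insert j I. \<forall>y. norm (F i t y) \<le> max B C"
    using B(3) C(2) by eventually_elim (auto simp: le_max_iff_disj)
  then show ?case using B C by (intro exI[of _ "max B C"]) (auto simp: le_max_iff_disj)
qed

text \<open>The support of \<open>V 0\<close> is compact, so \<open>V 0\<close> and its first and second derivatives are bounded;
convergence in \<open>C\<^sup>2\<close> transfers the bounds to small times.\<close>

lemma velocity_field_regular:
  fixes V :: "real \<Rightarrow> real^'n \<Rightarrow> real^'n"
  assumes "velocity_field 2 D \<epsilon> V" "0 < \<epsilon>"
  obtains \<delta> L where "\<delta> \<le> \<epsilon>" "regular_velocity \<delta> L V"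
    "\<And>\<eta>. \<eta> > 0 \<Longrightarrow> \<exists>\<delta>'>0. \<forall>t\<in>{0..\<delta>'}. \<forall>y e. norm (fderiv (V t) y e - fderiv (V 0) y e) \<le> \<eta> * norm e"
proof -
  define A where "A = at 0 within {0..\<epsilon>}"
  define K where "K = closure {y. V 0 y \<noteq> 0}"
  define G where "G b t y = fderiv (V t) y b" for b t y
  define H where "H p t y = fderiv (G (fst p) t) y (snd p)" for p t y
  have C2: "Ck_on (Suc (Suc 0)) (V t) UNIV" if "t \<in> {0..\<epsilon>}" for t
    using assms(1) that by (auto simp: velocity_field_def Ck_compact_support_def numeral_2_eq_2)
  have K: "compact K" using assms unfolding velocity_field_def Ck_compact_support_def K_def by auto
  have ul: "Ck_limit (Suc (Suc 0)) UNIV V (V 0) A"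
    using assms by (auto simp: velocity_field_def A_def numeral_2_eq_2)
  have G_def': "G b t = (\<lambda>y. fderiv (V t) y b)" for b t by (auto simp: G_def)
  have H_def': "H p t = (\<lambda>y. fderiv (G (fst p) t) y (snd p))" for p t by (auto simp: H_def)
  have uV: "uniform_limit UNIV V (V 0) A" using ul by simp
  have uG: "uniform_limit UNIV (G b) (G b 0) A" for b using ul by (simp add: G_def'[abs_def])
  have uH: "uniform_limit UNIV (H p) (H p 0) A" for p using ul by (simp add: H_def'[abs_def] G_def')
  have dV: "(V t has_derivative fderiv (V t) y) (at y)" if "t \<in> {0..\<epsilon>}" for t y
    using Ck_on_Suc_has_derivative[OF C2[OF that]] by simp
  have CG: "Ck_on (Suc 0) (G b t) UNIV" if "t \<in> {0..\<epsilon>}" for t b using C2[OF that] by (simp add: G_def')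
  have dG: "(G b t has_derivative fderiv (G b t) y) (at y)" if "t \<in> {0..\<epsilon>}" for b t y
    using Ck_on_Suc_has_derivative[OF CG[OF that]] by simp
  have o: "open (- K)" by (simp add: K_def open_Compl)
  have zV: "V 0 y = 0" if "y \<notin> K" for y using that closure_subset[of "{y. V 0 y \<noteq> 0}"] by (auto simp: K_def)
  have zG: "G b 0 y = 0" if "y \<notin> K" for y b
    using frechet_derivative_cong_open[OF o, of y "V 0" "\<lambda>_. 0"] that zV by (simp add: G_def)
  have zH: "H p 0 y = 0" if "y \<notin> K" for y p
    using frechet_derivative_cong_open[OF o, of y "G (fst p) 0" "\<lambda>_. 0"] that zG by (simp add: H_def)
  have 0: "0 \<in> {0..\<epsilon>}" using assms by simp
  have cV: "continuous_on UNIV (V 0)" using Ck_on_imp_continuous[OF C2[OF 0]] .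
  have cG: "continuous_on UNIV (G b 0)" for b using Ck_on_imp_continuous[OF CG[OF 0]] .
  have cH: "continuous_on UNIV (H p 0)" for p using CG[OF 0, of "fst p"] by (simp add: H_def')
  obtain B0 where B0: "\<forall>y. norm (V 0 y) \<le> B0" "\<forall>\<^sub>F t in A. \<forall>y. norm (V t y) \<le> B0"
    using uniform_bound_near[OF uV[unfolded A_def] cV K zV] unfolding A_def by blast
  obtain B1 where B1: "B1 \<ge> 0" "\<forall>b\<in>Basis. \<forall>y. norm (G b 0 y) \<le> B1" "\<forall>\<^sub>F t in A. \<forall>b\<in>Basis. \<forall>y. norm (G b t y) \<le> B1"
    using finite_uniform_bound[where F=G and A=A, OF finite_Basis]
      uniform_bound_near[OF uG[unfolded A_def] cG K zG, folded A_def] by blast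
  obtain B2 where B2: "B2 \<ge> 0" "\<forall>p\<in>Basis\<times>Basis. \<forall>y. norm (H p 0 y) \<le> B2" "\<forall>\<^sub>F t in A. \<forall>p\<in>Basis\<times>Basis. \<forall>y. norm (H p t y) \<le> B2"
    using finite_uniform_bound[where F=H and A=A, OF finite_cartesian_product[OF finite_Basis finite_Basis]]
      uniform_bound_near[OF uH[unfolded A_def] cH K zH, folded A_def] by blast
  have "\<forall>\<^sub>F t in A. (\<forall>y. norm (V t y) \<le> B0) \<and> (\<forall>b\<in>Basis. \<forall>y. norm (G b t y) \<le> B1) \<and>
      (\<forall>p\<in>Basis\<times>Basis. \<forall>y. norm (H p t y) \<le> B2)"
    using B0(2) B1(3) B2(3) by eventually_elim auto
  then obtain d where d: "d > 0" "\<And>t. t \<in> {0..\<epsilon>} \<Longrightarrow> t \<noteq> 0 \<Longrightarrow> t < d \<Longrightarrow> (\<forall>y. norm (V t y) \<le> B0) \<and>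
      (\<forall>b\<in>Basis. \<forall>y. norm (G b t y) \<le> B1) \<and> (\<forall>p\<in>Basis\<times>Basis. \<forall>y. norm (H p t y) \<le> B2)"
    unfolding A_def eventually_at by (auto simp: dist_real_def)
  define \<delta> where "\<delta> = min (d/2) \<epsilon>"
  have del: "0 < \<delta>" "\<delta> \<le> \<epsilon>" "\<delta> < d" using d(1) assms by (auto simp: \<delta>_def)
  have bds: "norm (V t y) \<le> B0" "b \<in> Basis \<Longrightarrow> norm (G b t y) \<le> B1" "p \<in> Basis\<times>Basis \<Longrightarrow> norm (H p t y) \<le> B2"
    if "t \<in> {0..\<delta>}" for t y b p
    using d(2)[of t] del that B0(1) B1(2) B2(2) by (cases "t = 0"; simp; blast)+
  define N where "N = real DIM(real^'n)"
  have N: "N \<ge> 0" by (simp add: N_def)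
  have B0p: "B0 \<ge> 0" using B0(1) norm_ge_zero order_trans by blast
  define L where "L = B0 + N * B1 + N * (N * B2)"
  have L: "L \<ge> B0" "L \<ge> N * B1" "L \<ge> N * (N * B2)" "L \<ge> 0" using B0p B1 B2 N by (auto simp: L_def)
  have "regular_velocity \<delta> L V" unfolding regular_velocity_def
  proof (intro conjI ballI allI del L)
    fix t y assume t: "t \<in> {0..\<delta>}"
    then have te: "t \<in> {0..\<epsilon>}" using del by auto
    show "(V t has_derivative fderiv (V t) y) (at y)" using dV[OF te] .
    show "norm (V t y) \<le> L" using bds(1)[OF t, of y] L by linarith
    have lin: "linear (fderiv (V t) y)" for y using has_derivative_linear[OF dV[OF te]] .
    fix e :: "real^'n"
    have "norm (fderiv (V t) y e) \<le> (N * B1) * norm e"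
      unfolding N_def by (rule norm_le_Basis_sum[OF lin]) (use bds(2)[OF t] in \<open>simp add: G_def\<close>)
    also have "\<dots> \<le> L * norm e" using L by (intro mult_right_mono) auto
    finally show "norm (fderiv (V t) y e) \<le> L * norm e" .
    fix z
    have "norm (G b t y - G b t z) \<le> (N * B2) * norm (y - z)" if b: "b \<in> Basis" for b
    proof (rule differentiable_bound[OF convex_UNIV, where f'="\<lambda>y. fderiv (G b t) y"])
      fix y
      show "(G b t has_derivative fderiv (G b t) y) (at y)" using dG[OF te] .
      show "onorm (fderiv (G b t) y) \<le> N * B2"
      proof (rule onorm_bound)
        show "norm (fderiv (G b t) y v) \<le> N * B2 * norm v" for v
          unfolding N_def by (rule norm_le_Basis_sum[OF has_derivative_linear[OF dG[OF te]]])
            (use bds(3)[OF t, of "(b, _)"] b in \<open>simp add: H_def\<close>)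
      qed (use N B2 in simp)
    qed auto
    then have "norm (fderiv (V t) y e - fderiv (V t) z e) \<le> (N * ((N * B2) * norm (y - z))) * norm e"
      using norm_le_Basis_sum[OF linear_compose_sub[OF lin[of y] lin[of z]], of "(N * B2) * norm (y - z)" e]
      unfolding N_def G_def by blast
    also have "\<dots> = N * (N * B2) * (norm (y - z) * norm e)" by simp
    also have "\<dots> \<le> L * (norm (y - z) * norm e)" using L by (intro mult_right_mono) auto
    finally show "norm (fderiv (V t) y e - fderiv (V t) z e) \<le> L * norm (y - z) * norm e"
      by (simp add: mult.assoc)
  qed
  moreover have "\<exists>\<delta>'>0. \<forall>t\<in>{0..\<delta>'}. \<forall>y e. norm (fderiv (V t) y e - fderiv (V 0) y e) \<le> \<eta> * norm e"
    if eta: "\<eta> > 0" for \<eta>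
  proof -
    define h where "h = \<eta> / (N + 1)"
    have h: "h > 0" "N * h \<le> \<eta>" using eta N by (auto simp: h_def field_simps)
    have "\<forall>\<^sub>F t in A. \<forall>b\<in>Basis. \<forall>y\<in>UNIV. dist (G b t y) (G b 0 y) < h"
      using uniform_limitD[OF uG h(1)] by (intro eventually_ball_finite) auto
    then obtain d' where d': "d' > 0" "\<And>t b y. t \<in> {0..\<epsilon>} \<Longrightarrow> t \<noteq> 0 \<Longrightarrow> t < d' \<Longrightarrow> b \<in> Basis \<Longrightarrow> dist (G b t y) (G b 0 y) < h"
      unfolding A_def eventually_at by (auto simp: dist_real_def)
    define c where "c = min (d'/2) \<epsilon>"
    have c: "c > 0" "c \<le> \<epsilon>" "c < d'" using d'(1) assms by (auto simp: c_def)
    have "norm (fderiv (V t) y e - fderiv (V 0) y e) \<le> \<eta> * norm e" if t: "t \<in> {0..c}" for t y e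
    proof -
      have te: "t \<in> {0..\<epsilon>}" using t c by auto
      have "norm (G b t y - G b 0 y) \<le> h" if "b \<in> Basis" for b
        using d'(2)[OF te _ _ that, of y] t c h by (cases "t = 0") (auto simp: dist_norm)
      then have "norm (fderiv (V t) y e - fderiv (V 0) y e) \<le> (N * h) * norm e"
        using norm_le_Basis_sum[OF linear_compose_sub[OF has_derivative_linear[OF dV[OF te, of y]] has_derivative_linear[OF dV[OF 0, of y]]], of h e]
        unfolding N_def G_def by blast
      also have "\<dots> \<le> \<eta> * norm e" using h by (intro mult_right_mono) auto
      finally show ?thesis .
    qed
    then show ?thesis using c(1) by blast
  qed
  ultimately show ?thesis using that[OF del(2)] by blast
qed

lemma regular_velocityD:
  assumes "regular_velocity \<delta> L V" "t \<in> {0..\<delta>}"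
  shows "(V t has_derivative fderiv (V t) y) (at y)" "norm (V t y) \<le> L"
    "norm (fderiv (V t) y e) \<le> L * norm e"
    "norm (fderiv (V t) y e - fderiv (V t) z e) \<le> L * norm (y - z) * norm e"
  using assms unfolding regular_velocity_def by blast+

lemma regular_velocity_pos: "regular_velocity \<delta> L V \<Longrightarrow> 0 \<le> L" "regular_velocity \<delta> L V \<Longrightarrow> 0 < \<delta>"
  unfolding regular_velocity_def by auto

lemma regular_velocity_lipschitz:
  assumes "regular_velocity \<delta> L V" "t \<in> {0..\<delta>}"
  shows "norm (V t y - V t z) \<le> L * norm (y - z)"
proof (rule differentiable_bound[OF convex_UNIV, where f'="\<lambda>y. fderiv (V t) y"])
  show "(V t has_derivative fderiv (V t) y) (at y)" for y by (rule regular_velocityD[OF assms])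
  show "onorm (fderiv (V t) y) \<le> L" for y
    by (rule onorm_bound) (use regular_velocityD(3)[OF assms] regular_velocity_pos[OF assms(1)] in auto)
qed auto

lemma regular_velocity_second_difference:
  assumes "regular_velocity \<delta> L V" "t \<in> {0..\<delta>}"
  shows "norm (V t (a + p + q) - V t (a + p) - V t (a + q) + V t a) \<le> L * norm p * norm q"
proof -
  have "norm ((V t ((a + p) + q) - V t (a + p)) - (V t (a + q) - V t a)) \<le> (L * norm q) * norm ((a + p) - a)"
  proof (rule differentiable_bound[OF convex_UNIV, where f="\<lambda>z. V t (z + q) - V t z"
        and f'="\<lambda>z e. fderiv (V t) (z + q) e - fderiv (V t) z e"])
    fix z
    have "((\<lambda>z. V t (z + q)) has_derivative fderiv (V t) (z + q)) (at z)"
    proof (rule has_derivative_compose[OF _ regular_velocityD(1)[OF assms]])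
      show "((\<lambda>z. z + q) has_derivative (\<lambda>e. e)) (at z)" by (auto intro!: derivative_eq_intros)
    qed
    then show "((\<lambda>z. V t (z + q) - V t z) has_derivative (\<lambda>e. fderiv (V t) (z + q) e - fderiv (V t) z e)) (at z)"
      by (intro has_derivative_diff regular_velocityD(1)[OF assms])
    show "onorm (\<lambda>e. fderiv (V t) (z + q) e - fderiv (V t) z e) \<le> L * norm q"
      by (rule onorm_bound) (use regular_velocityD(4)[OF assms, of "z + q" _ z] regular_velocity_pos[OF assms(1)] in auto)
  qed auto
  then show ?thesis by (simp add: algebra_simps)
qed

text \<open>The flow up to a time \<open>T\<close> that is short enough for \<open>small_time_gronwall\<close>.\<close>

locale small_flow =
  fixes \<delta> L T :: real and V x :: "real \<Rightarrow> 'a::euclidean_space \<Rightarrow> 'a"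
  assumes rv: "regular_velocity \<delta> L V" and T: "0 \<le> T" "T \<le> \<delta>" "L * T \<le> 1/2"
    and x0: "x 0 X = X"
    and xd: "t \<in> {0..T} \<Longrightarrow> ((\<lambda>s. x s X) has_vector_derivative V t (x t X)) (at t within {0..T})"
begin

lemma L_nonneg: "0 \<le> L" using regular_velocity_pos[OF rv] by simp

lemma time_bounds: assumes "t \<in> {0..T}" shows "t \<in> {0..\<delta>}" "L * t \<le> 1/2" "0 \<le> t"
proof -
  have "L * t \<le> L * T" using assms L_nonneg by (intro mult_left_mono) auto
  then show "t \<in> {0..\<delta>}" "L * t \<le> 1/2" "0 \<le> t" using assms T by auto
qed

lemma trajectory_derivative: "t \<in> {0..T} \<Longrightarrow> s \<in> {0..t} \<Longrightarrow> ((\<lambda>s. x s X) has_vector_derivative V s (x s X)) (at s within {0..t})"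
  using has_vector_derivative_within_subset[OF xd[of s X], of "{0..t}"] by auto

lemma displacement:
  assumes t: "t \<in> {0..T}" shows "norm (x t X - X) \<le> 2 * L * t"
proof (rule small_time_gronwall[where u="\<lambda>s. x s X - X" and u'="\<lambda>s. V s (x s X)" and L=0])
  show "((\<lambda>s. x s X - X) has_vector_derivative V s (x s X)) (at s within {0..t})" if "s \<in> {0..t}" for s
    using has_vector_derivative_diff[OF trajectory_derivative[OF t that] has_vector_derivative_const] by simp
  show "norm (V s (x s X)) \<le> 0 * norm (x s X - X) + L" if "s \<in> {0..t}" for s
    using regular_velocityD(2)[OF rv, of s] that time_bounds[OF t] by simp
qed (use time_bounds[OF t] x0 in auto)

lemma near_isometry:
  assumes t: "t \<in> {0..T}" shows "norm (x t X - x t Y - (X - Y)) \<le> 2 * (L * norm (X - Y)) * t"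
proof (rule small_time_gronwall[where u="\<lambda>s. x s X - x s Y - (X - Y)" and u'="\<lambda>s. V s (x s X) - V s (x s Y)" and L=L])
  fix s assume s: "s \<in> {0..t}"
  then have sd: "s \<in> {0..\<delta>}" using time_bounds[OF t] by auto
  show "((\<lambda>s. x s X - x s Y - (X - Y)) has_vector_derivative V s (x s X) - V s (x s Y)) (at s within {0..t})"
    using has_vector_derivative_diff[OF has_vector_derivative_diff[OF trajectory_derivative[OF t s] trajectory_derivative[OF t s]] has_vector_derivative_const]
    by simp
  have "norm (V s (x s X) - V s (x s Y)) \<le> L * norm (x s X - x s Y)" by (rule regular_velocity_lipschitz[OF rv sd])
  also have "\<dots> \<le> L * (norm (x s X - x s Y - (X - Y)) + norm (X - Y))"
    using L_nonneg norm_triangle_sub by (intro mult_left_mono) (auto simp: add.commute)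
  finally show "norm (V s (x s X) - V s (x s Y)) \<le> L * norm (x s X - x s Y - (X - Y)) + L * norm (X - Y)"
    by (simp add: distrib_left)
qed (use time_bounds[OF t] x0 L_nonneg in auto)

lemma lipschitz:
  assumes t: "t \<in> {0..T}" shows "norm (x t X - x t Y) \<le> 2 * norm (X - Y)"
proof -
  have "2 * (L * norm (X - Y)) * t = (L * t) * (2 * norm (X - Y))" by simp
  also have "\<dots> \<le> 1/2 * (2 * norm (X - Y))" using time_bounds(2)[OF t] by (intro mult_right_mono) auto
  finally show ?thesis using near_isometry[OF t, of X Y] norm_triangle_sub[of "x t X - x t Y" "X - Y"] by simp
qed

text \<open>Second differences \<open>u\<close> of the flow solve a differential inequality: up to an error of size
\<open>L |u|\<close>, the second difference of the velocity along the flow is the one over an exact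
parallelogram, which is bounded by the product of the lengths of the sides.\<close>

lemma second_difference:
  assumes t: "t \<in> {0..T}"
  shows "norm (x t (X + A + B) - x t (X + A) - x t (X + B) + x t X) \<le> (8 * L * t) * norm A * norm B"
proof -
  define u where "u s = x s (X + A + B) - x s (X + A) - x s (X + B) + x s X" for s
  have "norm (u t) \<le> 2 * (4 * L * norm A * norm B) * t"
  proof (rule small_time_gronwall[where L=L and
      u'="\<lambda>s. V s (x s (X + A + B)) - V s (x s (X + A)) - V s (x s (X + B)) + V s (x s X)"])
    show "u 0 = 0" by (simp add: u_def x0)
    fix s assume s: "s \<in> {0..t}"
    then have sd: "s \<in> {0..\<delta>}" and sT: "s \<in> {0..T}" using time_bounds[OF t] t by auto
    show "(u has_vector_derivative V s (x s (X + A + B)) - V s (x s (X + A)) - V s (x s (X + B)) + V s (x s X)) (at s within {0..t})"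
      unfolding u_def[abs_def] by (intro has_vector_derivative_add has_vector_derivative_diff trajectory_derivative[OF t s])
    (* a + p + q is the fourth corner of the exact parallelogram over the other three *)
    define a p q where "a = x s X" and "p = x s (X + A) - x s X" and "q = x s (X + B) - x s X"
    have pq: "norm p \<le> 2 * norm A" "norm q \<le> 2 * norm B"
      using lipschitz[OF sT, of "X + A" X] lipschitz[OF sT, of "X + B" X] by (auto simp: p_def q_def)
    have eq: "V s (x s (X + A + B)) - V s (x s (X + A)) - V s (x s (X + B)) + V s (x s X) =
      (V s (x s (X + A + B)) - V s (a + p + q)) + (V s (a + p + q) - V s (a + p) - V s (a + q) + V s a)"
      by (simp add: a_def p_def q_def)
    have "norm (V s (x s (X + A + B)) - V s (a + p + q)) \<le> L * norm (x s (X + A + B) - (a + p + q))"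
      by (rule regular_velocity_lipschitz[OF rv sd])
    also have "x s (X + A + B) - (a + p + q) = u s" by (simp add: a_def p_def q_def u_def)
    finally have 1: "norm (V s (x s (X + A + B)) - V s (a + p + q)) \<le> L * norm (u s)" .
    have "norm (V s (a + p + q) - V s (a + p) - V s (a + q) + V s a) \<le> L * norm p * norm q"
      by (rule regular_velocity_second_difference[OF rv sd])
    also have "\<dots> \<le> L * (2 * norm A) * (2 * norm B)"
      using pq L_nonneg by (intro mult_mono mult_left_mono) auto
    finally have 2: "norm (V s (a + p + q) - V s (a + p) - V s (a + q) + V s a) \<le> 4 * L * norm A * norm B" by simp
    show "norm (V s (x s (X + A + B)) - V s (x s (X + A)) - V s (x s (X + B)) + V s (x s X)) \<le> L * norm (u s) + 4 * L * norm A * norm B"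
      unfolding eq by (rule norm_triangle_le) (use 1 2 in linarith)
  qed (use time_bounds[OF t] L_nonneg in auto)
  then show ?thesis by (simp add: u_def mult_ac)
qed

text \<open>First order expansion of the flow in time and space at once; \<open>\<eta>\<close> measures how far the Jacobian of
the velocity has moved from its initial value.\<close>

lemma expansion:
  assumes t: "t \<in> {0..T}" and \<eta>: "0 \<le> \<eta>"
    "\<And>s y e. s \<in> {0..t} \<Longrightarrow> norm (fderiv (V s) y e - fderiv (V 0) y e) \<le> \<eta> * norm e"
  shows "norm (x t (X + E) - x t X - E - t *\<^sub>R fderiv (V 0) X E) \<le>
    4 * norm E * (\<eta> + 2 * L * norm E + 3 * L * (L * t)) * t"
proof -
  define A where "A = fderiv (V 0) X"
  have 0: "0 \<in> {0..\<delta>}" using time_bounds[OF t] by auto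
  have linA: "linear A" using has_derivative_linear[OF regular_velocityD(1)[OF rv 0]] by (simp add: A_def)
  define u where "u s = x s (X + E) - x s X - E - s *\<^sub>R A E" for s
  have "norm (u t) \<le> 2 * (2 * norm E * (\<eta> + 2 * L * norm E + 3 * L * (L * t))) * t"
  proof (rule small_time_gronwall[where L=0 and u'="\<lambda>s. V s (x s (X + E)) - V s (x s X) - A E"])
    show "u 0 = 0" by (simp add: u_def x0)
    fix s assume s: "s \<in> {0..t}"
    then have sd: "s \<in> {0..\<delta>}" and sT: "s \<in> {0..T}" using time_bounds[OF t] t by auto
    have "(u has_vector_derivative V s (x s (X + E)) - V s (x s X) - 0 - (s *\<^sub>R 0 + 1 *\<^sub>R A E)) (at s within {0..t})"
      unfolding u_def[abs_def]
      by (intro has_vector_derivative_diff trajectory_derivative[OF t s] has_vector_derivative_const has_vector_derivative_scaleR DERIV_ident)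
    then show "(u has_vector_derivative V s (x s (X + E)) - V s (x s X) - A E) (at s within {0..t})" by simp
    define p q where "p = x s X" and "q = x s (X + E)"
    have qp: "norm (q - p) \<le> 2 * norm E" using lipschitz[OF sT, of "X + E" X] by (simp add: p_def q_def)
    have qpE: "norm (q - p - E) \<le> 2 * L * norm E * t"
    proof -
      have "norm (q - p - E) \<le> 2 * (L * norm E) * s" using near_isometry[OF sT, of "X + E" X] by (simp add: p_def q_def)
      also have "\<dots> \<le> 2 * (L * norm E) * t" using s L_nonneg by (intro mult_left_mono) auto
      finally show ?thesis by simp
    qed
    have pX: "norm (p - X) \<le> 2 * L * t"
    proof -
      have "norm (p - X) \<le> 2 * L * s" using displacement[OF sT] by (simp add: p_def)
      also have "\<dots> \<le> 2 * L * t" using s L_nonneg by (intro mult_left_mono) auto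
      finally show ?thesis .
    qed
    define S where "S = closed_segment p q"
    (* along the segment from p to q the Jacobian of the velocity is close to A *)
    have "norm ((V s q - A q) - (V s p - A p)) \<le> (\<eta> + L * (2 * norm E + 2 * L * t)) * norm (q - p)"
    proof (rule differentiable_bound[where S=S and f="\<lambda>z. V s z - A z" and f'="\<lambda>z e. fderiv (V s) z e - A e"])
      fix z assume z: "z \<in> S"
      show "((\<lambda>z. V s z - A z) has_derivative (\<lambda>e. fderiv (V s) z e - A e)) (at z within S)"
        by (intro has_derivative_diff has_derivative_at_withinI[OF regular_velocityD(1)[OF rv sd]]
            bounded_linear_imp_has_derivative linear_conv_bounded_linear[THEN iffD1, OF linA])
      have "norm (z - p) \<le> norm (q - p)" using segment_bound(1)[of z p q] z by (simp add: S_def norm_minus_commute)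
      then have zX: "norm (z - X) \<le> 2 * norm E + 2 * L * t"
        using norm_triangle_ineq[of "z - p" "p - X"] qp pX by simp
      show "onorm (\<lambda>e. fderiv (V s) z e - A e) \<le> \<eta> + L * (2 * norm E + 2 * L * t)"
      proof (rule onorm_bound)
        fix e
        have "norm (fderiv (V s) z e - A e) \<le>
          norm (fderiv (V s) z e - fderiv (V 0) z e) + norm (fderiv (V 0) z e - A e)"
          using norm_triangle_ineq[of "fderiv (V s) z e - fderiv (V 0) z e" "fderiv (V 0) z e - A e"] by simp
        also have "\<dots> \<le> \<eta> * norm e + L * norm (z - X) * norm e"
          unfolding A_def by (intro add_mono \<eta>(2)[OF s] regular_velocityD(4)[OF rv 0])
        also have "\<dots> \<le> \<eta> * norm e + L * (2 * norm E + 2 * L * t) * norm e"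
          using zX L_nonneg by (intro add_left_mono mult_right_mono mult_left_mono) auto
        finally show "norm (fderiv (V s) z e - A e) \<le> (\<eta> + L * (2 * norm E + 2 * L * t)) * norm e"
          by (simp add: distrib_right)
      qed (intro add_nonneg_nonneg mult_nonneg_nonneg \<eta>(1) L_nonneg time_bounds(3)[OF t] norm_ge_zero, simp_all)
    qed (auto simp: S_def)
    also have "\<dots> \<le> (\<eta> + L * (2 * norm E + 2 * L * t)) * (2 * norm E)"
      by (intro mult_left_mono qp add_nonneg_nonneg mult_nonneg_nonneg \<eta>(1) L_nonneg time_bounds(3)[OF t] norm_ge_zero) simp_all
    finally have 1: "norm ((V s q - A q) - (V s p - A p)) \<le> (\<eta> + L * (2 * norm E + 2 * L * t)) * (2 * norm E)" .
    have "norm (A (q - p - E)) \<le> L * norm (q - p - E)" unfolding A_def by (rule regular_velocityD(3)[OF rv 0])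
    also have "\<dots> \<le> L * (2 * L * norm E * t)" using qpE L_nonneg by (intro mult_left_mono) auto
    finally have 2: "norm (A (q - p - E)) \<le> L * (2 * L * norm E * t)" .
    have "V s q - V s p - A E = ((V s q - A q) - (V s p - A p)) + A (q - p - E)"
      using linA by (simp add: linear_diff)
    from arg_cong[OF this, of norm]
    have "norm (V s q - V s p - A E) \<le> (\<eta> + L * (2 * norm E + 2 * L * t)) * (2 * norm E) + L * (2 * L * norm E * t)"
      using norm_triangle_le[OF add_mono[OF 1 2]] by (simp only:)
    also have "\<dots> = 2 * norm E * (\<eta> + 2 * L * norm E + 3 * L * (L * t))" by (simp add: algebra_simps)
    finally show "norm (V s (x s (X + E)) - V s (x s X) - A E) \<le> 0 * norm (u s) + 2 * norm E * (\<eta> + 2 * L * norm E + 3 * L * (L * t))"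
      by (simp add: p_def q_def)
  qed (use time_bounds[OF t] in auto)
  then show ?thesis by (simp add: u_def A_def)
qed

lemma C1_flow:
  assumes t: "t \<in> {0..T}" shows "Ck_on 1 (x t) UNIV"
    and "\<And>X e. norm (x t (X + e) - x t X - fderiv (x t) X e) \<le> (8 * L * t) * (norm e)\<^sup>2"
proof -
  have "0 \<le> 8 * L * t" using L_nonneg time_bounds[OF t] by simp
  from second_difference_imp_differentiable[OF second_difference[OF t] lipschitz[OF t] this]
  obtain f' where f': "\<And>X. (x t has_derivative f' X) (at X)"
    "\<And>X e. norm (x t (X + e) - x t X - f' X e) \<le> (8 * L * t) * (norm e)\<^sup>2"
    "\<And>X Y e. norm (f' X e - f' Y e) \<le> (8 * L * t) * norm (X - Y) * norm e" by blast
  have "continuous_on UNIV (\<lambda>X. f' X e)" for e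
  proof (rule lipschitz_on_continuous_on)
    have c: "0 \<le> (8 * L * t) * norm e" by (rule mult_nonneg_nonneg[OF \<open>0 \<le> 8 * L * t\<close> norm_ge_zero])
    show "((8 * L * t) * norm e)-lipschitz_on UNIV (\<lambda>X. f' X e)"
      using f'(3)[where e=e] c by (intro lipschitz_onI) (auto simp: dist_norm mult_ac)
  qed
  then show "Ck_on 1 (x t) UNIV" unfolding One_nat_def by (intro Ck_on_SucI[OF _ f'(1)]) auto
  show "norm (x t (X + e) - x t X - fderiv (x t) X e) \<le> (8 * L * t) * (norm e)\<^sup>2" for X e
    using f'(2)[of X e] frechet_derivative_at[OF f'(1)] by metis
qed

text \<open>Applying \<open>expansion\<close> to \<open>h e\<close>, dividing by \<open>h\<close> and letting \<open>h\<close> tend to zero removes the terms that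
are quadratic in the space increment.\<close>

lemma derivative_expansion:
  assumes t: "t \<in> {0..T}" and \<eta>: "0 \<le> \<eta>"
    "\<And>s y e. s \<in> {0..t} \<Longrightarrow> norm (fderiv (V s) y e - fderiv (V 0) y e) \<le> \<eta> * norm e"
  shows "norm (fderiv (x t) X e - e - t *\<^sub>R fderiv (V 0) X e) \<le>
    4 * (\<eta> + 3 * L * (L * t)) * t * norm e"
proof (rule tendsto_lowerbound)
  define J A where "J = fderiv (x t) X" and "A = fderiv (V 0) X"
  have 0: "0 \<in> {0..\<delta>}" using time_bounds[OF t] by auto
  have linA: "linear A" using has_derivative_linear[OF regular_velocityD(1)[OF rv 0]] by (simp add: A_def)
  have "(x t has_derivative J) (at X)" using C1_flow(1)[OF t] Ck_on_Suc_has_derivative[of 0 "x t" UNIV X] by (simp add: J_def)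
  then have linJ: "linear J" by (rule has_derivative_linear)
  show "((\<lambda>h. (8 * L * t) * (h * (norm e)\<^sup>2) + 4 * norm e * (\<eta> + 2 * L * (h * norm e) + 3 * L * (L * t)) * t) \<longlongrightarrow>
     4 * (\<eta> + 3 * L * (L * t)) * t * norm e) (at_right 0)"
    by (auto intro!: tendsto_eq_intros)
  show "\<forall>\<^sub>F h in at_right 0. norm (fderiv (x t) X e - e - t *\<^sub>R fderiv (V 0) X e) \<le>
      (8 * L * t) * (h * (norm e)\<^sup>2) + 4 * norm e * (\<eta> + 2 * L * (h * norm e) + 3 * L * (L * t)) * t"
    using eventually_at_right_less[of "0::real"]
  proof eventually_elim
    case (elim h)
    define E where "E = h *\<^sub>R e"
    have nE: "norm E = h * norm e" using elim by (simp add: E_def)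
    have "h *\<^sub>R (J e - e - t *\<^sub>R A e) = - (x t (X + E) - x t X - J E) + (x t (X + E) - x t X - E - t *\<^sub>R A E)"
      using linJ linA by (simp add: E_def linear_scale algebra_simps)
    then have "norm (h *\<^sub>R (J e - e - t *\<^sub>R A e)) \<le> norm (x t (X + E) - x t X - J E) + norm (x t (X + E) - x t X - E - t *\<^sub>R A E)"
      by (metis norm_minus_cancel norm_triangle_ineq)
    also have "\<dots> \<le> (8 * L * t) * (norm E)\<^sup>2 + 4 * norm E * (\<eta> + 2 * L * norm E + 3 * L * (L * t)) * t"
      unfolding J_def A_def by (intro add_mono C1_flow(2)[OF t] expansion[OF t \<eta>])
    also have "\<dots> = h * ((8 * L * t) * (h * (norm e)\<^sup>2) + 4 * norm e * (\<eta> + 2 * L * (h * norm e) + 3 * L * (L * t)) * t)"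
      unfolding nE by (simp add: algebra_simps power2_eq_square)
    finally show ?case using elim by (simp add: J_def A_def)
  qed
qed simp

end

lemma flow_small_time:
  fixes V x :: "real \<Rightarrow> real^'n \<Rightarrow> real^'n"
  assumes "velocity_field 2 D \<epsilon> V" "trajectories \<epsilon> V x" "0 < \<epsilon>"
  obtains \<delta> where "0 < \<delta>" "\<And>t. t \<in> {0..\<delta>} \<Longrightarrow> Ck_on 1 (x t) UNIV"
    "\<And>t X Y. t \<in> {0..\<delta>} \<Longrightarrow> norm (x t X - x t Y - (X - Y)) \<le> norm (X - Y) / 2"
    "\<And>\<eta>. \<eta> > 0 \<Longrightarrow> \<exists>\<delta>'>0. \<forall>t\<in>{0..\<delta>'}. \<forall>X e.
       norm (fderiv (x t) X e - e - t *\<^sub>R fderiv (V 0) X e) \<le> \<eta> * t * norm e"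
proof -
  obtain \<delta> L where V: "\<delta> \<le> \<epsilon>" "regular_velocity \<delta> L V"
    "\<And>\<eta>. \<eta> > 0 \<Longrightarrow> \<exists>\<delta>'>0. \<forall>t\<in>{0..\<delta>'}. \<forall>y e. norm (fderiv (V t) y e - fderiv (V 0) y e) \<le> \<eta> * norm e"
    by (rule velocity_field_regular[OF assms(1,3)]) (rule that)
  have L: "0 \<le> L" "0 < \<delta>" using regular_velocity_pos[OF V(2)] by auto
  (* L * T at most 1/4 makes the flow differ from the identity by a contraction with factor 1/2 *)
  define T where "T = min \<delta> (1 / (4 * (L + 1)))"
  have Tp: "0 < T" "T \<le> \<delta>" using L by (auto simp: T_def)
  have "L * T \<le> (L + 1) * (1 / (4 * (L + 1)))" using L by (intro mult_mono) (auto simp: T_def)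
  also have "\<dots> = 1/4" using L by simp
  finally have LT: "L * T \<le> 1/4" .
  interpret small_flow \<delta> L T V x
  proof
    fix t X
    show "x 0 X = X" using assms(2) by (simp add: trajectories_def)
    assume t: "t \<in> {0..T}"
    then have "((\<lambda>s. x s X) has_vector_derivative V t (x t X)) (at t within {0..\<epsilon>})"
      using assms(2) Tp V(1) by (auto simp: trajectories_def)
    then show "((\<lambda>s. x s X) has_vector_derivative V t (x t X)) (at t within {0..T})"
      by (rule has_vector_derivative_within_subset) (use Tp V(1) in auto)
  qed (use V(2) Tp LT in auto)
  show ?thesis
  proof (rule that[of T])
    show "norm (x t X - x t Y - (X - Y)) \<le> norm (X - Y) / 2" if t: "t \<in> {0..T}" for t X Y
    proof -
      have "L * t \<le> L * T" using L t by (intro mult_left_mono) auto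
      then have "(L * t) * (2 * norm (X - Y)) \<le> 1/4 * (2 * norm (X - Y))" using LT by (intro mult_right_mono) auto
      then show ?thesis using near_isometry[OF t, of X Y] by (simp add: mult_ac)
    qed
    fix \<eta> :: real assume \<eta>: "\<eta> > 0"
    obtain d where d: "d > 0" "\<forall>t\<in>{0..d}. \<forall>y e. norm (fderiv (V t) y e - fderiv (V 0) y e) \<le> (\<eta>/8) * norm e"
      using V(3)[of "\<eta>/8"] \<eta> by auto
    define c where "c = Min {d, T, \<eta> / (24 * (L * L + 1))}"
    have c: "c \<le> d" "c \<le> T" "c \<le> \<eta> / (24 * (L * L + 1))" by (auto simp: c_def)
    have LL: "0 \<le> L * L" using L by simp
    have c0: "c > 0" using d(1) Tp \<eta> LL by (simp add: c_def add_nonneg_pos)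
    have "norm (fderiv (x t) X e - e - t *\<^sub>R fderiv (V 0) X e) \<le> \<eta> * t * norm e"
      if t: "t \<in> {0..c}" for t X e
    proof -
      have "norm (fderiv (x t) X e - e - t *\<^sub>R fderiv (V 0) X e) \<le>
         4 * (\<eta>/8 + 3 * L * (L * t)) * t * norm e"
        by (rule derivative_expansion) (use t c d \<eta> in auto)
      also have "\<dots> \<le> \<eta> * t * norm e"
      proof (intro mult_right_mono)
        have "(L * L) * t \<le> (L * L + 1) * (\<eta> / (24 * (L * L + 1)))" using t c LL by (intro mult_mono) auto
        also have "\<dots> = \<eta> / 24"
        proof -
          have *: "m * (\<eta> / (24 * m)) = \<eta> / 24" if "m > 0" for m using that by simp
          show ?thesis by (rule *) (use LL in linarith)
        qed
        finally show "4 * (\<eta>/8 + 3 * L * (L * t)) \<le> \<eta>" by (simp add: mult.assoc)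
      qed (use t in auto)
      finally show ?thesis .
    qed
    then show "\<exists>\<delta>'>0. \<forall>t\<in>{0..\<delta>'}. \<forall>X e.
       norm (fderiv (x t) X e - e - t *\<^sub>R fderiv (V 0) X e) \<le> \<eta> * t * norm e"
      using c0 by blast
  qed (use Tp C1_flow(1) in auto)
qed

text \<open>The identity plus a contraction: \<open>f X = Y\<close> is a fixed point equation for a contraction, and the
derivatives are invertible with inverses of norm at most 2.\<close>

lemma near_identity_diffeomorphism:
  fixes f :: "'a::euclidean_space \<Rightarrow> 'a"
  assumes "Ck_on 1 f UNIV" and ni: "\<And>X Y. norm (f X - f Y - (X - Y)) \<le> norm (X - Y) / 2"
  obtains h where "homeomorphism UNIV UNIV f h" "Ck_on 1 h UNIV"
    "\<And>X e. norm (fderiv f X e - e) \<le> norm e / 2"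
proof -
  define J where "J X = fderiv f X" for X
  have Jd: "(f has_derivative J X) (at X)" for X
    using assms(1) Ck_on_Suc_has_derivative[of 0 f UNIV X] by (simp add: J_def)
  have linJ: "linear (J X)" for X using has_derivative_linear[OF Jd] .
  have Jc: "continuous_on UNIV (\<lambda>X. J X e)" for e using assms(1) by (simp add: J_def)
  have low: "norm (X - Y) \<le> 2 * norm (f X - f Y)" for X Y
    using ni[of X Y] norm_triangle_ineq4[of "f X - f Y" "f X - f Y - (X - Y)"] by simp
  have inj: "inj f"
  proof (rule injI)
    fix X Y assume "f X = f Y"
    then show "X = Y" using low[of X Y] by simp
  qed
  have surj: "surj f"
    unfolding surj_def
  proof
    fix Y
    have "\<exists>!X. Y - (f X - X) = X"
    proof (rule banach_fix_type[of "1/2"])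
      have "norm (Y - (f X - X) - (Y - (f Z - Z))) \<le> norm (X - Z) / 2" for X Z
        using ni[of Z X] by (simp add: algebra_simps norm_minus_commute)
      then show "\<forall>X Z. dist (Y - (f X - X)) (Y - (f Z - Z)) \<le> 1/2 * dist X Z" by (simp add: dist_norm)
    qed auto
    then show "\<exists>X. Y = f X" by (metis add_diff_cancel_left' diff_add_cancel diff_diff_eq2 eq_iff_diff_eq_0)
  qed
  define h where "h = inv f"
  have fh: "f (h Y) = Y" and hf: "h (f X) = X" for X Y
    using inj surj by (auto simp: h_def surj_f_inv_f)
  have hl: "norm (h P - h Q) \<le> 2 * norm (P - Q)" for P Q using low[of "h P" "h Q"] by (simp add: fh)
  have "2-lipschitz_on UNIV h" using hl by (intro lipschitz_onI) (auto simp: dist_norm)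
  then have hc: "continuous_on UNIV h" by (rule lipschitz_on_continuous_on)
  have fc: "continuous_on UNIV f" using Ck_on_imp_continuous[OF assms(1)] .
  have homeo: "homeomorphism UNIV UNIV f h"
    unfolding homeomorphism_def using fh hf fc hc by (metis surj surjI UNIV_I)
  have Jn: "norm (J X e - e) \<le> norm e / 2" for X e
  proof (rule field_le_epsilon)
    fix \<eta> :: real assume "\<eta> > 0"
    define c where "c = \<eta> / (norm e + 1)"
    have ne: "norm e + 1 > 0" using norm_ge_zero[of e] by linarith
    have c: "c > 0" "c * norm e \<le> \<eta>" using \<open>\<eta> > 0\<close> ne by (auto simp: c_def field_simps)
    obtain d where d: "d > 0" "\<And>y. norm (y - X) < d \<Longrightarrow> norm (f y - f X - J X (y - X)) \<le> c * norm (y - X)"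
      using Jd[of X] c(1) unfolding has_derivative_at_alt by blast
    define s where "s = d / (2 * (norm e + 1))"
    have s: "s > 0" using d(1) ne by (simp add: s_def)
    have "s * norm e < s * (norm e + 1)" using s by simp
    also have "\<dots> = d / 2" using ne by (simp add: s_def field_simps)
    finally have sd: "norm ((X + s *\<^sub>R e) - X) < d" using s d(1) by simp
    have "s *\<^sub>R (J X e - e) = (f (X + s *\<^sub>R e) - f X - ((X + s *\<^sub>R e) - X)) - (f (X + s *\<^sub>R e) - f X - J X ((X + s *\<^sub>R e) - X))"
      by (simp add: linear_scale[OF linJ] scaleR_diff_right)
    then have "norm (s *\<^sub>R (J X e - e)) \<le> norm ((X + s *\<^sub>R e) - X) / 2 + c * norm ((X + s *\<^sub>R e) - X)"
      using norm_triangle_le_diff[OF add_mono[OF ni[of "X + s *\<^sub>R e" X] d(2)[OF sd]]] by metis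
    also have "norm (s *\<^sub>R (J X e - e)) = s * norm (J X e - e)" using s by simp
    also have "norm ((X + s *\<^sub>R e) - X) / 2 + c * norm ((X + s *\<^sub>R e) - X) = s * (norm e / 2 + c * norm e)"
      using s by (simp add: distrib_left)
    finally have "s * norm (J X e - e) \<le> s * (norm e / 2 + c * norm e)" .
    then show "norm (J X e - e) \<le> norm e / 2 + \<eta>" using s c(2) by simp
  qed
  have Jlow: "norm e \<le> 2 * norm (J X e)" for X e
    using Jn[of X e] norm_triangle_ineq4[of "J X e" "J X e - e"] by simp
  have "\<exists>K. linear K \<and> (\<forall>e. K (J X e) = e) \<and> (\<forall>e. J X (K e) = e)" for X
  proof (rule linear_injective_isomorphism[OF linJ])
    show "inj (J X)"
      unfolding linear_injective_0[OF linJ] using Jlow[of _ X] by (metis mult_zero_right norm_le_zero_iff norm_zero)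
  qed simp
  then obtain K where K: "\<And>X. linear (K X)" "\<And>X e. K X (J X e) = e" "\<And>X e. J X (K X e) = e" by metis
  have Kb: "norm (K X e) \<le> 2 * norm e" for X e using Jlow[of "K X e" X] by (simp add: K)
  have hd: "(h has_derivative K (h Y)) (at Y)" for Y
  proof (rule has_derivative_inverse_basic[OF Jd, where T=UNIV])
    show "bounded_linear (K (h Y))" using K(1) linear_conv_bounded_linear by blast
    show "continuous (at Y) h" using hc by (simp add: continuous_on_eq_continuous_at)
  qed (auto simp: fh K fun_eq_iff)
  have "continuous_on UNIV (\<lambda>Y. K (h Y) e)" for e
  proof (clarsimp simp: continuous_on_eq_continuous_at isCont_def)
    fix Q
    show "((\<lambda>Y. K (h Y) e) \<longlongrightarrow> K (h Q) e) (at Q)"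
    proof (rule Lim_null_comparison[THEN Lim_null[THEN iffD2]])
      have "norm (K (h P) e - K (h Q) e) \<le> 2 * norm (J (h P) (K (h Q) e) - J (h Q) (K (h Q) e))" for P
      proof -
        have "K (h P) e - K (h Q) e = K (h P) (J (h Q) (K (h Q) e) - J (h P) (K (h Q) e))"
          by (simp add: linear_diff[OF K(1)] K(2,3))
        then show ?thesis using Kb by (metis norm_minus_commute)
      qed
      then show "\<forall>\<^sub>F P in at Q. norm (K (h P) e - K (h Q) e) \<le> 2 * norm (J (h P) (K (h Q) e) - J (h Q) (K (h Q) e))" by simp
      have "continuous_on UNIV (\<lambda>P. J (h P) (K (h Q) e))"
        using continuous_on_compose2[OF Jc hc] by auto
      then have "((\<lambda>P. J (h P) (K (h Q) e)) \<longlongrightarrow> J (h Q) (K (h Q) e)) (at Q)"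
        by (simp add: continuous_on_eq_continuous_at isCont_def)
      then have "((\<lambda>P. 2 * norm (J (h P) (K (h Q) e) - J (h Q) (K (h Q) e))) \<longlongrightarrow> 2 * norm (J (h Q) (K (h Q) e) - J (h Q) (K (h Q) e))) (at Q)"
        by (intro tendsto_intros)
      then show "((\<lambda>P. 2 * norm (J (h P) (K (h Q) e) - J (h Q) (K (h Q) e))) \<longlongrightarrow> 0) (at Q)" by simp
    qed
  qed
  then have "Ck_on 1 h UNIV" unfolding One_nat_def by (intro Ck_on_SucI[OF _ hd]) auto
  then show ?thesis using that[OF homeo] Jn by (simp add: J_def)
qed

section \<open>Uniform one-sided derivatives in time\<close>

text \<open>The derivative at \<open>t = 0\<close> from the right, uniformly in space. The bounds are part of the notion
because they make it stable under products.\<close>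

definition has_uniform_derivative ::
  "'a set \<Rightarrow> (real \<Rightarrow> 'a \<Rightarrow> 'b::real_normed_vector) \<Rightarrow> ('a \<Rightarrow> 'b) \<Rightarrow> ('a \<Rightarrow> 'b) \<Rightarrow> bool" where
  "has_uniform_derivative S F f f' \<longleftrightarrow> bounded (f ` S) \<and> bounded (f' ` S) \<and>
     uniform_limit S (\<lambda>t y. (F t y - f y) /\<^sub>R t) f' (at_right 0)"

lemma uniform_limit_at_right_cong:
  assumes "uniform_limit S F f (at_right 0)" "\<And>t y. t > 0 \<Longrightarrow> y \<in> S \<Longrightarrow> F t y = G t y" "\<And>y. y \<in> S \<Longrightarrow> f y = g y"
  shows "uniform_limit S G g (at_right (0::real))"
proof -
  have ev: "\<forall>\<^sub>F t in at_right (0::real). \<forall>y\<in>S. F t y = G t y"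
    using eventually_at_right_less[of "0::real"] by eventually_elim (use assms(2) in auto)
  show ?thesis using uniform_limit_cong[OF ev, of f g] assms(1,3) by blast
qed

lemma uniform_limit_time: "uniform_limit S (\<lambda>t y. t) (\<lambda>y. 0) (at_right (0::real))"
proof (rule uniform_limitI)
  fix e :: real assume "e > 0"
  then have "\<forall>\<^sub>F t in at_right (0::real). dist t 0 < e"
    by (auto simp: eventually_at_right_field dist_real_def intro!: exI[of _ e])
  then show "\<forall>\<^sub>F t in at_right (0::real). \<forall>y\<in>S. dist t 0 < e" by eventually_elim auto
qed

lemma has_uniform_derivative_limit:
  fixes f :: "'a \<Rightarrow> 'b::real_normed_vector"
  assumes "has_uniform_derivative S F f f'"
  shows "uniform_limit S F f (at_right 0)"
proof -
  have *: "uniform_limit S (\<lambda>t y. (F t y - f y) /\<^sub>R t) f' (at_right 0)" "bounded (f' ` S)"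
    using assms by (auto simp: has_uniform_derivative_def)
  have "uniform_limit S (\<lambda>t y. t *\<^sub>R ((F t y - f y) /\<^sub>R t)) (\<lambda>y. 0 *\<^sub>R f' y) (at_right 0)"
    by (rule bounded_bilinear.bounded_uniform_limit[OF bounded_bilinear_scaleR uniform_limit_time *(1,2)])
      (auto simp: bounded_iff)
  from uniform_limit_add[OF this uniform_limit_const[where c=f]] show ?thesis
    by (rule uniform_limit_at_right_cong) auto
qed

lemma has_uniform_derivative_cong:
  assumes "has_uniform_derivative S F f f'" "\<And>y. y \<in> S \<Longrightarrow> f y = g y" "\<And>y. y \<in> S \<Longrightarrow> f' y = g' y"
    "\<forall>\<^sub>F t in at_right 0. \<forall>y\<in>S. F t y = G t y"
  shows "has_uniform_derivative S G g g'"
proof -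
  have "f ` S = g ` S" "f' ` S = g' ` S" using assms(2,3) by auto
  moreover have "\<forall>\<^sub>F t in at_right 0. \<forall>y\<in>S. (F t y - f y) /\<^sub>R t = (G t y - g y) /\<^sub>R t"
    using assms(4) by eventually_elim (use assms(2) in auto)
  then have "uniform_limit S (\<lambda>t y. (F t y - f y) /\<^sub>R t) f' (at_right 0) \<longleftrightarrow>
      uniform_limit S (\<lambda>t y. (G t y - g y) /\<^sub>R t) g' (at_right 0)"
    by (rule uniform_limit_cong) (use assms(3) in auto)
  ultimately show ?thesis using assms(1) by (simp add: has_uniform_derivative_def)
qed

lemma bounded_image_bilinear:
  assumes "bounded_bilinear B" "bounded (f ` S)" "bounded (g ` S)"
  shows "bounded ((\<lambda>y. B (f y) (g y)) ` S)"
proof -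
  obtain K where K: "K > 0" "\<And>a b. norm (B a b) \<le> norm a * norm b * K" using bounded_bilinear.pos_bounded[OF assms(1)] by auto
  obtain C1 C2 where C: "C1 > 0" "\<And>y. y \<in> S \<Longrightarrow> norm (f y) \<le> C1" "C2 > 0" "\<And>y. y \<in> S \<Longrightarrow> norm (g y) \<le> C2"
    using assms(2,3) unfolding bounded_pos by auto
  have "norm (B (f y) (g y)) \<le> C1 * C2 * K" if "y \<in> S" for y
  proof -
    have "norm (f y) * norm (g y) * K \<le> C1 * C2 * K"
      using C(2,4)[OF that] C(1) K(1) by (intro mult_right_mono mult_mono) auto
    then show ?thesis using K(2)[of "f y" "g y"] by linarith
  qed
  then show ?thesis unfolding bounded_iff by (intro exI[of _ "C1 * C2 * K"]) auto
qed

lemma bounded_image_add: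
  "bounded (f ` S) \<Longrightarrow> bounded (g ` S) \<Longrightarrow> bounded ((\<lambda>y. f y + g y :: 'b::real_normed_vector) ` S)"
  by (rule bounded_plus_comp)

lemma has_uniform_derivative_bilinear:
  assumes "bounded_bilinear B" "has_uniform_derivative S F f f'" "has_uniform_derivative S G g g'"
  shows "has_uniform_derivative S (\<lambda>t y. B (F t y) (G t y)) (\<lambda>y. B (f y) (g y)) (\<lambda>y. B (f' y) (g y) + B (f y) (g' y))"
proof -
  have f: "bounded (f ` S)" "bounded (f' ` S)" "uniform_limit S (\<lambda>t y. (F t y - f y) /\<^sub>R t) f' (at_right 0)"
   and g: "bounded (g ` S)" "bounded (g' ` S)" "uniform_limit S (\<lambda>t y. (G t y - g y) /\<^sub>R t) g' (at_right 0)"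
    using assms(2,3) by (auto simp: has_uniform_derivative_def)
  note lim = bounded_bilinear.bounded_uniform_limit[OF assms(1)]
  have "uniform_limit S (\<lambda>t y. B ((F t y - f y) /\<^sub>R t) (G t y) + B (f y) ((G t y - g y) /\<^sub>R t))
      (\<lambda>y. B (f' y) (g y) + B (f y) (g' y)) (at_right 0)"
    by (intro uniform_limit_add lim f g uniform_limit_const has_uniform_derivative_limit[OF assms(3)])
  then have "uniform_limit S (\<lambda>t y. (B (F t y) (G t y) - B (f y) (g y)) /\<^sub>R t)
      (\<lambda>y. B (f' y) (g y) + B (f y) (g' y)) (at_right 0)"
    by (rule uniform_limit_at_right_cong)
      (simp_all add: bounded_bilinear.scaleR_left[OF assms(1)] bounded_bilinear.scaleR_right[OF assms(1)]
        bounded_bilinear.diff_left[OF assms(1)] bounded_bilinear.diff_right[OF assms(1)] flip: scaleR_add_right)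
  then show ?thesis
    unfolding has_uniform_derivative_def
    by (intro conjI bounded_image_add bounded_image_bilinear[OF assms(1)] f g)
qed

lemma has_uniform_derivative_const: "bounded (f ` S) \<Longrightarrow> has_uniform_derivative S (\<lambda>t. f) f (\<lambda>y. 0)"
  unfolding has_uniform_derivative_def
  by (auto simp: bounded_iff intro!: uniform_limitI)

lemma has_uniform_derivative_bounded_linear:
  assumes "bounded_linear h" "has_uniform_derivative S F f f'"
  shows "has_uniform_derivative S (\<lambda>t y. h (F t y)) (\<lambda>y. h (f y)) (\<lambda>y. h (f' y))"
proof -
  have f: "bounded (f ` S)" "bounded (f' ` S)" "uniform_limit S (\<lambda>t y. (F t y - f y) /\<^sub>R t) f' (at_right 0)"
    using assms(2) by (auto simp: has_uniform_derivative_def)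
  have "uniform_limit S (\<lambda>t y. h ((F t y - f y) /\<^sub>R t)) (\<lambda>y. h (f' y)) (at_right 0)"
    by (rule bounded_linear.uniform_limit[OF assms(1) f(3)])
  then have "uniform_limit S (\<lambda>t y. (h (F t y) - h (f y)) /\<^sub>R t) (\<lambda>y. h (f' y)) (at_right 0)"
    by (rule uniform_limit_at_right_cong)
      (simp_all add: bounded_linear.linear[OF assms(1)] linear_diff linear_scale)
  then show ?thesis
    using bounded_linear_image[OF f(1) assms(1)] bounded_linear_image[OF f(2) assms(1)]
    by (simp add: has_uniform_derivative_def image_image)
qed

lemma has_uniform_derivative_add:
  assumes "has_uniform_derivative S F f f'" "has_uniform_derivative S G g g'"
  shows "has_uniform_derivative S (\<lambda>t y. F t y + G t y) (\<lambda>y. f y + g y) (\<lambda>y. f' y + g' y)"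
proof -
  have "uniform_limit S (\<lambda>t y. (F t y - f y) /\<^sub>R t + (G t y - g y) /\<^sub>R t) (\<lambda>y. f' y + g' y) (at_right 0)"
    using assms unfolding has_uniform_derivative_def by (intro uniform_limit_add) auto
  then have "uniform_limit S (\<lambda>t y. ((F t y + G t y) - (f y + g y)) /\<^sub>R t) (\<lambda>y. f' y + g' y) (at_right 0)"
    by (rule uniform_limit_at_right_cong) (simp_all add: algebra_simps)
  then show ?thesis using assms unfolding has_uniform_derivative_def by (simp add: bounded_image_add)
qed

lemma has_uniform_derivative_diff:
  assumes "has_uniform_derivative S F f f'" "has_uniform_derivative S G g g'"
  shows "has_uniform_derivative S (\<lambda>t y. F t y - G t y) (\<lambda>y. f y - g y) (\<lambda>y. f' y - g' y)"
  using has_uniform_derivative_add[OF assms(1) has_uniform_derivative_bounded_linear[OF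
     bounded_linear_minus[OF bounded_linear_ident] assms(2)]] by simp

text \<open>The product is kept abstract so that matrices and real numbers are both covered. From \<open>G F = 1\<close>
one gets \<open>G - 1 = - G (F - 1)\<close>, which first shows that \<open>G\<close> converges to \<open>1\<close> and then gives its
derivative.\<close>

lemma has_uniform_derivative_inverse:
  fixes prod :: "'b::real_normed_vector \<Rightarrow> 'b \<Rightarrow> 'b"
  assumes bb: "bounded_bilinear prod" and one: "\<And>a. prod a one = a" "\<And>a. prod one a = a"
    and F: "has_uniform_derivative S F (\<lambda>y. one) f'"
    and inv: "\<forall>\<^sub>F t in at_right 0. \<forall>y\<in>S. prod (G t y) (F t y) = one"
  shows "has_uniform_derivative S G (\<lambda>y. one) (\<lambda>y. - f' y)"
proof -
  obtain K where K: "K > 0" "\<And>a b. norm (prod a b) \<le> norm a * norm b * K" using bounded_bilinear.pos_bounded[OF bb] by auto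
  have f: "bounded (f' ` S)" "uniform_limit S (\<lambda>t y. (F t y - one) /\<^sub>R t) f' (at_right 0)"
    using F by (auto simp: has_uniform_derivative_def)
  have eq: "\<forall>\<^sub>F t in at_right 0. \<forall>y\<in>S. G t y - one = - prod (G t y) (F t y - one)"
    using inv by eventually_elim (simp add: bounded_bilinear.diff_right[OF bb] one)
  have G: "uniform_limit S G (\<lambda>y. one) (at_right 0)"
  proof (rule uniform_limitI)
    fix e :: real assume "e > 0"
    (* the first bound absorbs the term with G on the right, the second one makes the rest small *)
    define d where "d = min (1 / (2 * K)) (e / (4 * K * (norm one + 1)))"
    have n1: "norm one + 1 > 0" using norm_ge_zero[of one] by linarith
    have d: "d > 0" using \<open>e > 0\<close> K n1 by (simp add: d_def)
    have Kd: "K * d \<le> 1/2"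
    proof -
      have "K * d \<le> K * (1 / (2 * K))" using K by (intro mult_left_mono) (auto simp: d_def)
      then show ?thesis using K by simp
    qed
    have "K * d * (norm one + 1) \<le> K * (e / (4 * K * (norm one + 1))) * (norm one + 1)"
      using K n1 by (intro mult_right_mono mult_left_mono) (auto simp: d_def)
    also have "\<dots> = e / 4"
    proof -
      have *: "K * (e / (4 * K * n)) * n = e / 4" if "n > 0" for n using K(1) that by simp
      show ?thesis by (rule *[OF n1])
    qed
    finally have Ke: "K * d * (norm one + 1) \<le> e / 4" .
    show "\<forall>\<^sub>F t in at_right 0. \<forall>y\<in>S. dist (G t y) one < e"
      using eq uniform_limitD[OF has_uniform_derivative_limit[OF F] d]
    proof eventually_elim
      case (elim t)
      show ?case
      proof
        fix y assume y: "y \<in> S"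
        define g where "g = norm (G t y - one)"
        have Fd: "norm (F t y - one) \<le> d" using elim(2) y by (auto simp: dist_norm)
        have Gn: "norm (G t y) \<le> g + norm one" using norm_triangle_sub[of "G t y" one] by (simp add: g_def)
        have "g = norm (prod (G t y) (F t y - one))" using elim(1) y by (simp add: g_def)
        also have "\<dots> \<le> norm (G t y) * norm (F t y - one) * K" by (rule K(2))
        also have "\<dots> \<le> (g + norm one) * d * K"
          using K Fd Gn d by (intro mult_right_mono mult_mono) (auto simp: g_def)
        also have "\<dots> = (K * d) * g + (K * d) * norm one" by (simp add: algebra_simps)
        also have "\<dots> \<le> 1/2 * g + (K * d) * norm one" using Kd by (intro add_right_mono mult_right_mono) (auto simp: g_def)
        finally have "g \<le> 2 * ((K * d) * norm one)" by simp
        moreover have "(K * d) * norm one \<le> K * d * (norm one + 1)" using K d by (intro mult_left_mono) auto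
        ultimately have "g < e" using Ke \<open>e > 0\<close> by linarith
        then show "dist (G t y) one < e" by (simp add: g_def dist_norm)
      qed
    qed
  qed
  have "uniform_limit S (\<lambda>t y. - prod (G t y) ((F t y - one) /\<^sub>R t)) (\<lambda>y. - prod one (f' y)) (at_right 0)"
    by (intro uniform_limit_intros bounded_bilinear.bounded_uniform_limit[OF bb G f(2)] f(1)) (auto simp: bounded_iff)
  moreover have "\<forall>\<^sub>F t in at_right 0. \<forall>y\<in>S. - prod (G t y) ((F t y - one) /\<^sub>R t) = (G t y - one) /\<^sub>R t"
    using eq by eventually_elim (simp add: bounded_bilinear.scaleR_right[OF bb])
  from uniform_limit_cong[OF this, of "\<lambda>y. - prod one (f' y)" "\<lambda>y. - f' y"] have "uniform_limit S (\<lambda>t y. - prod (G t y) ((F t y - one) /\<^sub>R t)) (\<lambda>y. - prod one (f' y)) (at_right 0)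
      \<longleftrightarrow> uniform_limit S (\<lambda>t y. (G t y - one) /\<^sub>R t) (\<lambda>y. - f' y) (at_right 0)"
    by (simp add: one)
  ultimately have "uniform_limit S (\<lambda>t y. (G t y - one) /\<^sub>R t) (\<lambda>y. - f' y) (at_right 0)" by blast
  moreover have "bounded ((\<lambda>y. - f' y) ` S)" using f(1) by (simp add: bounded_iff)
  ultimately show ?thesis unfolding has_uniform_derivative_def by (auto simp: bounded_iff)
qed

lemma bounded_bilinear_matrix_vector: "bounded_bilinear ((*v) :: real^'n^'m \<Rightarrow> real^'n \<Rightarrow> real^'m)"
  unfolding bilinear_conv_bounded_bilinear[symmetric] bilinear_def
  by (auto intro!: linearI simp: vec_eq_iff matrix_vector_mult_def sum.distrib sum_distrib_left algebra_simps)

lemma bounded_bilinear_matrix_matrix: "bounded_bilinear ((**) :: real^'n^'m \<Rightarrow> real^'k^'n \<Rightarrow> real^'k^'m)"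
  unfolding bilinear_conv_bounded_bilinear[symmetric] bilinear_def
  by (auto intro!: linearI simp: vec_eq_iff matrix_matrix_mult_def sum.distrib sum_distrib_left algebra_simps)

lemma bounded_bilinear_outer: "bounded_bilinear (outer :: real^'n \<Rightarrow> real^'n \<Rightarrow> real^'n^'n)"
  unfolding bilinear_conv_bounded_bilinear[symmetric] bilinear_def
  by (auto intro!: linearI simp: outer_def vec_eq_iff algebra_simps)

lemma bounded_linear_transpose: "bounded_linear (transpose :: real^'n^'m \<Rightarrow> real^'m^'n)"
  unfolding linear_conv_bounded_linear[symmetric]
  by (auto intro!: linearI simp: transpose_def vec_eq_iff)

lemma matrix_column_expansion: "(A :: real^'n^'m) = (\<chi> i j. (A *v axis j 1) $ i)"
  by (simp add: vec_eq_iff matrix_vector_mult_basis column_def)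

lemma matrix_norm_le_columns:
  fixes A :: "real^'n^'m"
  assumes "\<And>j. norm (A *v axis j 1) \<le> c"
  shows "norm A \<le> real CARD('m) * real CARD('n) * c"
proof -
  have "norm A \<le> (\<Sum>i\<in>UNIV. norm (A $ i))" unfolding norm_vec_def by (rule L2_set_le_sum) auto
  also have "\<dots> \<le> (\<Sum>i\<in>(UNIV::'m set). real CARD('n) * c)"
  proof (rule sum_mono)
    fix i
    have "norm (A $ i) \<le> (\<Sum>j\<in>UNIV. norm (A $ i $ j))" unfolding norm_vec_def by (rule L2_set_le_sum) auto
    also have "\<dots> \<le> (\<Sum>j\<in>(UNIV::'n set). c)"
    proof (rule sum_mono)
      fix j
      have "A $ i $ j = (A *v axis j 1) $ i" using matrix_column_expansion[of A] by (metis vec_lambda_beta)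
      then show "norm (A $ i $ j) \<le> c" using assms[of j] component_le_norm_cart[of "A *v axis j 1" i] by simp
    qed
    finally show "norm (A $ i) \<le> real CARD('n) * c" by simp
  qed
  finally show ?thesis by simp
qed

lemma uniform_limit_matrix:
  fixes A :: "'t \<Rightarrow> 'a \<Rightarrow> real^'n^'m"
  assumes "\<And>j. uniform_limit S (\<lambda>t y. A t y *v axis j 1) (\<lambda>y. A0 y *v axis j 1) F"
  shows "uniform_limit S A A0 F"
proof (rule uniform_limitI)
  fix e :: real assume e: "e > 0"
  define c where "c = e / (real CARD('m) * real CARD('n) + 1)"
  have pos: "real CARD('m) * real CARD('n) + 1 > 0" by (simp add: add_nonneg_pos)
  have c: "c > 0" using e pos by (simp add: c_def)
  have ce: "real CARD('m) * real CARD('n) * c < e"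
  proof -
    have "real CARD('m) * real CARD('n) * c < (real CARD('m) * real CARD('n) + 1) * c" using c by simp
    also have "\<dots> = e" using pos by (simp add: c_def)
    finally show ?thesis .
  qed
  have "\<forall>\<^sub>F t in F. \<forall>j\<in>UNIV. \<forall>y\<in>S. dist (A t y *v axis j 1) (A0 y *v axis j 1) < c"
    using uniform_limitD[OF assms c] by (intro eventually_ball_finite) auto
  then show "\<forall>\<^sub>F t in F. \<forall>y\<in>S. dist (A t y) (A0 y) < e"
  proof eventually_elim
    case (elim t)
    have "norm (A t y - A0 y) \<le> real CARD('m) * real CARD('n) * c" if "y \<in> S" for y
      using elim that by (intro matrix_norm_le_columns) (auto simp: dist_norm matrix_vector_mult_diff_rdistrib less_imp_le)
    then show ?case using ce by (auto simp: dist_norm intro: le_less_trans)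
  qed
qed

lemma bounded_image_matrix:
  fixes A :: "'a \<Rightarrow> real^'n^'m"
  assumes "\<And>j. bounded ((\<lambda>y. A y *v axis j 1) ` S)"
  shows "bounded (A ` S)"
proof -
  have "\<exists>B. \<forall>y\<in>S. norm (A y *v axis j 1) \<le> B" for j using assms[of j] by (auto simp: bounded_iff)
  then obtain B where B: "\<And>j y. y \<in> S \<Longrightarrow> norm (A y *v axis j 1) \<le> B j" by metis
  have "norm (A y) \<le> real CARD('m) * real CARD('n) * (\<Sum>j\<in>UNIV. \<bar>B j\<bar>)" if "y \<in> S" for y
  proof (rule matrix_norm_le_columns)
    fix j
    have "B j \<le> \<bar>B j\<bar>" by simp
    also have "\<dots> \<le> (\<Sum>j\<in>UNIV. \<bar>B j\<bar>)" by (rule member_le_sum) auto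
    finally show "norm (A y *v axis j 1) \<le> (\<Sum>j\<in>UNIV. \<bar>B j\<bar>)" using B[OF that, of j] by linarith
  qed
  then show ?thesis unfolding bounded_iff by (intro exI[of _ "real CARD('m) * real CARD('n) * (\<Sum>j\<in>UNIV. \<bar>B j\<bar>)"]) auto
qed

section \<open>Tangential derivatives and extensions\<close>

lemma extends_Ck_differentiable:
  assumes "extends_Ck 1 \<Gamma> f F" "y \<in> \<Gamma>"
  shows "(F has_derivative fderiv F y) (at y)"
  using assms Ck_on_1_has_derivative unfolding extends_Ck_def by blast

lemma C1_extension_extends:
  "f \<in> Ck_boundary 1 \<Gamma> \<Longrightarrow> extends_Ck 1 \<Gamma> f (C1_extension \<Gamma> f)"
  unfolding Ck_boundary_def C1_extension_def mem_Collect_eq by (rule someI_ex[of "extends_Ck 1 \<Gamma> f"])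

lemma extends_Ck_mono: "extends_Ck k \<Gamma> f F \<Longrightarrow> j \<le> k \<Longrightarrow> extends_Ck j \<Gamma> f F"
  unfolding extends_Ck_def using Ck_on_mono by blast

lemma Ck_boundary_mono: "f \<in> Ck_boundary k \<Gamma> \<Longrightarrow> j \<le> k \<Longrightarrow> f \<in> Ck_boundary j \<Gamma>"
  unfolding Ck_boundary_def using extends_Ck_mono by blast

text \<open>Tangent vectors are velocities of curves in \<open>\<Gamma>\<close>, along which the two functions agree.\<close>

lemma tangential_derivative_extension_independent:
  assumes "\<tau> \<in> tangent_space \<Gamma> y"
    and F: "(F has_derivative F') (at y)" and G: "(G has_derivative G') (at y)"
    and eq: "\<And>z. z \<in> \<Gamma> \<Longrightarrow> F z = G z"
  shows "F' \<tau> = G' \<tau>"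
proof -
  obtain \<gamma> \<delta> where c: "\<delta> > 0" "\<gamma> 0 = y" "\<gamma> ` {-\<delta><..<\<delta>} \<subseteq> \<Gamma>"
      "(\<gamma> has_vector_derivative \<tau>) (at (0::real))" using assms(1) unfolding tangent_space_def by blast
  have "((\<lambda>s. F (\<gamma> s)) has_derivative (\<lambda>s. F' (s *\<^sub>R \<tau>))) (at 0)"
    using has_derivative_compose[OF c(4)[unfolded has_vector_derivative_def], of F F'] F c(2) by simp
  moreover have "((\<lambda>s. G (\<gamma> s)) has_derivative (\<lambda>s. G' (s *\<^sub>R \<tau>))) (at 0)"
    using has_derivative_compose[OF c(4)[unfolded has_vector_derivative_def], of G G'] G c(2) by simp
  then have "((\<lambda>s. F (\<gamma> s)) has_derivative (\<lambda>s. G' (s *\<^sub>R \<tau>))) (at 0)"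
  proof (rule has_derivative_transform_within_open[of _ _ _ _ "{-\<delta><..<\<delta>}"])
    show "G (\<gamma> s) = F (\<gamma> s)" if "s \<in> {-\<delta><..<\<delta>}" for s
    proof -
      have "\<gamma> s \<in> \<Gamma>" using c(3) that by blast
      then show ?thesis using eq by simp
    qed
  qed (use c(1) in auto)
  ultimately have "(\<lambda>s. F' (s *\<^sub>R \<tau>)) = (\<lambda>s. G' (s *\<^sub>R \<tau>))" by (rule has_derivative_unique)
  from fun_cong[OF this, of 1] show ?thesis by simp
qed

definition tangential_part :: "'a::real_inner \<Rightarrow> 'a \<Rightarrow> 'a" where
  "tangential_part n e = e - (n \<bullet> e) *\<^sub>R n"

lemma inner_tangential_part: "norm n = 1 \<Longrightarrow> n \<bullet> tangential_part n e = 0"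
  by (simp add: tangential_part_def inner_diff_right dot_square_norm)

lemma tangential_part_tangent: "n \<bullet> \<tau> = 0 \<Longrightarrow> tangential_part n \<tau> = \<tau>"
  by (simp add: tangential_part_def)

lemma linear_tangential_part: "linear (tangential_part n)"
  by (rule linearI) (simp_all add: tangential_part_def algebra_simps)

lemma tangential_part_in_tangent_space:
  "C1_boundary \<Gamma> \<Longrightarrow> y \<in> \<Gamma> \<Longrightarrow> tangential_part (outward_normal \<Gamma> y) e \<in> tangent_space \<Gamma> y"
  using C1_boundary_normal(2,3)[of \<Gamma> y] by (simp add: inner_tangential_part)

lemma tan_deriv_eq:
  assumes "C1_boundary \<Gamma>" "y \<in> \<Gamma>" "f \<in> Ck_boundary 1 \<Gamma>"
    "(F has_derivative F') (at y)" "\<And>z. z \<in> \<Gamma> \<Longrightarrow> F z = f z"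
  shows "tan_deriv \<Gamma> f e y = F' (tangential_part (outward_normal \<Gamma> y) e)"
proof -
  note ext = C1_extension_extends[OF assms(3)]
  have "C1_extension \<Gamma> f z = F z" if "z \<in> \<Gamma>" for z using ext that assms(5) by (simp add: extends_Ck_def)
  from tangential_derivative_extension_independent[OF tangential_part_in_tangent_space[OF assms(1,2)]
     extends_Ck_differentiable[OF ext assms(2)] assms(4) this]
  show ?thesis by (simp add: tan_deriv_def Let_def tangential_part_def)
qed

lemma tan_deriv_extends:
  assumes "C1_boundary \<Gamma>" "y \<in> \<Gamma>" "extends_Ck 1 \<Gamma> f F"
  shows "tan_deriv \<Gamma> f e y = fderiv F y (tangential_part (outward_normal \<Gamma> y) e)"
  by (rule tan_deriv_eq[OF assms(1,2) _ extends_Ck_differentiable[OF assms(3,2)]])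
    (use assms in \<open>auto simp: Ck_boundary_def extends_Ck_def\<close>)

lemma tan_deriv_tangential_part:
  assumes "C1_boundary \<Gamma>" "y \<in> \<Gamma>" "f \<in> Ck_boundary 1 \<Gamma>"
  shows "tan_deriv \<Gamma> f (tangential_part (outward_normal \<Gamma> y) e) y = tan_deriv \<Gamma> f e y"
  unfolding tan_deriv_extends[OF assms(1,2) C1_extension_extends[OF assms(3)]]
  using C1_boundary_normal(2)[OF assms(1,2)]
  by (simp add: inner_tangential_part tangential_part_tangent)

lemma tan_jacobian_mult:
  assumes "y \<in> \<Gamma>" "w \<in> Ck_boundary 1 \<Gamma>"
  shows "tan_jacobian \<Gamma> w y *v e = tan_deriv \<Gamma> w e y"
proof -
  define W where "W = fderiv (C1_extension \<Gamma> w) y"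
  have lin: "linear W" using has_derivative_linear[OF extends_Ck_differentiable[OF C1_extension_extends[OF assms(2)] assms(1)]]
    by (simp add: W_def)
  have "matrix W *v e = W e" for e using lin by (simp add: matrix_works linear_matrix_vector_mul_eq)
  then show ?thesis
    by (simp add: tan_jacobian_def tan_deriv_def Let_def jacobian_def W_def[symmetric] matrix_vector_mult_diff_rdistrib
        outer_mult_vec linear_diff[OF lin] linear_scale[OF lin])
qed

lemma tan_grad_inner:
  fixes f :: "real^'n \<Rightarrow> real"
  assumes "y \<in> \<Gamma>" "f \<in> Ck_boundary 1 \<Gamma>"
  shows "tan_grad \<Gamma> f y \<bullet> e = tan_deriv \<Gamma> f e y"
proof -
  define F where "F = fderiv (C1_extension \<Gamma> f) y"
  define g where "g = (\<chi> i. F (axis i 1))"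
  define n where "n = outward_normal \<Gamma> y"
  have lin: "linear F" using has_derivative_linear[OF extends_Ck_differentiable[OF C1_extension_extends[OF assms(2)] assms(1)]]
    by (simp add: F_def)
  have expand: "F v = (\<Sum>i\<in>UNIV. (v $ i) * F (axis i 1))" for v
  proof -
    have "v = (\<Sum>i\<in>UNIV. (v $ i) *\<^sub>R axis i 1)" using basis_expansion[of v] by (simp add: scalar_mult_eq_scaleR)
    then have "F v = F (\<Sum>i\<in>UNIV. (v $ i) *\<^sub>R axis i 1)" by (rule arg_cong)
    then show ?thesis using lin by (simp add: linear_sum linear_scale)
  qed
  have g: "g \<bullet> v = F v" for v
    unfolding expand[of v] by (simp add: g_def inner_vec_def mult.commute)
  have "tan_grad \<Gamma> f y \<bullet> e = (g - (n \<bullet> g) *\<^sub>R n) \<bullet> e"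
    by (simp add: tan_grad_def Let_def F_def[symmetric] n_def[symmetric] g_def[symmetric]
        matrix_vector_mult_diff_rdistrib outer_mult_vec)
  also have "\<dots> = g \<bullet> (e - (n \<bullet> e) *\<^sub>R n)" by (simp add: inner_diff_left inner_diff_right inner_commute mult.commute)
  finally show ?thesis by (simp add: g tan_deriv_def Let_def F_def n_def)
qed

lemma trace_outer: "trace (outer a b) = a \<bullet> b"
  by (simp add: trace_def outer_def inner_vec_def)

lemma tan_div_eq_trace: "tan_div \<Gamma> w y = trace (tan_jacobian \<Gamma> w y)"
  by (simp add: tan_div_def tan_jacobian_def Let_def trace_sub trace_outer)

lemma continuous_on_frechet_apply:
  fixes F :: "'a::euclidean_space \<Rightarrow> 'b::real_normed_vector"
  assumes "Ck_on 1 F U" "S \<subseteq> U" "continuous_on S u"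
  shows "continuous_on S (\<lambda>y. fderiv F y (u y))"
proof -
  have "continuous_on S (\<lambda>y. \<Sum>b\<in>Basis. (u y \<bullet> b) *\<^sub>R fderiv F y b)"
    using assms by (intro continuous_intros) (auto intro: continuous_on_subset)
  moreover have "fderiv F y (u y) = (\<Sum>b\<in>Basis. (u y \<bullet> b) *\<^sub>R fderiv F y b)" if "y \<in> S" for y
    using linear_Basis_expansion[OF has_derivative_linear[OF Ck_on_1_has_derivative[OF assms(1)]], of y] that assms(2) by blast
  ultimately show ?thesis by (auto cong: continuous_on_cong)
qed

lemma continuous_on_tan_deriv:
  assumes "C1_boundary \<Gamma>" "f \<in> Ck_boundary 1 \<Gamma>"
  shows "continuous_on \<Gamma> (tan_deriv \<Gamma> f e)"
proof -
  obtain F where F: "extends_Ck 1 \<Gamma> f F" using assms(2) by (auto simp: Ck_boundary_def)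
  then obtain U where U: "\<Gamma> \<subseteq> U" "Ck_on 1 F U" by (auto simp: extends_Ck_def)
  have "continuous_on \<Gamma> (\<lambda>y. fderiv F y (tangential_part (outward_normal \<Gamma> y) e))"
    unfolding tangential_part_def
    by (intro continuous_on_frechet_apply[OF U(2,1)] continuous_intros C1_boundary_normal(1)[OF assms(1)])
  then show ?thesis using tan_deriv_extends[OF assms(1) _ F] by (auto cong: continuous_on_cong)
qed

lemma Ck_boundary_imp_continuous: "f \<in> Ck_boundary k \<Gamma> \<Longrightarrow> continuous_on \<Gamma> f"
proof -
  assume "f \<in> Ck_boundary k \<Gamma>"
  then obtain F U where F: "\<Gamma> \<subseteq> U" "Ck_on k F U" "\<forall>y\<in>\<Gamma>. F y = f y" by (auto simp: Ck_boundary_def extends_Ck_def)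
  then have "continuous_on \<Gamma> F" using Ck_on_imp_continuous continuous_on_subset by blast
  then show ?thesis using F(3) by (auto cong: continuous_on_cong)
qed

text \<open>Continuous functions on a closed set extend by Tietze's theorem.\<close>

lemma Ck_boundary_0_iff:
  fixes f :: "real^'n \<Rightarrow> 'b::real_inner"
  assumes "compact \<Gamma>"
  shows "f \<in> Ck_boundary 0 \<Gamma> \<longleftrightarrow> continuous_on \<Gamma> f"
proof
  assume "continuous_on \<Gamma> f"
  moreover have "closedin (top_of_set UNIV) \<Gamma>" using assms compact_imp_closed by auto
  ultimately obtain g where "continuous_on UNIV g" "\<And>x. x \<in> \<Gamma> \<Longrightarrow> g x = f x" by (rule Tietze_unbounded) blast
  then show "f \<in> Ck_boundary 0 \<Gamma>" unfolding Ck_boundary_def extends_Ck_def by (auto intro!: exI[of _ g] exI[of _ UNIV])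
qed (rule Ck_boundary_imp_continuous)

lemma Ck_boundaryI:
  assumes "open U" "\<Gamma> \<subseteq> U" "Ck_on k F U" "\<And>y. y \<in> \<Gamma> \<Longrightarrow> F y = f y"
  shows "f \<in> Ck_boundary k \<Gamma>"
  using assms unfolding Ck_boundary_def extends_Ck_def by blast

lemma bounded_image_tan_deriv:
  "C1_boundary \<Gamma> \<Longrightarrow> f \<in> Ck_boundary 1 \<Gamma> \<Longrightarrow> bounded (tan_deriv \<Gamma> f e ` \<Gamma>)"
  using compact_continuous_image[OF continuous_on_tan_deriv C1_boundary_compact] compact_imp_bounded by blast

lemma bounded_image_tan_jacobian:
  assumes "C1_boundary \<Gamma>" "w \<in> Ck_boundary 1 \<Gamma>"
  shows "bounded (tan_jacobian \<Gamma> w ` \<Gamma>)"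
proof (rule bounded_image_matrix)
  fix j
  show "bounded ((\<lambda>y. tan_jacobian \<Gamma> w y *v axis j 1) ` \<Gamma>)"
    using bounded_image_tan_deriv[OF assms, of "axis j 1"] tan_jacobian_mult[OF _ assms(2)]
    by (simp cong: image_cong)
qed

section \<open>Transport of boundaries by diffeomorphisms\<close>

lemma homeomorphism_UNIV_frontier:
  fixes f h :: "'a::heine_borel \<Rightarrow> 'a"
  assumes "homeomorphism UNIV UNIV f h" "open S" "bounded S"
  shows "open (f ` S)" "bounded (f ` S)" "frontier (f ` S) = f ` frontier S"
proof -
  have f: "continuous_on UNIV f" and h: "continuous_on UNIV h" and hf: "\<And>z. h (f z) = z" and fh: "\<And>z. f (h z) = z"
    using assms(1) by (auto simp: homeomorphism_def)
  have "f ` S = h -` S" using hf fh by (auto simp: image_iff) (metis fh)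
  then show o: "open (f ` S)" using open_vimage[OF assms(2) h] by simp
  have cp: "compact (f ` closure S)" using assms(3) f
    by (intro compact_continuous_image) (auto intro: continuous_on_subset)
  then show "bounded (f ` S)" using compact_imp_bounded bounded_subset closure_subset by (metis image_mono)
  have "closure (f ` S) \<subseteq> f ` closure S"
    by (rule closure_minimal) (use cp compact_imp_closed closure_subset in \<open>auto intro: image_mono\<close>)
  moreover have "f ` closure S \<subseteq> closure (f ` S)"
    by (rule image_closure_subset[OF continuous_on_subset[OF f subset_UNIV] closed_closure closure_subset])
  ultimately have "closure (f ` S) = f ` closure S" by auto
  moreover have "inj f" using hf by (metis injI)
  ultimately show "frontier (f ` S) = f ` frontier S"
    using assms(2) o by (simp add: frontier_def interior_open image_set_diff)
qed

text \<open>Charts of the image are obtained by composing with \<open>f\<close> and its inverse \<open>h\<close>.\<close>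

lemma C1_boundary_image:
  fixes f h :: "real^'n \<Rightarrow> real^'n"
  assumes "C1_boundary \<Gamma>" "homeomorphism UNIV UNIV f h" "Ck_on 1 f UNIV" "Ck_on 1 h UNIV"
  shows "C1_boundary (f ` \<Gamma>)"
proof -
  obtain \<Omega> where dom: "Ck_domain 1 \<Omega>" and fr: "frontier \<Omega> = \<Gamma>" using assms(1) by (auto simp: C1_boundary_def)
  have ob: "open \<Omega>" "bounded \<Omega>" using dom by (auto simp: Ck_domain_def)
  note im = homeomorphism_UNIV_frontier[OF assms(2) ob]
  have hf: "h (f z) = z" and fh: "f (h z) = z" for z using assms(2) by (auto simp: homeomorphism_def)
  have inj: "inj f" using hf by (metis injI)
  have "Ck_domain 1 (f ` \<Omega>)" unfolding Ck_domain_def im(3)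
  proof (intro conjI ballI)
    fix p assume "p \<in> f ` frontier \<Omega>"
    then obtain q where q: "q \<in> frontier \<Omega>" "p = f q" by blast
    obtain U W :: "(real^'n) set" and g k i where ch: "open U" "q \<in> U" "open W" "homeomorphism U W g k" "Ck_on 1 g U" "Ck_on 1 k W"
      "g ` (U \<inter> \<Omega>) = {y\<in>W. y $ i < 0}" "g ` (U \<inter> frontier \<Omega>) = {y\<in>W. y $ i = 0}"
      using dom q(1) unfolding Ck_domain_def by blast
    have oU: "open (f ` U)"
    proof -
      have "f ` U = h -` U" using hf fh by (auto simp: image_iff) (metis fh)
      then show ?thesis using open_vimage[OF ch(1), of h] assms(2) by (simp add: homeomorphism_def)
    qed
    have fU: "homeomorphism (f ` U) U h f"
      using homeomorphism_sym[THEN iffD1, OF homeomorphism_of_subsets[OF assms(2), of U "f ` U"]] by auto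
    have "homeomorphism (f ` U) W (g \<circ> h) (f \<circ> k)" using homeomorphism_compose[OF fU ch(4)] .
    moreover have "Ck_on 1 (g \<circ> h) (f ` U)"
      unfolding o_def using hf by (intro Ck_on_1_compose[OF oU Ck_on_subset[OF assms(4)] ch(1) _ ch(5)]) auto
    moreover have "Ck_on 1 (f \<circ> k) W"
      unfolding o_def by (rule Ck_on_1_compose[OF ch(3,6) open_UNIV _ assms(3)]) auto
    moreover have imS: "(g \<circ> h) ` (f ` U \<inter> f ` S) = g ` (U \<inter> S)" for S
      using inj by (simp add: image_Int[symmetric] image_image hf)
    have "(g \<circ> h) ` (f ` U \<inter> f ` \<Omega>) = {y\<in>W. y $ i < 0}" "(g \<circ> h) ` (f ` U \<inter> f ` frontier \<Omega>) = {y\<in>W. y $ i = 0}"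
      unfolding imS by (rule ch(7,8))+
    moreover have "p \<in> f ` U" using ch(2) q(2) by blast
    ultimately show "\<exists>(U :: (real^'n) set) (W :: (real^'n) set) g h i.
        open U \<and> p \<in> U \<and> open W \<and> homeomorphism U W g h \<and> Ck_on 1 g U \<and> Ck_on 1 h W \<and>
        g ` (U \<inter> f ` \<Omega>) = {y\<in>W. y $ i < 0} \<and> g ` (U \<inter> f ` frontier \<Omega>) = {y\<in>W. y $ i = 0}"
      using ch(3) oU by (intro exI[of _ "f ` U"] exI[of _ W] exI[of _ "g \<circ> h"] exI[of _ "f \<circ> k"] exI[of _ i] conjI)
  qed (use im in auto)
  then show ?thesis using im(3) fr unfolding C1_boundary_def by blast
qed

lemma tangent_space_image:
  assumes "\<tau> \<in> tangent_space \<Gamma> y" "(f has_derivative f') (at y)"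
  shows "f' \<tau> \<in> tangent_space (f ` \<Gamma>) (f y)"
proof -
  obtain \<gamma> \<delta> where c: "\<delta> > 0" "\<gamma> 0 = y" "\<gamma> ` {-\<delta><..<\<delta>} \<subseteq> \<Gamma>"
      "(\<gamma> has_vector_derivative \<tau>) (at (0::real))" using assms(1) unfolding tangent_space_def by blast
  have "((\<lambda>s. f (\<gamma> s)) has_vector_derivative f' \<tau>) (at 0)"
    using has_derivative_compose[OF c(4)[unfolded has_vector_derivative_def], of f f'] assms(2) c(2)
      linear_scale[OF has_derivative_linear[OF assms(2)]] by (simp add: has_vector_derivative_def)
  moreover have "(\<lambda>s. f (\<gamma> s)) ` {-\<delta><..<\<delta>} \<subseteq> f ` \<Gamma>" using c(3) by auto
  ultimately show ?thesis unfolding tangent_space_def using c(1,2)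
    by (intro CollectI exI[of _ "\<lambda>s. f (\<gamma> s)"] exI[of _ \<delta>]) auto
qed

text \<open>If \<open>K\<close> is the inverse Jacobian of a diffeomorphism \<open>f\<close> and \<open>n\<close> a normal of \<open>\<Gamma>\<close>, then \<open>m\<close> is a
normal of \<open>f(\<Gamma>)\<close>. So this tensor projects onto the tangent space of \<open>f(\<Gamma>)\<close> and then pulls the result
back to the tangent space of \<open>\<Gamma>\<close>.\<close>

definition transported_projection :: "real^'n^'n \<Rightarrow> real^'n \<Rightarrow> real^'n^'n" where
  "transported_projection K n = (let m = transpose K *v n in
     K ** (mat 1 - inverse (m \<bullet> m) *\<^sub>R outer m m))"

text \<open>If \<open>E\<close> extends \<open>u\<close>, then \<open>E \<circ> h\<close> extends \<open>w\<close>, and the chain rule applies to the tangential part of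
each direction. The tangent spaces of \<open>\<Gamma>\<close> and of its image correspond under the derivative of \<open>f\<close>,
which identifies the normal of the image up to a factor; the factor disappears in the projection.\<close>

lemma tan_jacobian_transport:
  fixes f h :: "real^'n \<Rightarrow> real^'n"
  assumes C1: "C1_boundary \<Gamma>" and hom: "homeomorphism UNIV UNIV f h" and fh1: "Ck_on 1 f UNIV" "Ck_on 1 h UNIV"
    and u: "u \<in> Ck_boundary 1 \<Gamma>" and w: "\<And>z. z \<in> \<Gamma> \<Longrightarrow> w (f z) = u z"
  shows "w \<in> Ck_boundary 1 (f ` \<Gamma>)"
    and "y \<in> \<Gamma> \<Longrightarrow> tan_jacobian (f ` \<Gamma>) w (f y) =
      tan_jacobian \<Gamma> u y ** transported_projection (matrix (fderiv h (f y))) (outward_normal \<Gamma> y)"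
proof -
  have hf: "h (f z) = z" for z using hom by (auto simp: homeomorphism_def)
  obtain E B where E: "open B" "\<Gamma> \<subseteq> B" "Ck_on 1 E B" "\<And>z. z \<in> \<Gamma> \<Longrightarrow> E z = u z"
    using u by (auto simp: Ck_boundary_def extends_Ck_def)
  have oO: "open (h -` B)" using open_vimage[OF E(1), of h] hom by (simp add: homeomorphism_def)
  have CE: "Ck_on 1 (\<lambda>z. E (h z)) (h -` B)"
    by (rule Ck_on_1_compose[OF oO Ck_on_subset[OF fh1(2)] E(1) _ E(3)]) auto
  have ext: "E (h z) = w z" if "z \<in> f ` \<Gamma>" for z using that hf E(4) w by auto
  show wC: "w \<in> Ck_boundary 1 (f ` \<Gamma>)"
    by (rule Ck_boundaryI[OF oO _ CE ext]) (use E(2) hf in auto)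
  note C1' = C1_boundary_image[OF C1 hom fh1]
  assume y: "y \<in> \<Gamma>"
  define J K n n' where "J = fderiv f y" and "K = fderiv h (f y)"
    and "n = outward_normal \<Gamma> y" and "n' = outward_normal (f ` \<Gamma>) (f y)"
  have fy: "f y \<in> f ` \<Gamma>" using y by simp
  have KJ: "K (J e) = e" and JK: "J (K e) = e" for e
    using chart_derivative_inverse[OF open_UNIV open_UNIV hom fh1 UNIV_I] by (simp_all add: J_def K_def)
  have Jd: "(f has_derivative J) (at y)" using Ck_on_1_has_derivative[OF fh1(1)] by (simp add: J_def)
  have Kd: "(h has_derivative K) (at (f y))" using Ck_on_1_has_derivative[OF fh1(2)] by (simp add: K_def)
  have linK: "linear K" using has_derivative_linear[OF Kd] .
  define m where "m = transpose (matrix K) *v n"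
  have mK: "m \<bullet> e = n \<bullet> K e" for e
    using linK by (simp add: m_def dot_lmul_matrix matrix_works linear_matrix_vector_mul_eq)
  note nor = C1_boundary_normal(2,3)[OF C1 y, folded n_def]
  note nor' = C1_boundary_normal(2,3)[OF C1' fy, folded n'_def]
  have mJ: "m \<bullet> J n = 1" using nor(1) by (simp add: mK KJ dot_square_norm)
  then have m0: "m \<noteq> 0" by auto
  (* the pullback of a vector orthogonal to m is tangent to the original boundary *)
  have "n' \<bullet> \<tau> = 0" if "m \<bullet> \<tau> = 0" for \<tau>
  proof -
    have "K \<tau> \<in> tangent_space \<Gamma> y" using that nor(2) by (simp add: mK)
    from tangent_space_image[OF this Jd] show ?thesis using nor'(2) by (simp add: JK)
  qed
  from same_orthogonal_complement[OF m0 this] obtain c where c: "n' = c *\<^sub>R m" by blast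
  have "c * c * (m \<bullet> m) = 1" using nor'(1) unfolding c
    by (metis c dot_square_norm inner_scaleR_left inner_scaleR_right mult.assoc power_one)
  then have cc: "c * c = inverse (m \<bullet> m)" using m0 by (simp add: field_simps)
  have tp: "tangential_part n' e = (mat 1 - inverse (m \<bullet> m) *\<^sub>R outer m m) *v e" for e
    by (simp add: tangential_part_def c matrix_vector_mult_diff_rdistrib scaleR_matrix_vector_assoc[symmetric]
        outer_mult_vec cc[symmetric] mult_ac)
  have proj: "transported_projection (matrix K) n *v e = K (tangential_part n' e)" for e
    unfolding transported_projection_def Let_def m_def[symmetric] matrix_vector_mul_assoc[symmetric] tp[symmetric]
    using linK by (simp add: matrix_works linear_matrix_vector_mul_eq)
  have "tan_jacobian (f ` \<Gamma>) w (f y) *v e =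
      (tan_jacobian \<Gamma> u y ** transported_projection (matrix K) n) *v e" for e
  proof -
    have Ed: "(E has_derivative fderiv E y) (at y)" using Ck_on_1_has_derivative[OF E(3)] E(2) y by blast
    have "((\<lambda>z. E (h z)) has_derivative (\<lambda>e. fderiv E y (K e))) (at (f y))"
      by (rule has_derivative_compose[OF Kd]) (simp add: hf Ed)
    from tan_deriv_eq[OF C1' fy wC this ext, of e]
    have "tan_deriv (f ` \<Gamma>) w e (f y) = fderiv E y (K (tangential_part n' e))" by (simp add: n'_def)
    also have "\<dots> = tan_deriv \<Gamma> u (K (tangential_part n' e)) y"
    proof -
      have "tangential_part n' e \<in> tangent_space (f ` \<Gamma>) (f y)"
        using tangential_part_in_tangent_space[OF C1' fy] by (simp add: n'_def)
      from tangent_space_image[OF this Kd] have "n \<bullet> K (tangential_part n' e) = 0"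
        using nor(2) by (simp add: image_image hf)
      then show ?thesis
        using tan_deriv_eq[OF C1 y u Ed E(4), of "K (tangential_part n' e)"]
        by (simp add: n_def[symmetric] tangential_part_tangent)
    qed
    finally show ?thesis
      using tan_jacobian_mult[OF fy wC, of e] tan_jacobian_mult[OF y u, of "K (tangential_part n' e)"]
      by (simp add: proj matrix_vector_mul_assoc[symmetric])
  qed
  then show "tan_jacobian (f ` \<Gamma>) w (f y) =
      tan_jacobian \<Gamma> u y ** transported_projection (matrix (fderiv h (f y))) (outward_normal \<Gamma> y)"
    unfolding matrix_eq by (simp add: K_def n_def)
qed

section \<open>The material derivative of the tangential Jacobian\<close>

lemma C1_extension_cong: "(\<And>y. y \<in> \<Gamma> \<Longrightarrow> f y = g y) \<Longrightarrow> C1_extension \<Gamma> f = C1_extension \<Gamma> g"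
  by (simp add: C1_extension_def extends_Ck_def)

lemma tan_jacobian_cong: "(\<And>y. y \<in> \<Gamma> \<Longrightarrow> f y = g y) \<Longrightarrow> tan_jacobian \<Gamma> f = tan_jacobian \<Gamma> g"
  using C1_extension_cong[of \<Gamma> f g] by (simp add: tan_jacobian_def[abs_def])

lemma Ck_boundary_add_scaleR:
  assumes "f \<in> Ck_boundary k \<Gamma>" "g \<in> Ck_boundary k \<Gamma>"
  shows "(\<lambda>y. f y + c *\<^sub>R g y) \<in> Ck_boundary k \<Gamma>"
proof -
  obtain F U where F: "open U" "\<Gamma> \<subseteq> U" "Ck_on k F U" "\<And>y. y \<in> \<Gamma> \<Longrightarrow> F y = f y" using assms(1) by (auto simp: Ck_boundary_def extends_Ck_def)
  obtain G U' where G: "open U'" "\<Gamma> \<subseteq> U'" "Ck_on k G U'" "\<And>y. y \<in> \<Gamma> \<Longrightarrow> G y = g y" using assms(2) by (auto simp: Ck_boundary_def extends_Ck_def)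
  have "open (U \<inter> U')" using F G by auto
  then have "Ck_on k (\<lambda>y. F y + c *\<^sub>R G y) (U \<inter> U')"
    using Ck_on_subset[OF F(3)] Ck_on_subset[OF G(3)]
    by (intro Ck_on_add Ck_on_bounded_linear[OF bounded_linear_scaleR_right]) auto
  then show ?thesis using F G by (intro Ck_boundaryI[of "U \<inter> U'" _ _ "\<lambda>y. F y + c *\<^sub>R G y"]) auto
qed

lemma tan_deriv_add_scaleR:
  assumes "C1_boundary \<Gamma>" "y \<in> \<Gamma>" "f \<in> Ck_boundary 1 \<Gamma>" "g \<in> Ck_boundary 1 \<Gamma>"
  shows "tan_deriv \<Gamma> (\<lambda>y. f y + c *\<^sub>R g y) e y = tan_deriv \<Gamma> f e y + c *\<^sub>R tan_deriv \<Gamma> g e y"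
proof -
  obtain F G where FG: "extends_Ck 1 \<Gamma> f F" "extends_Ck 1 \<Gamma> g G" using assms(3,4) by (auto simp: Ck_boundary_def)
  have "((\<lambda>y. F y + c *\<^sub>R G y) has_derivative (\<lambda>e. fderiv F y e + c *\<^sub>R fderiv G y e)) (at y)"
    by (intro has_derivative_add has_derivative_scaleR_right extends_Ck_differentiable[OF FG(1) assms(2)] extends_Ck_differentiable[OF FG(2) assms(2)])
  from tan_deriv_eq[OF assms(1,2) Ck_boundary_add_scaleR[OF assms(3,4)] this]
  show ?thesis using FG tan_deriv_extends[OF assms(1,2) FG(1)] tan_deriv_extends[OF assms(1,2) FG(2)] by (simp add: extends_Ck_def)
qed

lemma tan_jacobian_add_scaleR:
  assumes "C1_boundary \<Gamma>" "y \<in> \<Gamma>" "f \<in> Ck_boundary 1 \<Gamma>" "g \<in> Ck_boundary 1 \<Gamma>"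
  shows "tan_jacobian \<Gamma> (\<lambda>y. f y + c *\<^sub>R g y) y = tan_jacobian \<Gamma> f y + c *\<^sub>R tan_jacobian \<Gamma> g y"
  unfolding matrix_eq
  using assms by (simp add: tan_jacobian_mult Ck_boundary_add_scaleR tan_deriv_add_scaleR matrix_vector_mult_add_rdistrib
      scaleR_matrix_vector_assoc[symmetric])

definition tangential_projection :: "real^'n \<Rightarrow> real^'n^'n" where
  "tangential_projection n = mat 1 - outer n n"

text \<open>The derivative of \<open>transported_projection (K t) n\<close> at a time when \<open>K\<close> is the identity and has
derivative \<open>- A\<close>.\<close>

definition transported_projection_rate :: "real^'n^'n \<Rightarrow> real^'n \<Rightarrow> real^'n^'n" where
  "transported_projection_rate A n = (let g = transpose A *v n in
     (outer g n + outer n g - (2 * (g \<bullet> n)) *\<^sub>R outer n n) - A ** tangential_projection n)"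

lemma tangential_projection_mult: "tangential_projection n *v e = tangential_part n e"
  by (simp add: tangential_projection_def tangential_part_def matrix_vector_mult_diff_rdistrib outer_mult_vec)

lemma has_uniform_derivative_transported_projection:
  fixes K J :: "real \<Rightarrow> 'a \<Rightarrow> real^'n^'n" and n :: "'a \<Rightarrow> real^'n"
  assumes J: "has_uniform_derivative S J (\<lambda>y. mat 1) A"
    and KJ: "\<forall>\<^sub>F t in at_right 0. \<forall>y\<in>S. K t y ** J t y = mat 1"
    and n: "\<And>y. y \<in> S \<Longrightarrow> norm (n y) = 1"
  shows "has_uniform_derivative S (\<lambda>t y. transported_projection (K t y) (n y))
    (\<lambda>y. tangential_projection (n y)) (\<lambda>y. transported_projection_rate (A y) (n y))"
proof -
  have K: "has_uniform_derivative S K (\<lambda>y. mat 1) (\<lambda>y. - A y)"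
    by (rule has_uniform_derivative_inverse[OF bounded_bilinear_matrix_matrix _ _ J KJ]) simp_all
  have bn: "bounded (n ` S)" using n by (auto simp: bounded_iff)
  define m where "m t y = transpose (K t y) *v n y" for t y
  define g where "g y = transpose (A y) *v n y" for y
  have "has_uniform_derivative S (\<lambda>t y. transpose (K t y) *v n y) (\<lambda>y. transpose (mat 1) *v n y)
     (\<lambda>y. transpose (- A y) *v n y + transpose (mat 1) *v 0)"
    by (intro has_uniform_derivative_bilinear[OF bounded_bilinear_matrix_vector]
        has_uniform_derivative_bounded_linear[OF bounded_linear_transpose] K has_uniform_derivative_const bn)
  moreover have "transpose (- A y) *v n y = - g y" for y
    by (simp add: g_def transpose_def vec_eq_iff matrix_vector_mult_def sum_negf)
  ultimately have m: "has_uniform_derivative S m n (\<lambda>y. - g y)"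
    by (elim has_uniform_derivative_cong) (auto simp: m_def)
  have "has_uniform_derivative S (\<lambda>t y. m t y \<bullet> m t y) (\<lambda>y. n y \<bullet> n y) (\<lambda>y. - g y \<bullet> n y + n y \<bullet> - g y)"
    by (intro has_uniform_derivative_bilinear[OF bounded_bilinear_inner] m)
  then have mm: "has_uniform_derivative S (\<lambda>t y. m t y \<bullet> m t y) (\<lambda>y. 1) (\<lambda>y. - (2 * (g y \<bullet> n y)))"
    by (rule has_uniform_derivative_cong) (auto simp: n dot_square_norm inner_commute)
  have "\<forall>\<^sub>F t in at_right 0. \<forall>y\<in>S. dist (m t y \<bullet> m t y) 1 < 1"
    using uniform_limitD[OF has_uniform_derivative_limit[OF mm], of 1] by simp
  then have "\<forall>\<^sub>F t in at_right 0. \<forall>y\<in>S. inverse (m t y \<bullet> m t y) * (m t y \<bullet> m t y) = 1"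
  proof eventually_elim
    case (elim t)
    have "inverse r * r = 1" if "dist r 1 < 1" for r :: real using that by (cases "r = 0") auto
    then show ?case using elim by blast
  qed
  then have im: "has_uniform_derivative S (\<lambda>t y. inverse (m t y \<bullet> m t y)) (\<lambda>y. 1) (\<lambda>y. - (- (2 * (g y \<bullet> n y))))"
    by (intro has_uniform_derivative_inverse[OF bounded_bilinear_mult _ _ mm]) simp_all
  have o: "has_uniform_derivative S (\<lambda>t y. outer (m t y) (m t y)) (\<lambda>y. outer (n y) (n y)) (\<lambda>y. outer (- g y) (n y) + outer (n y) (- g y))"
    by (intro has_uniform_derivative_bilinear[OF bounded_bilinear_outer] m)
  have c: "has_uniform_derivative S (\<lambda>t y. mat 1 :: real^'n^'n) (\<lambda>y. mat 1) (\<lambda>y. 0)"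
    by (rule has_uniform_derivative_const) (auto simp: bounded_iff)
  have "has_uniform_derivative S (\<lambda>t y. K t y ** (mat 1 - inverse (m t y \<bullet> m t y) *\<^sub>R outer (m t y) (m t y)))
     (\<lambda>y. mat 1 ** (mat 1 - 1 *\<^sub>R outer (n y) (n y)))
     (\<lambda>y. - A y ** (mat 1 - 1 *\<^sub>R outer (n y) (n y)) + mat 1 ** (0 - (- (- (2 * (g y \<bullet> n y))) *\<^sub>R outer (n y) (n y) +
           1 *\<^sub>R (outer (- g y) (n y) + outer (n y) (- g y)))))"
    by (intro has_uniform_derivative_bilinear[OF bounded_bilinear_matrix_matrix] K has_uniform_derivative_diff c
        has_uniform_derivative_bilinear[OF bounded_bilinear_scaleR] im o)
  moreover have "outer (- a) b = - outer a b" "outer a (- b) = - outer a b" for a b :: "real^'n"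
    by (simp_all add: outer_def vec_eq_iff)
  moreover have "- A y ** B = - (A y ** B)" for y B by (simp add: matrix_matrix_mult_def vec_eq_iff sum_negf)
  ultimately show ?thesis
    by (elim has_uniform_derivative_cong)
      (auto simp: transported_projection_def tangential_projection_def transported_projection_rate_def Let_def m_def g_def)
qed

lemma has_uniform_derivative_jacobian_flow:
  fixes x :: "real \<Rightarrow> real^'n \<Rightarrow> real^'n"
  assumes "compact S" and v: "Ck_on 1 v UNIV"
    and x: "\<forall>\<^sub>F t in at_right 0. Ck_on 1 (x t) UNIV"
    and ex: "\<And>\<eta>. \<eta> > 0 \<Longrightarrow> \<exists>\<delta>'>0. \<forall>t\<in>{0..\<delta>'}. \<forall>X e.
       norm (fderiv (x t) X e - e - t *\<^sub>R fderiv v X e) \<le> \<eta> * t * norm e"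
  shows "has_uniform_derivative S (\<lambda>t y. matrix (fderiv (x t) y)) (\<lambda>y. mat 1)
     (\<lambda>y. matrix (fderiv v y))"
  unfolding has_uniform_derivative_def
proof (intro conjI)
  have mv: "matrix (fderiv f y) *v e = fderiv f y e" if "Ck_on 1 f UNIV" for f :: "real^'n \<Rightarrow> real^'n" and y e
    using has_derivative_linear[OF Ck_on_1_has_derivative[OF that UNIV_I]] by (simp add: matrix_works linear_matrix_vector_mul_eq)
  show "bounded ((\<lambda>y. mat 1 :: real^'n^'n) ` S)" by (auto simp: bounded_iff)
  show "bounded ((\<lambda>y. matrix (fderiv v y)) ` S)"
  proof (rule bounded_image_matrix)
    fix j
    have "continuous_on UNIV (\<lambda>y. fderiv v y (axis j 1))" using v by simp
    then have "continuous_on S (\<lambda>y. fderiv v y (axis j 1))" by (rule continuous_on_subset) simp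
    then show "bounded ((\<lambda>y. matrix (fderiv v y) *v axis j 1) ` S)"
      unfolding mv[OF v] using assms(1) compact_continuous_image compact_imp_bounded by blast
  qed
  show "uniform_limit S (\<lambda>t y. (matrix (fderiv (x t) y) - mat 1) /\<^sub>R t) (\<lambda>y. matrix (fderiv v y)) (at_right 0)"
  proof (rule uniform_limit_matrix, rule uniform_limitI)
    fix j and e :: real assume e: "e > 0"
    obtain d where d: "d > 0" "\<And>t X a. t \<in> {0..d} \<Longrightarrow> norm (fderiv (x t) X a - a - t *\<^sub>R fderiv v X a) \<le> (e/2) * t * norm a"
      using ex[of "e/2"] e by auto
    have "\<forall>\<^sub>F t in at_right 0. 0 < t \<and> t < d"
      using d(1) unfolding eventually_at_right_field by blast
    then show "\<forall>\<^sub>F t in at_right 0. \<forall>y\<in>S. dist (((matrix (fderiv (x t) y) - mat 1) /\<^sub>R t) *v axis j 1)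
         (matrix (fderiv v y) *v axis j 1) < e"
      using x
    proof eventually_elim
      case (elim t)
      show ?case
      proof
        fix y
        define q where "q = fderiv (x t) y (axis j 1) - axis j 1 - t *\<^sub>R fderiv v y (axis j 1)"
        have "((matrix (fderiv (x t) y) - mat 1) /\<^sub>R t) *v axis j 1 - matrix (fderiv v y) *v axis j 1
          = q /\<^sub>R t"
          using elim(1) by (simp add: q_def mv[OF v] mv[OF elim(2)] scaleR_matrix_vector_assoc[symmetric] matrix_vector_mult_diff_rdistrib scaleR_diff_right)
        moreover have "norm q \<le> (e/2) * t" using d(2)[of t y "axis j 1"] elim by (simp add: q_def)
        then have "norm (q /\<^sub>R t) \<le> e / 2" using elim by (simp add: field_simps)
        ultimately show "dist (((matrix (fderiv (x t) y) - mat 1) /\<^sub>R t) *v axis j 1)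
         (matrix (fderiv v y) *v axis j 1) < e" using e by (simp add: dist_norm)
      qed
    qed
  qed
qed

lemma velocity_field_0_C1: "velocity_field 2 D \<epsilon> V \<Longrightarrow> 0 < \<epsilon> \<Longrightarrow> Ck_on 1 (V 0) UNIV"
  using Ck_on_mono[of 2 "V 0" UNIV 1] by (auto simp: velocity_field_def Ck_compact_support_def)

lemma flow_eventually_diffeomorphism:
  fixes V x :: "real \<Rightarrow> real^'n \<Rightarrow> real^'n"
  assumes "velocity_field 2 D \<epsilon> V" "trajectories \<epsilon> V x" "0 < \<epsilon>"
  shows "\<forall>\<^sub>F t in at_right 0. homeomorphism UNIV UNIV (x t) (inv (x t)) \<and> Ck_on 1 (x t) UNIV \<and> Ck_on 1 (inv (x t)) UNIV"
proof -
  obtain \<delta> where \<delta>: "0 < \<delta>" "\<And>t. t \<in> {0..\<delta>} \<Longrightarrow> Ck_on 1 (x t) UNIV"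
    "\<And>t X Y. t \<in> {0..\<delta>} \<Longrightarrow> norm (x t X - x t Y - (X - Y)) \<le> norm (X - Y) / 2"
    "\<And>\<eta>. \<eta> > 0 \<Longrightarrow> \<exists>\<delta>'>0. \<forall>t\<in>{0..\<delta>'}. \<forall>X e.
       norm (fderiv (x t) X e - e - t *\<^sub>R fderiv (V 0) X e) \<le> \<eta> * t * norm e"
    by (rule flow_small_time[OF assms]) (rule that)
  have "homeomorphism UNIV UNIV (x t) (inv (x t)) \<and> Ck_on 1 (x t) UNIV \<and> Ck_on 1 (inv (x t)) UNIV" if t: "t \<in> {0..\<delta>}" for t
  proof -
    obtain h where h: "homeomorphism UNIV UNIV (x t) h" "Ck_on 1 h UNIV"
      by (rule near_identity_diffeomorphism[OF \<delta>(2)[OF t] \<delta>(3)[OF t]]) (rule that)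
    then have "inv (x t) = h" by (intro inv_unique_comp) (auto simp: homeomorphism_def fun_eq_iff)
    then show ?thesis using h \<delta>(2)[OF t] by simp
  qed
  then show ?thesis using \<delta>(1) unfolding eventually_at_right_field by (intro exI[of _ \<delta>]) auto
qed

lemma Ck_boundary_limit_1D:
  assumes "Ck_boundary_limit 1 \<Gamma> Q q A"
  shows "\<forall>\<^sub>F t in A. Q t \<in> Ck_boundary 1 \<Gamma>" "q \<in> Ck_boundary 1 \<Gamma>" "uniform_limit \<Gamma> Q q A"
    "uniform_limit \<Gamma> (\<lambda>t. tan_deriv \<Gamma> (Q t) e) (tan_deriv \<Gamma> q e) A"
  using assms by (auto simp: Ck_boundary_limit_def)

text \<open>By \<open>tan_jacobian_transport\<close> the pulled back Jacobian is the product of the tangential Jacobian of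
the pulled back field and of a transported projection, and both factors are uniformly
differentiable in time. For the first one the difference quotient is exactly the tangential Jacobian
of the difference quotient \<open>Q t\<close> of the field.\<close>

lemma material_derivative_tan_jacobian:
  fixes V x :: "real \<Rightarrow> real^'n \<Rightarrow> real^'n"
  assumes C1: "C1_boundary \<Gamma>" and vel: "velocity_field 2 D \<epsilon> V" "trajectories \<epsilon> V x" "0 < \<epsilon>"
    and w0: "w \<Gamma> \<in> Ck_boundary 1 \<Gamma>"
    and lim: "Ck_boundary_limit 1 \<Gamma> (\<lambda>t y. (w (x t ` \<Gamma>) (x t y) - w \<Gamma> y) /\<^sub>R t) wdot (at_right 0)"
  shows "has_uniform_derivative \<Gamma> (\<lambda>t y. tan_jacobian (x t ` \<Gamma>) (w (x t ` \<Gamma>)) (x t y)) (tan_jacobian \<Gamma> (w \<Gamma>))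
     (\<lambda>y. tan_jacobian \<Gamma> wdot y ** tangential_projection (outward_normal \<Gamma> y) +
          tan_jacobian \<Gamma> (w \<Gamma>) y ** transported_projection_rate (matrix (fderiv (V 0) y)) (outward_normal \<Gamma> y))"
    and "\<forall>\<^sub>F t in at_right 0. continuous_on \<Gamma> (\<lambda>y. tan_jacobian (x t ` \<Gamma>) (w (x t ` \<Gamma>)) (x t y) *v e)"
proof -
  define Q where "Q = (\<lambda>t y. (w (x t ` \<Gamma>) (x t y) - w \<Gamma> y) /\<^sub>R t)"
  note Q = Ck_boundary_limit_1D[OF lim[folded Q_def]]
  define u where "u t y = w \<Gamma> y + t *\<^sub>R Q t y" for t y
  define K where "K t y = matrix (fderiv (inv (x t)) (x t y))" for t y
  define J where "J t y = matrix (fderiv (x t) y)" for t y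
  note diff = flow_eventually_diffeomorphism[OF vel]
  have uC: "\<forall>\<^sub>F t in at_right 0. u t \<in> Ck_boundary 1 \<Gamma>"
    using Q(1) unfolding u_def[abs_def] by eventually_elim (rule Ck_boundary_add_scaleR[OF w0])
  have uw: "w (x t ` \<Gamma>) (x t z) = u t z" if "t > 0" for t z using that by (simp add: u_def Q_def)
  have pos: "\<forall>\<^sub>F t in at_right 0. (0::real) < t" by (rule eventually_at_right_less)
  have Ju: "has_uniform_derivative \<Gamma> J (\<lambda>y. mat 1) (\<lambda>y. matrix (fderiv (V 0) y))"
    unfolding J_def[abs_def]
  proof (rule has_uniform_derivative_jacobian_flow[OF C1_boundary_compact[OF C1] velocity_field_0_C1[OF vel(1,3)]])
    show "\<forall>\<^sub>F t in at_right 0. Ck_on 1 (x t) UNIV" using diff by eventually_elim blast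
    show "\<exists>\<delta>'>0. \<forall>t\<in>{0..\<delta>'}. \<forall>X e. norm (fderiv (x t) X e - e - t *\<^sub>R fderiv (V 0) X e) \<le> \<eta> * t * norm e"
      if "\<eta> > 0" for \<eta>
      by (rule flow_small_time[OF vel]) (use that in blast)
  qed
  have KJ: "\<forall>\<^sub>F t in at_right 0. \<forall>y\<in>\<Gamma>. K t y ** J t y = mat 1"
    using diff
  proof eventually_elim
    case (elim t)
    have "K t y ** J t y = mat 1" for y
      unfolding matrix_eq
    proof
      fix e
      have "linear (fderiv (x t) y)" "linear (fderiv (inv (x t)) (x t y))"
        using elim has_derivative_linear[OF Ck_on_1_has_derivative] by blast+
      then show "(K t y ** J t y) *v e = mat 1 *v e"
        using chart_derivative_inverse(1)[of UNIV UNIV "x t" "inv (x t)" y e] elim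
        by (simp add: K_def J_def matrix_vector_mul_assoc[symmetric] matrix_works linear_matrix_vector_mul_eq)
    qed
    then show ?case by blast
  qed
  have Au: "has_uniform_derivative \<Gamma> (\<lambda>t. tan_jacobian \<Gamma> (u t)) (tan_jacobian \<Gamma> (w \<Gamma>)) (tan_jacobian \<Gamma> wdot)"
    unfolding has_uniform_derivative_def
  proof (intro conjI bounded_image_tan_jacobian[OF C1] w0 Q(2))
    have "uniform_limit \<Gamma> (\<lambda>t. tan_jacobian \<Gamma> (Q t)) (tan_jacobian \<Gamma> wdot) (at_right 0)"
    proof (rule uniform_limit_matrix)
      fix j
      have "\<forall>\<^sub>F t in at_right 0. \<forall>y\<in>\<Gamma>. tan_deriv \<Gamma> (Q t) (axis j 1) y = tan_jacobian \<Gamma> (Q t) y *v axis j 1"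
        using Q(1) by eventually_elim (simp add: tan_jacobian_mult)
      from uniform_limit_cong[OF this, of "tan_deriv \<Gamma> wdot (axis j 1)" "\<lambda>y. tan_jacobian \<Gamma> wdot y *v axis j 1"]
      show "uniform_limit \<Gamma> (\<lambda>t y. tan_jacobian \<Gamma> (Q t) y *v axis j 1) (\<lambda>y. tan_jacobian \<Gamma> wdot y *v axis j 1) (at_right 0)"
        using Q(4)[of "axis j 1"] tan_jacobian_mult[OF _ Q(2)] by simp
    qed
    moreover have "\<forall>\<^sub>F t in at_right 0. \<forall>y\<in>\<Gamma>. tan_jacobian \<Gamma> (Q t) y = (tan_jacobian \<Gamma> (u t) y - tan_jacobian \<Gamma> (w \<Gamma>) y) /\<^sub>R t"
      using Q(1) pos
    proof eventually_elim
      case (elim t)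
      then show ?case using tan_jacobian_add_scaleR[OF C1 _ w0 elim(1), of _ t] by (simp add: u_def[abs_def])
    qed
    from uniform_limit_cong[OF this, of "tan_jacobian \<Gamma> wdot" "tan_jacobian \<Gamma> wdot"] have "uniform_limit \<Gamma> (\<lambda>t. tan_jacobian \<Gamma> (Q t)) (tan_jacobian \<Gamma> wdot) (at_right 0) \<longleftrightarrow>
      uniform_limit \<Gamma> (\<lambda>t y. (tan_jacobian \<Gamma> (u t) y - tan_jacobian \<Gamma> (w \<Gamma>) y) /\<^sub>R t) (tan_jacobian \<Gamma> wdot) (at_right 0)" by blast
    ultimately show "uniform_limit \<Gamma> (\<lambda>t y. (tan_jacobian \<Gamma> (u t) y - tan_jacobian \<Gamma> (w \<Gamma>) y) /\<^sub>R t) (tan_jacobian \<Gamma> wdot) (at_right 0)" by blast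
  qed
  note nor = C1_boundary_normal(2)[OF C1]
  have R: "has_uniform_derivative \<Gamma> (\<lambda>t y. transported_projection (K t y) (outward_normal \<Gamma> y))
    (\<lambda>y. tangential_projection (outward_normal \<Gamma> y)) (\<lambda>y. transported_projection_rate (matrix (fderiv (V 0) y)) (outward_normal \<Gamma> y))"
    by (rule has_uniform_derivative_transported_projection[OF Ju KJ nor])
  have tr: "\<forall>\<^sub>F t in at_right 0. w (x t ` \<Gamma>) \<in> Ck_boundary 1 (x t ` \<Gamma>) \<and> (\<forall>y\<in>\<Gamma>. tan_jacobian \<Gamma> (u t) y ** transported_projection (K t y) (outward_normal \<Gamma> y) =
       tan_jacobian (x t ` \<Gamma>) (w (x t ` \<Gamma>)) (x t y))"
    using diff uC pos
  proof eventually_elim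
    case (elim t)
    then show ?case
      using tan_jacobian_transport[OF C1, of "x t" "inv (x t)" "u t" "w (x t ` \<Gamma>)"] uw[OF elim(3)] by (simp add: K_def)
  qed
  show "has_uniform_derivative \<Gamma> (\<lambda>t y. tan_jacobian (x t ` \<Gamma>) (w (x t ` \<Gamma>)) (x t y)) (tan_jacobian \<Gamma> (w \<Gamma>))
     (\<lambda>y. tan_jacobian \<Gamma> wdot y ** tangential_projection (outward_normal \<Gamma> y) +
          tan_jacobian \<Gamma> (w \<Gamma>) y ** transported_projection_rate (matrix (fderiv (V 0) y)) (outward_normal \<Gamma> y))"
  proof (rule has_uniform_derivative_cong[OF has_uniform_derivative_bilinear[OF bounded_bilinear_matrix_matrix Au R]])
    show "tan_jacobian \<Gamma> (w \<Gamma>) y ** tangential_projection (outward_normal \<Gamma> y) = tan_jacobian \<Gamma> (w \<Gamma>) y" if "y \<in> \<Gamma>" for y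
      unfolding matrix_eq using that w0 C1
      by (simp add: matrix_vector_mul_assoc[symmetric] tangential_projection_mult tan_jacobian_mult tan_deriv_tangential_part)
    show "\<forall>\<^sub>F t in at_right 0. \<forall>y\<in>\<Gamma>. tan_jacobian \<Gamma> (u t) y ** transported_projection (K t y) (outward_normal \<Gamma> y) =
       tan_jacobian (x t ` \<Gamma>) (w (x t ` \<Gamma>)) (x t y)" using tr by eventually_elim blast
  qed auto
  show "\<forall>\<^sub>F t in at_right 0. continuous_on \<Gamma> (\<lambda>y. tan_jacobian (x t ` \<Gamma>) (w (x t ` \<Gamma>)) (x t y) *v e)"
    using diff tr
  proof eventually_elim
    case (elim t)
    have "continuous_on (x t ` \<Gamma>) (tan_deriv (x t ` \<Gamma>) (w (x t ` \<Gamma>)) e)"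
      using elim C1_boundary_image[OF C1] by (intro continuous_on_tan_deriv) auto
    moreover have "continuous_on \<Gamma> (x t)" using elim Ck_on_imp_continuous continuous_on_subset by blast
    ultimately have "continuous_on \<Gamma> (\<lambda>y. tan_deriv (x t ` \<Gamma>) (w (x t ` \<Gamma>)) e (x t y))"
      by (rule continuous_on_compose2) auto
    then show ?case using elim by (simp add: tan_jacobian_mult cong: continuous_on_cong)
  qed
qed

section \<open>The shape derivatives\<close>

text \<open>The linear algebra behind the formula for the shape derivative, at a point with normal \<open>n\<close> and
velocity \<open>v\<close>. Here \<open>DN\<close> and \<open>Dv\<close> are the derivatives of the normal and the velocity, \<open>g\<close> is the
transpose of \<open>Dv\<close> applied to \<open>n\<close>, and \<open>G\<close> is the tangential gradient of the normal velocity.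
On the left, the three groups come from the rate of the transported projection and from the
derivatives of the tangential parts of \<open>v\<close> and of \<open>e\<close>. The key identity is
\<open>G = P g + DN (P v)\<close> with the tangential projection \<open>P\<close>; it rests on the symmetry of \<open>DN\<close>, which also cancels the
remaining multiples of \<open>n\<close>.\<close>

lemma moving_normal_algebra:
  fixes n v e g G :: "'a::real_inner" and DN Dv :: "'a \<Rightarrow> 'a"
  assumes n: "norm n = 1" and g: "\<And>a. g \<bullet> a = n \<bullet> Dv a"
    and DNn: "\<And>a. n \<bullet> DN a = 0"
    and sym: "\<And>\<sigma> \<tau>. n \<bullet> \<sigma> = 0 \<Longrightarrow> n \<bullet> \<tau> = 0 \<Longrightarrow> DN \<sigma> \<bullet> \<tau> = DN \<tau> \<bullet> \<sigma>"
    and G: "\<And>a. G \<bullet> a = n \<bullet> Dv (tangential_part n a) + v \<bullet> DN (tangential_part n a)"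
  shows "tangential_part n (((n \<bullet> e) *\<^sub>R g + (g \<bullet> e) *\<^sub>R n - (2 * (g \<bullet> n)) *\<^sub>R ((n \<bullet> e) *\<^sub>R n)) - Dv (tangential_part n e)) +
      (Dv (tangential_part n e) - (DN (tangential_part n e) \<bullet> v + n \<bullet> Dv (tangential_part n e)) *\<^sub>R n - (n \<bullet> v) *\<^sub>R DN (tangential_part n e)) -
      (- ((DN (tangential_part n v) \<bullet> e) *\<^sub>R n) - (n \<bullet> e) *\<^sub>R DN (tangential_part n v))
    = tangential_part n ((n \<bullet> e) *\<^sub>R G - (n \<bullet> v) *\<^sub>R DN (tangential_part n e))"
proof -
  define P where "P = tangential_part n"
  have P: "P a = a - (n \<bullet> a) *\<^sub>R n" for a by (simp add: P_def tangential_part_def)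
  have nn: "n \<bullet> n = 1" using n by (simp add: dot_square_norm)
  have nP: "n \<bullet> P a = 0" for a by (simp add: P inner_diff_right nn)
  have DP: "DN a \<bullet> P b = DN a \<bullet> b" for a b using DNn[of a] by (simp add: P inner_diff_right inner_commute)
  have s: "DN (P a) \<bullet> b = DN (P b) \<bullet> a" for a b
    using sym[OF nP nP, of a b] by (simp add: DP)
  have "G \<bullet> a = (P g + DN (P v)) \<bullet> a" for a
  proof -
    have "n \<bullet> Dv (P a) = P g \<bullet> a" using g[of "P a"] by (simp add: P inner_diff_left inner_diff_right inner_commute mult.commute)
    moreover have "v \<bullet> DN (P a) = DN (P v) \<bullet> a" using s[of a v] by (simp add: inner_commute)
    ultimately show ?thesis using G[of a] by (simp add: P_def inner_add_left)
  qed
  then have "G = P g + DN (P v)" by (metis vector_eq_rdot)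
  moreover have "P (P g) = P g" "P (DN a) = DN a" for a using nP DNn by (simp_all add: P[of "P g"] P[of "DN a"])
  moreover have "linear P" unfolding P_def by (rule linear_tangential_part)
  moreover have "P n = 0" by (simp add: P nn)
  moreover have "DN (P v) \<bullet> e = DN (P e) \<bullet> v" by (rule s)
  moreover have "P (Dv (P e)) = Dv (P e) - (n \<bullet> Dv (P e)) *\<^sub>R n" by (rule P)
  ultimately show ?thesis
    unfolding P_def[symmetric]
    by (simp add: linear_add linear_diff linear_scale) (simp add: algebra_simps)
qed

text \<open>On \<open>\<Gamma>\<close> the tangential Jacobian applied to \<open>a\<close> is the derivative of \<open>W\<close> in the direction of the
tangential part of \<open>a\<close>, an expression that makes sense near \<open>\<Gamma>\<close> and can be differentiated by
\<open>has_derivative_frechet_apply\<close>. The two uses are \<open>a = v\<close> and \<open>a\<close> constant.\<close>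

lemma tan_deriv_tan_jacobian_apply:
  fixes w W N a :: "real^'n \<Rightarrow> real^'n"
  assumes C1: "C1_boundary \<Gamma>"
    and W: "open B" "\<Gamma> \<subseteq> B" "Ck_on 2 W B" "\<And>z. z \<in> \<Gamma> \<Longrightarrow> W z = w z"
    and N: "open U" "\<Gamma> \<subseteq> U" "Ck_on 1 N U" "\<And>z. z \<in> \<Gamma> \<Longrightarrow> N z = outward_normal \<Gamma> z"
    and a: "Ck_on 1 a UNIV"
  shows "(\<lambda>z. tan_jacobian \<Gamma> w z *v a z) \<in> Ck_boundary 1 \<Gamma>"
    and "y \<in> \<Gamma> \<Longrightarrow> tan_deriv \<Gamma> (\<lambda>z. tan_jacobian \<Gamma> w z *v a z) e y =
      fderiv (\<lambda>z. fderiv W z (tangential_part (N y) (a y))) y (tangential_part (N y) e) +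
      fderiv W y (fderiv a y (tangential_part (N y) e) -
         (fderiv N y (tangential_part (N y) e) \<bullet> a y + N y \<bullet> fderiv a y (tangential_part (N y) e)) *\<^sub>R N y -
         (N y \<bullet> a y) *\<^sub>R fderiv N y (tangential_part (N y) e))"
proof -
  have W1: "Ck_on 1 W B" by (rule Ck_on_mono[OF W(3)]) simp
  have ext: "extends_Ck 1 \<Gamma> w W" using W W1 by (auto simp: extends_Ck_def)
  have wC: "w \<in> Ck_boundary 1 \<Gamma>" using ext by (auto simp: Ck_boundary_def)
  define E where "E z = fderiv W z (tangential_part (N z) (a z))" for z
  have Eq: "E z = tan_jacobian \<Gamma> w z *v a z" if "z \<in> \<Gamma>" for z
    using that wC by (simp add: E_def tan_jacobian_mult tan_deriv_extends[OF C1 that ext] N(4))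
  have o: "open (B \<inter> U)" using W(1) N(1) by auto
  have "Ck_on 1 (\<lambda>z. tangential_part (N z) (a z)) (B \<inter> U)"
    unfolding tangential_part_def
    by (intro Ck_on_diff Ck_on_scaleR Ck_on_inner o Ck_on_subset[OF N(3)] Ck_on_subset[OF a]) auto
  then have E1: "Ck_on 1 E (B \<inter> U)"
    unfolding E_def[abs_def] using W(3) by (intro Ck_on_frechet_apply o) (auto simp: numeral_2_eq_2 intro: Ck_on_subset simp del: Ck_on.simps)
  show mem: "(\<lambda>z. tan_jacobian \<Gamma> w z *v a z) \<in> Ck_boundary 1 \<Gamma>"
    by (rule Ck_boundaryI[OF o _ E1 Eq]) (use W(2) N(2) in auto)
  assume y: "y \<in> \<Gamma>"
  define DN where "DN = fderiv N y"
  define Da where "Da = fderiv a y"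
  have N': "(N has_derivative DN) (at y)" using Ck_on_1_has_derivative[OF N(3)] N(2) y by (auto simp: DN_def)
  have a': "(a has_derivative Da) (at y)" using Ck_on_1_has_derivative[OF a] by (simp add: Da_def)
  have "((\<lambda>z. a z - (N z \<bullet> a z) *\<^sub>R N z) has_derivative
     (\<lambda>\<tau>. Da \<tau> - ((N y \<bullet> a y) *\<^sub>R DN \<tau> + (N y \<bullet> Da \<tau> + DN \<tau> \<bullet> a y) *\<^sub>R N y))) (at y)"
    by (intro has_derivative_diff has_derivative_scaleR has_derivative_inner N' a')
  then have u': "((\<lambda>z. tangential_part (N z) (a z)) has_derivative
     (\<lambda>\<tau>. Da \<tau> - (DN \<tau> \<bullet> a y + N y \<bullet> Da \<tau>) *\<^sub>R N y - (N y \<bullet> a y) *\<^sub>R DN \<tau>)) (at y)"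
    unfolding tangential_part_def by (rule has_derivative_eq_rhs) (simp add: fun_eq_iff algebra_simps)
  have "y \<in> B" using y W(2) by blast
  from tan_deriv_eq[OF C1 y mem has_derivative_frechet_apply[OF W(1,3) this u', folded E_def] Eq, of e]
  show "tan_deriv \<Gamma> (\<lambda>z. tan_jacobian \<Gamma> w z *v a z) e y =
      fderiv (\<lambda>z. fderiv W z (tangential_part (N y) (a y))) y (tangential_part (N y) e) +
      fderiv W y (fderiv a y (tangential_part (N y) e) -
         (fderiv N y (tangential_part (N y) e) \<bullet> a y + N y \<bullet> fderiv a y (tangential_part (N y) e)) *\<^sub>R N y -
         (N y \<bullet> a y) *\<^sub>R fderiv N y (tangential_part (N y) e))"
    using N(4)[OF y] by (simp add: DN_def Da_def)
qed

text \<open>Differentiate \<open>N \<bullet> N = 1\<close>.\<close>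

lemma outward_normal_derivative_orthogonal:
  fixes N :: "real^'n \<Rightarrow> real^'n"
  assumes "open U" "y \<in> U" "Ck_on 1 N U" "\<And>z. z \<in> U \<Longrightarrow> norm (N z) = 1"
  shows "N y \<bullet> fderiv N y e = 0"
proof -
  have N': "(N has_derivative fderiv N y) (at y)" using Ck_on_1_has_derivative[OF assms(3,2)] .
  have "((\<lambda>z. N z \<bullet> N z) has_derivative (\<lambda>e. 0)) (at y)"
    by (rule has_derivative_transform_within_open[OF has_derivative_const[of "1::real"] assms(1,2)])
      (simp add: dot_square_norm assms(4))
  from fun_cong[OF has_derivative_unique[OF this has_derivative_inner[OF N' N']], of e]
  show ?thesis by (simp add: inner_commute)
qed

text \<open>The left hand side is the material derivative of \<open>(D\<^sub>\<Gamma> w) e\<close> minus its transport term. Inserting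
\<open>w' = wdot - (D\<^sub>\<Gamma> w) v\<close> leaves the commutator of the tangential derivatives in the directions of \<open>e\<close>
and \<open>v\<close> (up to terms of first order); the second derivatives \<open>H\<close> of the extension cancel by symmetry and
\<open>moving_normal_algebra\<close> evaluates the rest.\<close>

lemma material_minus_transport_tan_jacobian:
  fixes \<Gamma> :: "(real^'n) set" and V :: "real \<Rightarrow> real^'n \<Rightarrow> real^'n"
  assumes C1: "C1_boundary \<Gamma>"
    and W: "open B" "\<Gamma> \<subseteq> B" "Ck_on 2 W B" "\<And>z. z \<in> \<Gamma> \<Longrightarrow> W z = w z"
    and N: "open U" "\<Gamma> \<subseteq> U" "Ck_on 1 N U" "\<And>z. z \<in> \<Gamma> \<Longrightarrow> N z = outward_normal \<Gamma> z"
      "\<And>z. z \<in> U \<Longrightarrow> norm (N z) = 1"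
      "\<And>y \<sigma> \<tau>. y \<in> \<Gamma> \<Longrightarrow> N y \<bullet> \<sigma> = 0 \<Longrightarrow> N y \<bullet> \<tau> = 0 \<Longrightarrow>
       fderiv N y \<sigma> \<bullet> \<tau> = fderiv N y \<tau> \<bullet> \<sigma>"
    and v: "Ck_on 1 (V 0) UNIV" and wdot: "wdot \<in> Ck_boundary 1 \<Gamma>"
    and w': "\<And>y. y \<in> \<Gamma> \<Longrightarrow> w' y = wdot y - tan_jacobian \<Gamma> w y *v V 0 y"
    and y: "y \<in> \<Gamma>"
  shows "(tan_jacobian \<Gamma> wdot y ** tangential_projection (outward_normal \<Gamma> y) +
          tan_jacobian \<Gamma> w y ** transported_projection_rate (matrix (fderiv (V 0) y)) (outward_normal \<Gamma> y)) *v e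
      - tan_jacobian \<Gamma> (\<lambda>z. tan_jacobian \<Gamma> w z *v e) y *v V 0 y =
     (tan_jacobian \<Gamma> w' y + tan_jacobian \<Gamma> w y **
                  (outer (tan_grad \<Gamma> (normal_velocity V \<Gamma>) y) (outward_normal \<Gamma> y) -
                   normal_velocity V \<Gamma> y *\<^sub>R tan_jacobian \<Gamma> (outward_normal \<Gamma>) y)) *v e"
proof -
  define n where "n = outward_normal \<Gamma> y"
  define P where "P = tangential_part n"
  define DW where "DW = fderiv W y"
  define H where "H b c = fderiv (\<lambda>z. fderiv W z b) y c" for b c
  define DN where "DN = fderiv N y"
  define Dv where "Dv = fderiv (V 0) y"
  define g where "g = transpose (matrix Dv) *v n"
  define vn where "vn = normal_velocity V \<Gamma>"
  define G where "G = tan_grad \<Gamma> vn y"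
  have Ny: "N y = n" using N(4)[OF y] by (simp add: n_def)
  have yO: "y \<in> B" and yU: "y \<in> U" using y W(2) N(2) by auto
  have n1: "norm n = 1" using N(5)[OF yU] Ny by simp
  have W1: "Ck_on 1 W B" by (rule Ck_on_mono[OF W(3)]) simp
  have ext: "extends_Ck 1 \<Gamma> w W" using W W1 by (auto simp: extends_Ck_def)
  have wC: "w \<in> Ck_boundary 1 \<Gamma>" using ext by (auto simp: Ck_boundary_def)
  have extN: "extends_Ck 1 \<Gamma> (outward_normal \<Gamma>) N" using N by (auto simp: extends_Ck_def)
  have NC: "outward_normal \<Gamma> \<in> Ck_boundary 1 \<Gamma>" using extN by (auto simp: Ck_boundary_def)
  have linDW: "linear DW" using has_derivative_linear[OF Ck_on_1_has_derivative[OF W1 yO]] by (simp add: DW_def)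
  have v': "(V 0 has_derivative Dv) (at y)" using Ck_on_1_has_derivative[OF v] by (simp add: Dv_def)
  have N': "(N has_derivative DN) (at y)" using Ck_on_1_has_derivative[OF N(3) yU] by (simp add: DN_def)
  have linDv: "linear Dv" using has_derivative_linear[OF v'] .
  have mDv: "matrix Dv *v b = Dv b" for b using linDv by (simp add: matrix_works linear_matrix_vector_mul_eq)
  have ga: "g \<bullet> b = n \<bullet> Dv b" for b by (simp add: g_def dot_lmul_matrix mDv)
  have A0: "tan_jacobian \<Gamma> w y *v b = DW (P b)" for b
    using tan_jacobian_mult[OF y wC] tan_deriv_extends[OF C1 y ext] by (simp add: DW_def P_def n_def)
  have vne: "N z \<bullet> V 0 z = vn z" if "z \<in> \<Gamma>" for z using N(4)[OF that] by (simp add: vn_def normal_velocity_def inner_commute)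
  have vnC: "vn \<in> Ck_boundary 1 \<Gamma>"
    by (rule Ck_boundaryI[OF N(1,2) Ck_on_inner[OF N(1) N(3) Ck_on_subset[OF v]] vne]) auto
  have Ga: "G \<bullet> b = n \<bullet> Dv (P b) + V 0 y \<bullet> DN (P b)" for b
    using tan_grad_inner[OF y vnC] tan_deriv_eq[OF C1 y vnC has_derivative_inner[OF N' v'] vne]
    by (simp add: G_def P_def n_def[symmetric] Ny inner_commute)
  have DNn: "n \<bullet> DN b = 0" for b
    using outward_normal_derivative_orthogonal[OF N(1) yU N(3,5)] Ny by (simp add: DN_def)
  have sym: "DN \<sigma> \<bullet> \<tau> = DN \<tau> \<bullet> \<sigma>" if "n \<bullet> \<sigma> = 0" "n \<bullet> \<tau> = 0" for \<sigma> \<tau>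
    using N(6)[OF y] that Ny by (simp add: DN_def)
  have Dn: "tan_jacobian \<Gamma> (outward_normal \<Gamma>) y *v b = DN (P b)" for b
    using tan_jacobian_mult[OF y NC] tan_deriv_extends[OF C1 y extN] by (simp add: DN_def P_def n_def)
  have Hs: "H b c = H c b" for b c unfolding H_def by (rule second_derivative_symmetric[OF W(1,3) yO])
  note app = tan_deriv_tan_jacobian_apply[OF C1 W N(1-4)]
  have vC: "(\<lambda>z. tan_jacobian \<Gamma> w z *v V 0 z) \<in> Ck_boundary 1 \<Gamma>" by (rule app(1)[OF _ _ v])
  have 1: "tan_deriv \<Gamma> (\<lambda>z. tan_jacobian \<Gamma> w z *v V 0 z) e y =
      H (P (V 0 y)) (P e) + DW (Dv (P e) - (DN (P e) \<bullet> V 0 y + n \<bullet> Dv (P e)) *\<^sub>R n - (n \<bullet> V 0 y) *\<^sub>R DN (P e))"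
    using app(2)[OF _ _ v y, of e] by (simp add: H_def DW_def Dv_def DN_def P_def Ny)
  have c1: "Ck_on 1 (\<lambda>z. e) UNIV" by (rule Ck_on_const) simp
  have eC: "(\<lambda>z. tan_jacobian \<Gamma> w z *v e) \<in> Ck_boundary 1 \<Gamma>" by (rule app(1)[OF _ _ c1])
  have 2: "tan_deriv \<Gamma> (\<lambda>z. tan_jacobian \<Gamma> w z *v e) (V 0 y) y =
      H (P e) (P (V 0 y)) + DW (- ((DN (P (V 0 y)) \<bullet> e) *\<^sub>R n) - (n \<bullet> e) *\<^sub>R DN (P (V 0 y)))"
    using app(2)[OF _ _ c1 y, of "V 0 y"] by (simp add: H_def DW_def DN_def P_def Ny)
  have w'C: "(\<lambda>z. wdot z + (-1) *\<^sub>R (tan_jacobian \<Gamma> w z *v V 0 z)) \<in> Ck_boundary 1 \<Gamma>" by (rule Ck_boundary_add_scaleR[OF wdot vC])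
  have 3: "tan_jacobian \<Gamma> w' y *v e = tan_deriv \<Gamma> wdot e y - tan_deriv \<Gamma> (\<lambda>z. tan_jacobian \<Gamma> w z *v V 0 z) e y"
  proof -
    have "tan_jacobian \<Gamma> w' = tan_jacobian \<Gamma> (\<lambda>z. wdot z + (-1) *\<^sub>R (tan_jacobian \<Gamma> w z *v V 0 z))"
      by (rule tan_jacobian_cong) (simp add: w')
    then show ?thesis
      using tan_jacobian_mult[OF y w'C] tan_deriv_add_scaleR[OF C1 y wdot vC, of "-1" e] by simp
  qed
  have 4: "tan_jacobian \<Gamma> wdot y *v (P e) = tan_deriv \<Gamma> wdot e y"
    unfolding tan_jacobian_mult[OF y wdot] P_def n_def by (rule tan_deriv_tangential_part[OF C1 y wdot])
  have rate: "transported_projection_rate (matrix Dv) n *v e =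
      ((n \<bullet> e) *\<^sub>R g + (g \<bullet> e) *\<^sub>R n - (2 * (g \<bullet> n)) *\<^sub>R ((n \<bullet> e) *\<^sub>R n)) - Dv (P e)"
    unfolding transported_projection_rate_def Let_def g_def[symmetric]
    by (simp add: matrix_vector_mult_diff_rdistrib
        matrix_vector_mult_add_rdistrib outer_mult_vec scaleR_matrix_vector_assoc[symmetric] matrix_vector_mul_assoc[symmetric]
        tangential_projection_mult mDv P_def)
  have "(tan_jacobian \<Gamma> wdot y ** tangential_projection n + tan_jacobian \<Gamma> w y ** transported_projection_rate (matrix Dv) n) *v e
      - tan_jacobian \<Gamma> (\<lambda>z. tan_jacobian \<Gamma> w z *v e) y *v V 0 y - tan_jacobian \<Gamma> w' y *v e
     = DW (P (transported_projection_rate (matrix Dv) n *v e)) + tan_deriv \<Gamma> (\<lambda>z. tan_jacobian \<Gamma> w z *v V 0 z) e y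
       - tan_deriv \<Gamma> (\<lambda>z. tan_jacobian \<Gamma> w z *v e) (V 0 y) y"
    by (simp add: matrix_vector_mult_add_rdistrib matrix_vector_mul_assoc[symmetric] tangential_projection_mult
        P_def[symmetric] 3 4 A0 tan_jacobian_mult[OF y eC])
  also have "\<dots> = DW (P (transported_projection_rate (matrix Dv) n *v e) +
      (Dv (P e) - (DN (P e) \<bullet> V 0 y + n \<bullet> Dv (P e)) *\<^sub>R n - (n \<bullet> V 0 y) *\<^sub>R DN (P e)) -
      (- ((DN (P (V 0 y)) \<bullet> e) *\<^sub>R n) - (n \<bullet> e) *\<^sub>R DN (P (V 0 y))))"
    unfolding 1 2 Hs[of "P e"] linear_add[OF linDW] linear_diff[OF linDW] by (simp add: algebra_simps)
  also have "\<dots> = DW (P ((n \<bullet> e) *\<^sub>R G - (n \<bullet> V 0 y) *\<^sub>R DN (P e)))"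
    unfolding rate P_def by (rule arg_cong[OF moving_normal_algebra[OF n1 ga DNn sym Ga[unfolded P_def]]])
  also have "\<dots> = (tan_jacobian \<Gamma> w y ** (outer G n - vn y *\<^sub>R tan_jacobian \<Gamma> (outward_normal \<Gamma>) y)) *v e"
    by (simp add: matrix_vector_mul_assoc[symmetric] A0 matrix_vector_mult_diff_rdistrib outer_mult_vec
        scaleR_matrix_vector_assoc[symmetric] Dn vne[OF y, symmetric] Ny)
  finally show ?thesis
    by (simp add: n_def Dv_def G_def vn_def matrix_vector_mult_add_rdistrib algebra_simps)
qed

lemma has_material_derivative_1I:
  fixes z :: "(real^'n) set \<Rightarrow> real^'n \<Rightarrow> 'b::euclidean_space"
  assumes "compact \<Gamma>" "z \<Gamma> \<in> Ck_boundary 1 \<Gamma>"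
    and "\<forall>\<^sub>F t in at_right 0. continuous_on \<Gamma> (\<lambda>y. z (x t ` \<Gamma>) (x t y))"
    and der: "has_uniform_derivative \<Gamma> (\<lambda>t y. z (x t ` \<Gamma>) (x t y)) (z \<Gamma>) zdot"
  shows "has_material_derivative 1 x \<Gamma> z zdot"
proof -
  have c: "continuous_on \<Gamma> (z \<Gamma>)" using Ck_boundary_imp_continuous[OF assms(2)] .
  have q: "\<forall>\<^sub>F t in at_right 0. continuous_on \<Gamma> (\<lambda>y. (z (x t ` \<Gamma>) (x t y) - z \<Gamma> y) /\<^sub>R t)"
    using assms(3) by eventually_elim (intro continuous_intros c)
  moreover have ul: "uniform_limit \<Gamma> (\<lambda>t y. (z (x t ` \<Gamma>) (x t y) - z \<Gamma> y) /\<^sub>R t) zdot (at_right 0)"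
    using der by (simp add: has_uniform_derivative_def)
  ultimately have "continuous_on \<Gamma> zdot" by (rule uniform_limit_theorem) simp
  then show ?thesis
    using assms(2) q ul by (simp add: has_material_derivative_def Ck_boundary_limit_def Ck_boundary_0_iff[OF assms(1)])
qed

text \<open>This converts the trace of the tensor formula, in which \<open>D\<^sub>\<Gamma> n\<close> occurs, into the scalar product of
tensors, in which its transpose occurs.\<close>

lemma shape_operator_symmetric:
  fixes N :: "real^'n \<Rightarrow> real^'n"
  assumes C1: "C1_boundary \<Gamma>" and y: "y \<in> \<Gamma>"
    and N: "open U" "\<Gamma> \<subseteq> U" "Ck_on 1 N U" "\<And>z. z \<in> U \<Longrightarrow> norm (N z) = 1"
      "\<And>z. z \<in> \<Gamma> \<Longrightarrow> N z = outward_normal \<Gamma> z"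
      "\<And>\<sigma> \<tau>. N y \<bullet> \<sigma> = 0 \<Longrightarrow> N y \<bullet> \<tau> = 0 \<Longrightarrow>
       fderiv N y \<sigma> \<bullet> \<tau> = fderiv N y \<tau> \<bullet> \<sigma>"
  shows "transpose (tan_jacobian \<Gamma> (outward_normal \<Gamma>) y) = tan_jacobian \<Gamma> (outward_normal \<Gamma>) y"
proof -
  define S where "S = tan_jacobian \<Gamma> (outward_normal \<Gamma>) y"
  define DN where "DN = fderiv N y"
  define P where "P = tangential_part (N y)"
  have yU: "y \<in> U" using y N(2) by blast
  have ext: "extends_Ck 1 \<Gamma> (outward_normal \<Gamma>) N" using N by (auto simp: extends_Ck_def)
  have NC: "outward_normal \<Gamma> \<in> Ck_boundary 1 \<Gamma>" using ext by (auto simp: Ck_boundary_def)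
  have S: "S *v b = DN (P b)" for b
    using tan_jacobian_mult[OF y NC] tan_deriv_extends[OF C1 y ext] N(5)[OF y] by (simp add: S_def DN_def P_def)
  have nP: "N y \<bullet> P b = 0" for b unfolding P_def by (rule inner_tangential_part[OF N(4)[OF yU]])
  have "a \<bullet> DN b = P a \<bullet> DN b" for a b
    using outward_normal_derivative_orthogonal[OF N(1) yU N(3,4), of b]
    by (simp add: P_def tangential_part_def inner_diff_left DN_def)
  then have "a \<bullet> (S *v b) = b \<bullet> (S *v a)" for a b
    using N(6)[OF nP nP, of a b] by (simp add: S DN_def inner_commute)
  from this[of "axis _ 1" "axis _ 1"] have "S $ i $ j = S $ j $ i" for i j
    by (simp add: matrix_vector_mult_basis column_def inner_axis')
  then show ?thesis by (simp add: S_def[symmetric] transpose_def vec_eq_iff)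
qed

lemma tan_deriv_sum_components:
  fixes b :: "'n \<Rightarrow> real^'n \<Rightarrow> real^'n"
  assumes C1: "C1_boundary \<Gamma>" and b: "\<And>i. b i \<in> Ck_boundary 1 \<Gamma>"
  shows "(\<lambda>y. \<Sum>i\<in>UNIV. b i y $ i) \<in> Ck_boundary 1 \<Gamma>"
    and "y \<in> \<Gamma> \<Longrightarrow> tan_deriv \<Gamma> (\<lambda>y. \<Sum>i\<in>UNIV. b i y $ i) e y = (\<Sum>i\<in>UNIV. tan_deriv \<Gamma> (b i) e y $ i)"
proof -
  define B where "B i = C1_extension \<Gamma> (b i)" for i
  have B: "extends_Ck 1 \<Gamma> (b i) (B i)" for i unfolding B_def by (rule C1_extension_extends[OF b])
  then have "\<exists>U. open U \<and> \<Gamma> \<subseteq> U \<and> Ck_on 1 (B i) U" for i by (simp add: extends_Ck_def)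
  then obtain U where U: "\<And>i. open (U i)" "\<And>i. \<Gamma> \<subseteq> U i" "\<And>i. Ck_on 1 (B i) (U i)" by metis
  have o: "open (\<Inter>i. U i)" using U(1) by (intro open_INT) auto
  have eq: "(\<Sum>i\<in>UNIV. B i z $ i) = (\<Sum>i\<in>UNIV. b i z $ i)" if "z \<in> \<Gamma>" for z
    using B that by (simp add: extends_Ck_def)
  have S1: "Ck_on 1 (\<lambda>y. \<Sum>i\<in>UNIV. B i y $ i) (\<Inter>i. U i)"
    by (intro Ck_on_sum o Ck_on_bounded_linear[OF bounded_linear_vec_nth o] Ck_on_subset[OF U(3)]) auto
  show mem: "(\<lambda>y. \<Sum>i\<in>UNIV. b i y $ i) \<in> Ck_boundary 1 \<Gamma>"
    by (rule Ck_boundaryI[OF o _ S1 eq]) (use U(2) in auto)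
  assume y: "y \<in> \<Gamma>"
  have "((\<lambda>y. \<Sum>i\<in>UNIV. B i y $ i) has_derivative (\<lambda>e. \<Sum>i\<in>UNIV. fderiv (B i) y e $ i)) (at y)"
    by (intro has_derivative_sum bounded_linear.has_derivative[OF bounded_linear_vec_nth] extends_Ck_differentiable[OF B y])
  from tan_deriv_eq[OF C1 y mem this eq, of e]
  show "tan_deriv \<Gamma> (\<lambda>y. \<Sum>i\<in>UNIV. b i y $ i) e y = (\<Sum>i\<in>UNIV. tan_deriv \<Gamma> (b i) e y $ i)"
    by (simp add: tan_deriv_extends[OF C1 y B])
qed

theorem corollary36:
  fixes D \<Gamma> :: "(real^'n) set"
    and V x :: "real \<Rightarrow> real^'n \<Rightarrow> real^'n"
    and \<epsilon> :: real
    and z :: "(real^'n) set \<Rightarrow> real^'n \<Rightarrow> real"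
    and z' :: "real^'n \<Rightarrow> real"
    and w :: "(real^'n) set \<Rightarrow> real^'n \<Rightarrow> real^'n"
    and w' :: "real^'n \<Rightarrow> real^'n"
  assumes "open D"
    and "admissible_boundary 2 D \<Gamma>"
    and "0 < \<epsilon>"
    and "velocity_field 2 D \<epsilon> V"
    and "trajectories \<epsilon> V x"
    and "has_shape_derivative 2 V x \<Gamma> z z'"
    and "has_shape_derivative_vec 2 V x \<Gamma> w w'"
  shows "has_shape_derivative_tensor 1 V x \<Gamma> (\<lambda>\<Gamma>. tan_jacobian \<Gamma> (w \<Gamma>))
           (\<lambda>y. tan_jacobian \<Gamma> w' y +
                tan_jacobian \<Gamma> (w \<Gamma>) y **
                  (outer (tan_grad \<Gamma> (normal_velocity V \<Gamma>) y) (outward_normal \<Gamma> y) -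
                   normal_velocity V \<Gamma> y *\<^sub>R tan_jacobian \<Gamma> (outward_normal \<Gamma>) y)) \<and>
         has_shape_derivative 1 V x \<Gamma> (\<lambda>\<Gamma>. tan_div \<Gamma> (w \<Gamma>))
           (\<lambda>y. tan_div \<Gamma> w' y +
                tensor_inner
                  (outer (outward_normal \<Gamma> y) (tan_grad \<Gamma> (normal_velocity V \<Gamma>) y) -
                   normal_velocity V \<Gamma> y *\<^sub>R tan_jacobian \<Gamma> (outward_normal \<Gamma>) y)
                  (tan_jacobian \<Gamma> (w \<Gamma>) y))"
proof -
  obtain \<Omega> where \<Omega>: "Ck_domain 2 \<Omega>" "frontier \<Omega> = \<Gamma>" using assms(2) by (auto simp: admissible_boundary_def)
  have C1: "C1_boundary \<Gamma>" using C2_domain_imp_C1_boundary \<Omega> by blast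
  have cpt: "compact \<Gamma>" by (rule C1_boundary_compact[OF C1])
  obtain U N where N: "open U" "\<Gamma> \<subseteq> U" "Ck_on 1 N U" "\<And>z. z \<in> U \<Longrightarrow> norm (N z) = 1"
    "\<And>y. y \<in> \<Gamma> \<Longrightarrow> N y = outward_normal \<Gamma> y"
    "\<And>y \<sigma> \<tau>. y \<in> \<Gamma> \<Longrightarrow> N y \<bullet> \<sigma> = 0 \<Longrightarrow> N y \<bullet> \<tau> = 0 \<Longrightarrow>
       fderiv N y \<sigma> \<bullet> \<tau> = fderiv N y \<tau> \<bullet> \<sigma>"
    by (rule C2_boundary_normal_extension[OF \<Omega>]) (rule that)
  obtain wdot where wm: "has_material_derivative 2 x \<Gamma> w wdot"
    and w': "\<And>y. y \<in> \<Gamma> \<Longrightarrow> w' y = wdot y - tan_jacobian \<Gamma> (w \<Gamma>) y *v V 0 y"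
    using assms(7) by (auto simp: has_shape_derivative_vec_def)
  have w2: "w \<Gamma> \<in> Ck_boundary 2 \<Gamma>"
    and lim: "Ck_boundary_limit 1 \<Gamma> (\<lambda>t y. (w (x t ` \<Gamma>) (x t y) - w \<Gamma> y) /\<^sub>R t) wdot (at_right 0)"
    using wm by (auto simp: has_material_derivative_def)
  obtain W B where W: "open B" "\<Gamma> \<subseteq> B" "Ck_on 2 W B" "\<And>z. z \<in> \<Gamma> \<Longrightarrow> W z = w \<Gamma> z"
    using w2 by (auto simp: Ck_boundary_def extends_Ck_def)
  have w1: "w \<Gamma> \<in> Ck_boundary 1 \<Gamma>" using Ck_boundary_mono[OF w2] by simp
  have v1: "Ck_on 1 (V 0) UNIV" by (rule velocity_field_0_C1[OF assms(4,3)])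
  have wdC: "wdot \<in> Ck_boundary 1 \<Gamma>" by (rule Ck_boundary_limit_1D(2)[OF lim])
  define A where "A = tan_jacobian \<Gamma> (w \<Gamma>)"
  define M where "M y = tan_jacobian \<Gamma> wdot y ** tangential_projection (outward_normal \<Gamma> y) +
          A y ** transported_projection_rate (matrix (fderiv (V 0) y)) (outward_normal \<Gamma> y)" for y
  define T where "T y = tan_jacobian \<Gamma> w' y + A y **
                  (outer (tan_grad \<Gamma> (normal_velocity V \<Gamma>) y) (outward_normal \<Gamma> y) -
                   normal_velocity V \<Gamma> y *\<^sub>R tan_jacobian \<Gamma> (outward_normal \<Gamma>) y)" for y
  note md = material_derivative_tan_jacobian[OF C1 assms(4,5,3) w1 lim, folded A_def, folded M_def]
  have formula: "M y *v e - tan_jacobian \<Gamma> (\<lambda>z. A z *v e) y *v V 0 y = T y *v e" if "y \<in> \<Gamma>" for y e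
    unfolding M_def T_def A_def
    by (rule material_minus_transport_tan_jacobian[where V=V, OF C1 W N(1-3,5,4,6) v1 wdC w' that])
  have AC: "(\<lambda>y. A y *v e) \<in> Ck_boundary 1 \<Gamma>" for e
    unfolding A_def by (rule tan_deriv_tan_jacobian_apply(1)[OF C1 W N(1-3,5) Ck_on_const[OF open_UNIV]])
  have vecder: "has_material_derivative 1 x \<Gamma> (\<lambda>\<Gamma> y. tan_jacobian \<Gamma> (w \<Gamma>) y *v e) (\<lambda>y. M y *v e)" for e
  proof (rule has_material_derivative_1I[OF cpt])
    show "(\<lambda>y. tan_jacobian \<Gamma> (w \<Gamma>) y *v e) \<in> Ck_boundary 1 \<Gamma>" using AC by (simp add: A_def)
    show "\<forall>\<^sub>F t in at_right 0. continuous_on \<Gamma> (\<lambda>y. tan_jacobian (x t ` \<Gamma>) (w (x t ` \<Gamma>)) (x t y) *v e)" by (rule md(2))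
    show "has_uniform_derivative \<Gamma> (\<lambda>t y. tan_jacobian (x t ` \<Gamma>) (w (x t ` \<Gamma>)) (x t y) *v e) (\<lambda>y. tan_jacobian \<Gamma> (w \<Gamma>) y *v e) (\<lambda>y. M y *v e)"
      using has_uniform_derivative_bounded_linear[OF bounded_bilinear.bounded_linear_left[OF bounded_bilinear_matrix_vector, of e] md(1)]
      by (simp add: A_def)
  qed
  have tensor: "has_shape_derivative_tensor 1 V x \<Gamma> (\<lambda>\<Gamma>. tan_jacobian \<Gamma> (w \<Gamma>)) T"
    unfolding has_shape_derivative_tensor_def has_shape_derivative_vec_def
  proof (intro allI exI conjI ballI)
    fix e show "has_material_derivative 1 x \<Gamma> (\<lambda>\<Gamma> y. tan_jacobian \<Gamma> (w \<Gamma>) y *v e) (\<lambda>y. M y *v e)" by (rule vecder)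
    fix y assume "y \<in> \<Gamma>"
    from formula[OF this, of e]
    show "T y *v e = M y *v e - tan_jacobian \<Gamma> (\<lambda>y. tan_jacobian \<Gamma> (w \<Gamma>) y *v e) y *v V 0 y" by (simp add: A_def)
  qed
  have trc: "trace B = (\<Sum>i\<in>UNIV. (B *v axis i 1) $ i)" for B :: "real^'n^'n"
    by (simp add: trace_def matrix_vector_mult_basis column_def)
  have bt: "bounded_linear (trace :: real^'n^'n \<Rightarrow> real)"
    unfolding linear_conv_bounded_linear[symmetric] by (auto intro!: linearI simp: trace_def sum.distrib sum_distrib_left)
  have divA: "tan_div \<Gamma> (w \<Gamma>) = (\<lambda>y. trace (A y))" by (auto simp: tan_div_eq_trace A_def)
  have divC: "(\<lambda>y. trace (A y)) \<in> Ck_boundary 1 \<Gamma>" unfolding trc by (rule tan_deriv_sum_components(1)[OF C1 AC])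
  have div_deriv: "tan_deriv \<Gamma> (\<lambda>y. trace (A y)) e y = (\<Sum>i\<in>UNIV. tan_deriv \<Gamma> (\<lambda>y. A y *v axis i 1) e y $ i)" if "y \<in> \<Gamma>" for e y
    unfolding trc by (rule tan_deriv_sum_components(2)[OF C1 AC that])
  have divder: "has_material_derivative 1 x \<Gamma> (\<lambda>\<Gamma>. tan_div \<Gamma> (w \<Gamma>)) (\<lambda>y. trace (M y))"
  proof (rule has_material_derivative_1I[OF cpt])
    show "tan_div \<Gamma> (w \<Gamma>) \<in> Ck_boundary 1 \<Gamma>" using divC by (simp add: divA)
    have "\<forall>\<^sub>F t in at_right 0. \<forall>i\<in>UNIV. continuous_on \<Gamma> (\<lambda>y. tan_jacobian (x t ` \<Gamma>) (w (x t ` \<Gamma>)) (x t y) *v axis i 1)"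
      by (intro eventually_ball_finite ballI md(2)) simp
    then show "\<forall>\<^sub>F t in at_right 0. continuous_on \<Gamma> (\<lambda>y. tan_div (x t ` \<Gamma>) (w (x t ` \<Gamma>)) (x t y))"
      unfolding tan_div_eq_trace trc by eventually_elim (intro continuous_intros, auto)
    show "has_uniform_derivative \<Gamma> (\<lambda>t y. tan_div (x t ` \<Gamma>) (w (x t ` \<Gamma>)) (x t y)) (tan_div \<Gamma> (w \<Gamma>)) (\<lambda>y. trace (M y))"
      using has_uniform_derivative_bounded_linear[OF bt md(1)] by (simp add: tan_div_eq_trace divA)
  qed
  define S where "S y = outer (outward_normal \<Gamma> y) (tan_grad \<Gamma> (normal_velocity V \<Gamma>) y) -
                   normal_velocity V \<Gamma> y *\<^sub>R tan_jacobian \<Gamma> (outward_normal \<Gamma>) y" for y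
  have "has_shape_derivative 1 V x \<Gamma> (\<lambda>\<Gamma>. tan_div \<Gamma> (w \<Gamma>)) (\<lambda>y. tan_div \<Gamma> w' y + tensor_inner (S y) (A y))"
    unfolding has_shape_derivative_def
  proof (intro exI conjI ballI)
    show "has_material_derivative 1 x \<Gamma> (\<lambda>\<Gamma>. tan_div \<Gamma> (w \<Gamma>)) (\<lambda>y. trace (M y))" by (rule divder)
    fix y assume y: "y \<in> \<Gamma>"
    have tr: "transpose (tan_jacobian \<Gamma> (outward_normal \<Gamma>) y) = tan_jacobian \<Gamma> (outward_normal \<Gamma>) y"
      by (rule shape_operator_symmetric[OF C1 y N(1-5) N(6)[OF y]])
    have "transpose (B - c *\<^sub>R E) = transpose B - c *\<^sub>R transpose E" "transpose (outer a b) = outer b a"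
      for B E :: "real^'n^'n" and c and a b :: "real^'n"
      by (simp_all add: transpose_def outer_def vec_eq_iff mult.commute)
    then have "T y = tan_jacobian \<Gamma> w' y + A y ** transpose (S y)" by (simp add: T_def S_def tr)
    then have trT: "trace (T y) = tan_div \<Gamma> w' y + tensor_inner (S y) (A y)"
      by (simp add: trace_add tan_div_eq_trace tensor_inner_def trace_mul_sym[of "A y"])
    have "tan_grad \<Gamma> (tan_div \<Gamma> (w \<Gamma>)) y \<bullet> V 0 y = (\<Sum>i\<in>UNIV. tan_deriv \<Gamma> (\<lambda>y. A y *v axis i 1) (V 0 y) y $ i)"
      unfolding divA tan_grad_inner[OF y divC] by (rule div_deriv[OF y])
    also have "\<dots> = (\<Sum>i\<in>UNIV. (M y *v axis i 1 - T y *v axis i 1) $ i)"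
    proof (intro sum.cong refl)
      fix i
      show "tan_deriv \<Gamma> (\<lambda>y. A y *v axis i 1) (V 0 y) y $ i = (M y *v axis i 1 - T y *v axis i 1) $ i"
        unfolding formula[OF y, symmetric] tan_jacobian_mult[OF y AC, symmetric] by simp
    qed
    also have "\<dots> = trace (M y) - trace (T y)" unfolding trc by (simp add: sum_subtractf)
    finally show "tan_div \<Gamma> w' y + tensor_inner (S y) (A y) = trace (M y) - tan_grad \<Gamma> (tan_div \<Gamma> (w \<Gamma>)) y \<bullet> V 0 y"
      using trT by simp
  qed
  then show ?thesis using tensor unfolding T_def S_def A_def by blast
qed

end
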